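(* Suppose that $M_z\in L(H_K)^d$ is a $K$-contraction. Let $\mathscr{E}_*,\mathscr{E}$ be complex Hilbert spaces and let $W\colon\mathbb{B}_d\to L(\mathscr{E}_*,\mathscr{E})$ be a $K$-inner function. Then there exist a complex Hilbert space $H$, a pure $K$-contraction $T\in L(H)^d$ and a matrix operator $$\begin{pmatrix} T^* & B\\ C& D\end{pmatrix}\in L(H\oplus\mathscr{E}_*,H^d\oplus\mathscr{E})$$ satisfying the conditions (K1) $C^*C=\frac1K(T)$, (K2) $D^*C+B^*(\oplus\Delta_T)T^*=0$, (K3) $D^*D+B^*(\oplus\Delta_T)B=1_{\mathscr{E}_*}$, (K4) $\operatorname{Im}((\oplus j_C)B)\subset M_z^*H_K(\mathscr{E})$, such that $$W(z)=D+CF(ZT^* )ZB\qquad(z\in\mathbb{B}_d).$$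
   Context: Kernel and function spaces. Let $d\ge 1$, let $\mathbb{B}_d$ be the open Euclidean unit ball of $\mathbb{C}^d$ and $\mathbb{D}$ the open unit disc. Let $k\colon\mathbb{D}\to\mathbb{C}$, $k(z)=\sum_{n=0}^\infty a_nz^n$, be an analytic function without zeros such that $a_0=1$, $a_n>0$ for all $n$ and $0<\inf_n \frac{a_n}{a_{n+1}}\le\sup_n\frac{a_n}{a_{n+1}}<\infty$. Assume moreover that the limit $r=\lim_{n\to\infty}\frac{a_n}{a_{n+1}}$ exists (then $r\in[1,\infty)$ is the radius of convergence of $\sum a_nz^n$). Write $\frac1k(z)=\sum_{n=0}^\infty c_nz^n$ on $\mathbb{D}$ and $K(z,w)=k(\langle z,w\rangle)$ for $z,w\in\mathbb{B}_d$. Set $\gamma_\alpha=|\alpha|!/\alpha!$ for $\alpha\in\mathbb{N}^d$ ($0\in\mathbb N$). For a complex Hilbert space $\mathscr{E}$, $H_K(\mathscr{E})$ is the $\mathscr{E}$-valued functional Hilbert space on $\mathbb{B}_d$ with reproducing kernel $(z,w)\mapsto K(z,w)1_{\mathscr{E}}$; it consists of all $f=\sum_{\alpha\in\mathbb{N}^d}f_\alpha z^\alpha$ ($f_\alpha\in\mathscr{E}$) with $\|f\|^2=\sum_\alpha\frac{\|f_\alpha\|^2}{a_{|\alpha|}\gamma_\alpha}<\infty$; $H_K=H_K(\mathbb{C})$. $M_z=(M_{z_1},\dots,M_{z_d})$ is the (bounded) tuple of multiplications by the coordinate functions on $H_K$ or $H_K(\mathscr{E})$; it is also regarded as the row operator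 $M_z\colon H_K(\mathscr{E})^d\to H_K(\mathscr{E})$, $(f_i)\mapsto\sum_i z_if_i$, with adjoint the column operator $M_z^*f=(M_{z_i}^*f)_{i=1}^d$. $L(H,G)$ denotes the bounded linear operators from $H$ to $G$. $K$-contractions. For a commuting tuple $T=(T_1,\dots,T_d)\in L(H)^d$ let $\sigma_T(X)=\sum_{i=1}^dT_iXT_i^*$. $T$ is a $K$-contraction if the limit $\frac1K(T)=\text{SOT-}\sum_{n=0}^\infty c_n\sigma_T^n(1_H)$ exists and is a positive operator. It is pure if $\text{SOT-}\lim_{N\to\infty}\big(1_H-\sum_{n=0}^Na_n\sigma_T^n(\frac1K(T))\big)=0$. $T$ is also regarded as the row operator $T\colon H^d\to H$, $(x_i)\mapsto\sum_iT_ix_i$, and $T^*\colon H\to H^d$ denotes the column operator $x\mapsto(T_i^*x)_{i=1}^d$. Operators $\Delta$, $\Delta_T$, $j_C$. On $H_K(\mathscr{E})$ let $\Delta\big(\sum_{n}\sum_{|\alpha|=n}f_\alpha z^\alpha\big)=\sum_{n=0}^\infty\frac{a_{n+1}}{a_n}\sum_{|\alpha|=n}f_\alpha z^\alpha$. For a pure $K$-contraction $T\in L(H)^d$ put $C_T=(\frac1K(T))^{1/2}$, $\mathscr{D}=\overline{\operatorname{Im}C_T}$, let $j\colon H\to H_K(\mathscr{D})$ be the isometry $j(h)=\sum_\alpha a_{|\alpha|}\gamma_\alpha(C_TT^{*\alpha}h)z^\alpha$, and define $\Delta_T=j^*\Delta j\in L(H)$. For any $C\in L(H,\mathscr{E})$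 with $C^*C=\frac1K(T)$, $j_C\colon H\to H_K(\mathscr{E})$, $j_C(x)=\sum_\alpha a_{|\alpha|}\gamma_\alpha(CT^{*\alpha}x)z^\alpha$, is a well-defined isometry. $\oplus X$ denotes the $d$-fold direct sum of an operator $X$ acting componentwise on $d$-tuples. The function $F(ZT^* )$. Let $F(z)=\sum_{n=0}^\infty a_{n+1}z^n$ on the disc $D_r(0)$. For $z\in\mathbb{B}_d$ let $Z\colon H^d\to H$, $(h_i)\mapsto\sum_iz_ih_i$. For a pure $K$-contraction $T$, the operator $ZT^*=\sum_iz_iT_i^*\in L(H)$ has spectrum in $D_r(0)$ and $F(ZT^* )=\sum_{n=0}^\infty a_{n+1}\sum_{|\alpha|=n}\gamma_\alpha T^{*\alpha}z^\alpha\in L(H)$. $K$-inner functions. An operator-valued analytic function $W\colon\mathbb{B}_d\to L(\mathscr{E}_*,\mathscr{E})$ is $K$-inner if the map $\mathscr{E}_*\to H_K(\mathscr{E})$, $x\mapsto Wx$ (with $(Wx)(z)=W(z)x$), is a well-defined isometry and $W\mathscr{E}_*\perp M_z^\alpha(W\mathscr{E}_* )$ for all $\alpha\in\mathbb{N}^d\setminus\{0\}$. *)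

theory Defs
  imports "HOL-Analysis.Analysis" "HOL-Library.Function_Algebras"
begin

section \<open>Complex vector spaces\<close>

class complex_vector = ab_group_add +
  fixes scaleC :: "complex \<Rightarrow> 'a \<Rightarrow> 'a" (infixr "*\<^sub>C" 75)
  assumes scaleC_add_right: "c *\<^sub>C (x + y) = c *\<^sub>C x + c *\<^sub>C y"
    and scaleC_add_left: "(b + c) *\<^sub>C x = b *\<^sub>C x + c *\<^sub>C x"
    and scaleC_scaleC: "b *\<^sub>C (c *\<^sub>C x) = (b * c) *\<^sub>C x"
    and scaleC_one: "1 *\<^sub>C x = x"

instantiation complex :: complex_vector
begin
definition scaleC_complex :: "complex \<Rightarrow> complex \<Rightarrow> complex"
  where "scaleC_complex c x = c * x"
instance
  by standard (simp_all add: scaleC_complex_def algebra_simps)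
end

instantiation "fun" :: (type, complex_vector) complex_vector
begin
definition scaleC_fun :: "complex \<Rightarrow> ('a \<Rightarrow> 'b) \<Rightarrow> 'a \<Rightarrow> 'b"
  where "scaleC_fun c f = (\<lambda>x. c *\<^sub>C f x)"
instance
  by standard (simp_all add: scaleC_fun_def fun_eq_iff scaleC_add_right scaleC_add_left
      scaleC_scaleC scaleC_one)
end

instantiation vec :: (complex_vector, finite) complex_vector
begin
definition scaleC_vec :: "complex \<Rightarrow> 'a ^ 'b \<Rightarrow> 'a ^ 'b"
  where "scaleC_vec c v = (\<chi> i. c *\<^sub>C (v $ i))"
instance
  by standard (simp_all add: scaleC_vec_def vec_eq_iff scaleC_add_right scaleC_add_left
      scaleC_scaleC scaleC_one)
end

instantiation prod :: (complex_vector, complex_vector) complex_vector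
begin
definition scaleC_prod :: "complex \<Rightarrow> 'a \<times> 'b \<Rightarrow> 'a \<times> 'b"
  where "scaleC_prod c p = (c *\<^sub>C fst p, c *\<^sub>C snd p)"
instance
  by standard (simp_all add: scaleC_prod_def prod_eq_iff scaleC_add_right scaleC_add_left
      scaleC_scaleC scaleC_one)
end


section \<open>Complex Hilbert spaces\<close>

text \<open>A Hilbert space is given by its underlying set inside an ambient complex vector space,
  from which it takes addition and scalar multiplication, and by its inner product (linear in the
  first argument). In this way Hilbert spaces can be quantified over, and the norm
  of a function space may depend on parameters. Operators are total functions of which only the
  values on the underlying set matter.\<close>

record 'a hilbert =
  hcarrier :: "'a set"
  hinner :: "'a \<Rightarrow> 'a \<Rightarrow> complex"

definition hnorm :: "'a hilbert \<Rightarrow> 'a \<Rightarrow> real"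
  where "hnorm H x = sqrt (Re (hinner H x x))"

definition hilbert_space :: "'a::complex_vector hilbert \<Rightarrow> bool" where
  "hilbert_space H \<longleftrightarrow>
     0 \<in> hcarrier H \<and>
     (\<forall>x\<in>hcarrier H. \<forall>y\<in>hcarrier H. x + y \<in> hcarrier H) \<and>
     (\<forall>c. \<forall>x\<in>hcarrier H. c *\<^sub>C x \<in> hcarrier H) \<and>
     (\<forall>x\<in>hcarrier H. \<forall>y\<in>hcarrier H. \<forall>z\<in>hcarrier H.
        hinner H (x + y) z = hinner H x z + hinner H y z) \<and>
     (\<forall>c. \<forall>x\<in>hcarrier H. \<forall>y\<in>hcarrier H. hinner H (c *\<^sub>C x) y = c * hinner H x y) \<and>
     (\<forall>x\<in>hcarrier H. \<forall>y\<in>hcarrier H. hinner H y x = cnj (hinner H x y)) \<and>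
     (\<forall>x\<in>hcarrier H. 0 \<le> Re (hinner H x x)) \<and>
     (\<forall>x\<in>hcarrier H. hinner H x x = 0 \<longrightarrow> x = 0) \<and>
     (\<forall>X. (\<forall>n::nat. X n \<in> hcarrier H) \<and>
          (\<forall>e>0. \<exists>N. \<forall>m\<ge>N. \<forall>n\<ge>N. hnorm H (X m - X n) < e) \<longrightarrow>
          (\<exists>x\<in>hcarrier H. (\<lambda>n. hnorm H (X n - x)) \<longlonglongrightarrow> 0))"

definition htendsto :: "'a::complex_vector hilbert \<Rightarrow> ('i \<Rightarrow> 'a) \<Rightarrow> 'a \<Rightarrow> 'i filter \<Rightarrow> bool"
  where "htendsto H X y F \<longleftrightarrow> y \<in> hcarrier H \<and> ((\<lambda>n. hnorm H (X n - y)) \<longlongrightarrow> 0) F"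

definition hlim :: "'a::complex_vector hilbert \<Rightarrow> 'i filter \<Rightarrow> ('i \<Rightarrow> 'a) \<Rightarrow> 'a"
  where "hlim H F X = (THE y. htendsto H X y F)"

definition complex_hilbert :: "complex hilbert"
  where "complex_hilbert = \<lparr>hcarrier = UNIV, hinner = (\<lambda>x y. x * cnj y)\<rparr>"

definition hpower :: "'a hilbert \<Rightarrow> ('a ^ 'd) hilbert"
  where "hpower H = \<lparr>hcarrier = {v. \<forall>i. v $ i \<in> hcarrier H},
                     hinner = (\<lambda>v w. \<Sum>i\<in>UNIV. hinner H (v $ i) (w $ i))\<rparr>"

definition hdirect_sum :: "'a hilbert \<Rightarrow> 'b hilbert \<Rightarrow> ('a \<times> 'b) hilbert"
  where "hdirect_sum H G = \<lparr>hcarrier = hcarrier H \<times> hcarrier G,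
                     hinner = (\<lambda>p q. hinner H (fst p) (fst q) + hinner G (snd p) (snd q))\<rparr>"

definition closed_image ::
    "'a hilbert \<Rightarrow> 'b::complex_vector hilbert \<Rightarrow> ('a \<Rightarrow> 'b) \<Rightarrow> 'b hilbert"
  where "closed_image H G A =
    \<lparr>hcarrier = {y \<in> hcarrier G. \<forall>e>0. \<exists>x\<in>hcarrier H. hnorm G (A x - y) < e},
     hinner = hinner G\<rparr>"


section \<open>Bounded operators\<close>

definition bounded_op ::
    "'a::complex_vector hilbert \<Rightarrow> 'b::complex_vector hilbert \<Rightarrow> ('a \<Rightarrow> 'b) \<Rightarrow> bool" where
  "bounded_op H G A \<longleftrightarrow>
     (\<forall>x\<in>hcarrier H. A x \<in> hcarrier G) \<and>
     (\<forall>x\<in>hcarrier H. \<forall>y\<in>hcarrier H. A (x + y) = A x + A y) \<and>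
     (\<forall>c. \<forall>x\<in>hcarrier H. A (c *\<^sub>C x) = c *\<^sub>C A x) \<and>
     (\<exists>M. \<forall>x\<in>hcarrier H. hnorm G (A x) \<le> M * hnorm H x)"

definition hadjoint :: "'a hilbert \<Rightarrow> 'b hilbert \<Rightarrow> ('a \<Rightarrow> 'b) \<Rightarrow> 'b \<Rightarrow> 'a"
  where "hadjoint H G A y =
    (THE x. x \<in> hcarrier H \<and> (\<forall>h\<in>hcarrier H. hinner G (A h) y = hinner H h x))"

definition positive_op :: "'a hilbert \<Rightarrow> ('a \<Rightarrow> 'a) \<Rightarrow> bool"
  where "positive_op H P \<longleftrightarrow>
    (\<forall>x\<in>hcarrier H. Im (hinner H (P x) x) = 0 \<and> 0 \<le> Re (hinner H (P x) x))"

definition sqrt_op :: "'a::complex_vector hilbert \<Rightarrow> ('a \<Rightarrow> 'a) \<Rightarrow> 'a \<Rightarrow> 'a"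
  where "sqrt_op H P =
    (SOME S. bounded_op H H S \<and> positive_op H S \<and> (\<forall>x\<in>hcarrier H. S (S x) = P x))"

definition norm_limit_op ::
    "'a hilbert \<Rightarrow> 'b::complex_vector hilbert \<Rightarrow> (nat \<Rightarrow> 'a \<Rightarrow> 'b) \<Rightarrow> ('a \<Rightarrow> 'b) \<Rightarrow> bool"
  where "norm_limit_op H G A L \<longleftrightarrow>
    (\<forall>e>0. \<exists>N. \<forall>n\<ge>N. \<forall>x\<in>hcarrier H. hnorm G (A n x - L x) \<le> e * hnorm H x)"

definition dsum_op :: "('a \<Rightarrow> 'b) \<Rightarrow> 'a ^ 'd \<Rightarrow> 'b ^ 'd"
  where "dsum_op X v = (\<chi> i. X (v $ i))"

definition column_op :: "('d \<Rightarrow> 'a \<Rightarrow> 'b) \<Rightarrow> 'a \<Rightarrow> 'b ^ 'd"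
  where "column_op A x = (\<chi> i. A i x)"

definition matrix_op ::
    "('h \<Rightarrow> 'g::plus) \<Rightarrow> ('f \<Rightarrow> 'g) \<Rightarrow> ('h \<Rightarrow> 'e::plus) \<Rightarrow> ('f \<Rightarrow> 'e) \<Rightarrow> 'h \<times> 'f \<Rightarrow> 'g \<times> 'e"
  where "matrix_op A B C D = (\<lambda>(h, x). (A h + B x, C h + D x))"


section \<open>Multi-indices\<close>

type_synonym 'd multiindex = "'d \<Rightarrow> nat"

definition msize :: "'d::finite multiindex \<Rightarrow> nat"
  where "msize \<alpha> = (\<Sum>i\<in>UNIV. \<alpha> i)"

definition mgamma :: "'d::finite multiindex \<Rightarrow> real"
  where "mgamma \<alpha> = fact (msize \<alpha>) / (\<Prod>i\<in>UNIV. fact (\<alpha> i))"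

definition zpow :: "complex ^ 'd::finite \<Rightarrow> 'd multiindex \<Rightarrow> complex"
  where "zpow z \<alpha> = (\<Prod>i\<in>UNIV. (z $ i) ^ \<alpha> i)"

definition index_list :: "'d::finite list"
  where "index_list = (SOME xs. set xs = UNIV \<and> distinct xs)"

text \<open>The factors are composed along a fixed but arbitrary enumeration of the index type; for
  commuting tuples the choice is irrelevant.\<close>

definition tpow :: "('d::finite \<Rightarrow> 'a \<Rightarrow> 'a) \<Rightarrow> 'd multiindex \<Rightarrow> 'a \<Rightarrow> 'a"
  where "tpow T \<alpha> = foldr (\<lambda>i A. (T i ^^ \<alpha> i) \<circ> A) index_list id"

definition adj_tuple :: "'a hilbert \<Rightarrow> ('d \<Rightarrow> 'a \<Rightarrow> 'a) \<Rightarrow> 'd \<Rightarrow> 'a \<Rightarrow> 'a"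
  where "adj_tuple H T i = hadjoint H H (T i)"


section \<open>The spaces \<open>H_K(E)\<close>\<close>

text \<open>A function on the open unit ball of \<open>\<complex>\<^sup>d\<close> is represented by its extension by \<open>0\<close>.\<close>

definition ball_fun :: "(complex ^ 'd::finite \<Rightarrow> 'e::zero) \<Rightarrow> complex ^ 'd \<Rightarrow> 'e"
  where "ball_fun f = (\<lambda>z. if z \<in> ball 0 1 then f z else 0)"

text \<open>\<open>f(z) = \<Sum>\<^sub>\<alpha> z\<^sup>\<alpha> \<phi>\<^sub>\<alpha>\<close> on the ball, as an unordered sum in the norm of \<open>E\<close>.\<close>

definition taylor_coeffs ::
    "'e::complex_vector hilbert \<Rightarrow> (complex ^ 'd::finite \<Rightarrow> 'e) \<Rightarrow> ('d multiindex \<Rightarrow> 'e) \<Rightarrow> bool"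
  where "taylor_coeffs E f \<phi> \<longleftrightarrow>
    (\<forall>\<alpha>. \<phi> \<alpha> \<in> hcarrier E) \<and>
    (\<forall>z\<in>ball 0 1. htendsto E (\<lambda>A. \<Sum>\<alpha>\<in>A. zpow z \<alpha> *\<^sub>C \<phi> \<alpha>) (f z) (finite_subsets_at_top UNIV))"

definition coeff_of ::
    "'e::complex_vector hilbert \<Rightarrow> (complex ^ 'd::finite \<Rightarrow> 'e) \<Rightarrow> 'd multiindex \<Rightarrow> 'e"
  where "coeff_of E f = (THE \<phi>. taylor_coeffs E f \<phi>)"

definition of_coeffs ::
    "'e::complex_vector hilbert \<Rightarrow> ('d::finite multiindex \<Rightarrow> 'e) \<Rightarrow> complex ^ 'd \<Rightarrow> 'e"
  where "of_coeffs E \<phi> =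
    ball_fun (\<lambda>z. hlim E (finite_subsets_at_top UNIV) (\<lambda>A. \<Sum>\<alpha>\<in>A. zpow z \<alpha> *\<^sub>C \<phi> \<alpha>))"

definition HK ::
    "(nat \<Rightarrow> real) \<Rightarrow> 'e::complex_vector hilbert \<Rightarrow> (complex ^ 'd::finite \<Rightarrow> 'e) hilbert"
  where "HK a E =
    \<lparr>hcarrier = {f. (\<forall>z. z \<notin> ball 0 1 \<longrightarrow> f z = 0) \<and>
        (\<exists>\<phi>. taylor_coeffs E f \<phi> \<and>
             (\<lambda>\<alpha>. (hnorm E (\<phi> \<alpha>))\<^sup>2 / (a (msize \<alpha>) * mgamma \<alpha>)) summable_on UNIV)},
     hinner = (\<lambda>f g. \<Sum>\<^sub>\<infinity>\<alpha>\<in>UNIV. hinner E (coeff_of E f \<alpha>) (coeff_of E g \<alpha>)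
                       / complex_of_real (a (msize \<alpha>) * mgamma \<alpha>))\<rparr>"

definition Mz :: "'d \<Rightarrow> (complex ^ 'd \<Rightarrow> 'e::complex_vector) \<Rightarrow> complex ^ 'd \<Rightarrow> 'e"
  where "Mz i f = (\<lambda>z. (z $ i) *\<^sub>C f z)"

definition Delta ::
    "(nat \<Rightarrow> real) \<Rightarrow> 'e::complex_vector hilbert \<Rightarrow>
     (complex ^ 'd::finite \<Rightarrow> 'e) \<Rightarrow> complex ^ 'd \<Rightarrow> 'e"
  where "Delta a E f =
    of_coeffs E (\<lambda>\<alpha>. complex_of_real (a (Suc (msize \<alpha>)) / a (msize \<alpha>)) *\<^sub>C coeff_of E f \<alpha>)"


section \<open>\<open>K\<close>-contractions\<close>

text \<open>In this section \<open>c\<close> is the coefficient sequence of \<open>1/k\<close> and \<open>a\<close> that of \<open>k\<close>.\<close>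

definition commuting_tuple :: "'a::complex_vector hilbert \<Rightarrow> ('d \<Rightarrow> 'a \<Rightarrow> 'a) \<Rightarrow> bool"
  where "commuting_tuple H T \<longleftrightarrow>
    (\<forall>i. bounded_op H H (T i)) \<and> (\<forall>i j. \<forall>x\<in>hcarrier H. T i (T j x) = T j (T i x))"

definition sigma_op ::
    "'a::complex_vector hilbert \<Rightarrow> ('d::finite \<Rightarrow> 'a \<Rightarrow> 'a) \<Rightarrow> ('a \<Rightarrow> 'a) \<Rightarrow> 'a \<Rightarrow> 'a"
  where "sigma_op H T X = (\<lambda>x. \<Sum>i\<in>UNIV. T i (X (adj_tuple H T i x)))"

definition invK_partial ::
    "(nat \<Rightarrow> complex) \<Rightarrow> 'a::complex_vector hilbert \<Rightarrow> ('d::finite \<Rightarrow> 'a \<Rightarrow> 'a) \<Rightarrow> 'a \<Rightarrow> nat \<Rightarrow> 'a"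
  where "invK_partial c H T x N = (\<Sum>n\<le>N. c n *\<^sub>C (sigma_op H T ^^ n) id x)"

definition invK ::
    "(nat \<Rightarrow> complex) \<Rightarrow> 'a::complex_vector hilbert \<Rightarrow> ('d::finite \<Rightarrow> 'a \<Rightarrow> 'a) \<Rightarrow> 'a \<Rightarrow> 'a"
  where "invK c H T x = hlim H sequentially (invK_partial c H T x)"

definition K_contraction ::
    "(nat \<Rightarrow> complex) \<Rightarrow> 'a::complex_vector hilbert \<Rightarrow> ('d::finite \<Rightarrow> 'a \<Rightarrow> 'a) \<Rightarrow> bool"
  where "K_contraction c H T \<longleftrightarrow>
    commuting_tuple H T \<and>
    (\<forall>x\<in>hcarrier H. \<exists>y. htendsto H (invK_partial c H T x) y sequentially) \<and>
    bounded_op H H (invK c H T) \<and> positive_op H (invK c H T)"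

definition pure_K_contraction ::
    "(nat \<Rightarrow> real) \<Rightarrow> (nat \<Rightarrow> complex) \<Rightarrow> 'a::complex_vector hilbert \<Rightarrow>
     ('d::finite \<Rightarrow> 'a \<Rightarrow> 'a) \<Rightarrow> bool"
  where "pure_K_contraction a c H T \<longleftrightarrow>
    K_contraction c H T \<and>
    (\<forall>x\<in>hcarrier H.
       htendsto H
         (\<lambda>N. x - (\<Sum>n\<le>N. complex_of_real (a n) *\<^sub>C (sigma_op H T ^^ n) (invK c H T) x))
         0 sequentially)"

definition j_op ::
    "(nat \<Rightarrow> real) \<Rightarrow> 'a hilbert \<Rightarrow> 'e::complex_vector hilbert \<Rightarrow> ('d::finite \<Rightarrow> 'a \<Rightarrow> 'a) \<Rightarrow>
     ('a \<Rightarrow> 'e) \<Rightarrow> 'a \<Rightarrow> complex ^ 'd \<Rightarrow> 'e"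
  where "j_op a H E T C x =
    of_coeffs E (\<lambda>\<alpha>. complex_of_real (a (msize \<alpha>) * mgamma \<alpha>) *\<^sub>C C (tpow (adj_tuple H T) \<alpha> x))"

definition defect_op ::
    "(nat \<Rightarrow> complex) \<Rightarrow> 'a::complex_vector hilbert \<Rightarrow> ('d::finite \<Rightarrow> 'a \<Rightarrow> 'a) \<Rightarrow> 'a \<Rightarrow> 'a"
  where "defect_op c H T = sqrt_op H (invK c H T)"

definition defect_space ::
    "(nat \<Rightarrow> complex) \<Rightarrow> 'a::complex_vector hilbert \<Rightarrow> ('d::finite \<Rightarrow> 'a \<Rightarrow> 'a) \<Rightarrow> 'a hilbert"
  where "defect_space c H T = closed_image H H (defect_op c H T)"

definition Delta_T ::
    "(nat \<Rightarrow> real) \<Rightarrow> (nat \<Rightarrow> complex) \<Rightarrow> 'a::complex_vector hilbert \<Rightarrow>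
     ('d::finite \<Rightarrow> 'a \<Rightarrow> 'a) \<Rightarrow> 'a \<Rightarrow> 'a"
  where "Delta_T a c H T =
    (let D = defect_space c H T; j = j_op a H D T (defect_op c H T)
     in (\<lambda>x. hadjoint H (HK a D) j (Delta a D (j x))))"

definition row_Z :: "complex ^ 'd::finite \<Rightarrow> 'a::complex_vector ^ 'd \<Rightarrow> 'a"
  where "row_Z z v = (\<Sum>i\<in>UNIV. (z $ i) *\<^sub>C (v $ i))"

text \<open>\<open>F(ZT\<^sup>*) = \<Sum>\<^sub>n a\<^bsub>n+1\<^esub> \<Sum>\<^bsub>|\<alpha>|=n\<^esub> \<gamma>\<^sub>\<alpha> z\<^sup>\<alpha> T\<^sup>*\<^sup>\<alpha>\<close>, the limit being taken in operator norm.\<close>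

definition F_ZT ::
    "(nat \<Rightarrow> real) \<Rightarrow> 'a::complex_vector hilbert \<Rightarrow> ('d::finite \<Rightarrow> 'a \<Rightarrow> 'a) \<Rightarrow>
     complex ^ 'd \<Rightarrow> 'a \<Rightarrow> 'a"
  where "F_ZT a H T z = (SOME L. bounded_op H H L \<and>
    norm_limit_op H H
      (\<lambda>N x. \<Sum>n\<le>N. complex_of_real (a (Suc n)) *\<^sub>C
         (\<Sum>\<alpha> | msize \<alpha> = n. (complex_of_real (mgamma \<alpha>) * zpow z \<alpha>) *\<^sub>C tpow (adj_tuple H T) \<alpha> x))
      L)"


section \<open>\<open>K\<close>-inner functions\<close>

text \<open>Analyticity means complex (Frechet) differentiability in operator norm; a complex-linear map
  on \<open>\<complex>\<^sup>d\<close> with values in \<open>L(E', E)\<close> is given by its values \<open>L i\<close> on the unit vectors.\<close>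

definition op_analytic ::
    "'f::complex_vector hilbert \<Rightarrow> 'e::complex_vector hilbert \<Rightarrow>
     (complex ^ 'd::finite \<Rightarrow> 'f \<Rightarrow> 'e) \<Rightarrow> bool"
  where "op_analytic E' E W \<longleftrightarrow>
    (\<forall>z\<in>ball 0 1. bounded_op E' E (W z)) \<and>
    (\<forall>z\<in>ball 0 1. \<exists>L. (\<forall>i. bounded_op E' E (L i)) \<and>
       (\<forall>e>0. \<exists>\<delta>>0. \<forall>h. norm h < \<delta> \<and> z + h \<in> ball 0 1 \<longrightarrow>
          (\<forall>x\<in>hcarrier E'.
             hnorm E (W (z + h) x - W z x - (\<Sum>i\<in>UNIV. (h $ i) *\<^sub>C L i x))
               \<le> e * norm h * hnorm E' x)))"

definition K_inner ::
    "(nat \<Rightarrow> real) \<Rightarrow> 'f::complex_vector hilbert \<Rightarrow> 'e::complex_vector hilbert \<Rightarrow>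
     (complex ^ 'd::finite \<Rightarrow> 'f \<Rightarrow> 'e) \<Rightarrow> bool"
  where "K_inner a E' E W \<longleftrightarrow>
    op_analytic E' E W \<and>
    (\<forall>x\<in>hcarrier E'. ball_fun (\<lambda>z. W z x) \<in> hcarrier (HK a E) \<and>
       hnorm (HK a E) (ball_fun (\<lambda>z. W z x)) = hnorm E' x) \<and>
    (\<forall>\<alpha>. \<alpha> \<noteq> (\<lambda>_. 0) \<longrightarrow> (\<forall>x\<in>hcarrier E'. \<forall>y\<in>hcarrier E'.
       hinner (HK a E) (ball_fun (\<lambda>z. W z x)) (tpow Mz \<alpha> (ball_fun (\<lambda>z. W z y))) = 0))"

end

theory Submission
  imports Defs
begin

text \<open>
  The wandering space \<open>W E\<^sub>*\<close> generates the \<open>M\<^sub>z\<close>-invariant subspace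
  \<open>S\<close> of \<open>H_K(E)\<close>. On its orthogonal complement \<open>H\<close> take
  \<open>T = P\<^sub>H M\<^sub>z|H\<close>, \<open>C h = h(0)\<close>, \<open>D = W(0)\<close> and
  \<open>B x = M\<^sub>z\<^sup>* W x\<close>; the values of \<open>B\<close> lie in \<open>H\<^sup>d\<close> precisely
  because \<open>W\<close> is \<open>K\<close>-inner. Comparing Taylor coefficients, \<open>j\<^sub>C\<close> is the inclusion of
  \<open>H\<close>, hence \<open>\<Delta>\<^sub>T = P\<^sub>H \<Delta>|H\<close>, and \<open>C F(ZT\<^sup>*) h = (\<Delta> h)(z)\<close>.
  Everything then follows from the identity \<open>M\<^sub>z (\<oplus>\<Delta>) M\<^sub>z\<^sup>* f = f - f(0)\<close>:
  applied to \<open>W x\<close> it is the realization formula, and paired with \<open>W y\<close> it yields (K2) and (K3).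
\<close>

section \<open>Complex vector spaces\<close>

text \<open>Several objects of the statement are given by a choice or a limit: the square root
  behind \<open>Delta_T\<close> and the operator \<open>F_ZT\<close> are picked by SOME, adjoints by
  THE, and the K-contraction hypothesis speaks of the scalar space alone. Existence has to be shown
  before anything can be computed: Riesz representation provides adjoints and projections, a
  binomial series the square root, a growth estimate the norm convergence of \<open>F_ZT\<close>,
  and a comparison of coefficient norms carries the series of 1/K from scalar to vector values. The
  computations stay explicit because sigma, formed with M_z, sends operators acting by a scalar on
  each homogeneous degree to operators of the same kind, and because P M_z P = P M_z, with P the
  projection onto H. Powers of sigma for T, applied to the compression of such an operator, are
  therefore compressions of the powers for M_z. In particular 1/K of T is the compression of the
  projection f \<mapsto> f(0) onto the constants.\<close>

lemma scaleC_zero_right [simp]: "c *\<^sub>C (0::'a::complex_vector) = 0"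
  using scaleC_add_right[of c "0::'a" 0] by simp

lemma scaleC_zero_left [simp]: "0 *\<^sub>C (x::'a::complex_vector) = 0"
  using scaleC_add_left[of 0 0 x] by simp

lemma scaleC_minus_left: "(- c) *\<^sub>C (x::'a::complex_vector) = - (c *\<^sub>C x)"
  using scaleC_add_left[of "- c" c x] by (simp add: eq_neg_iff_add_eq_0)

lemma scaleC_minus_one [simp]: "(-1) *\<^sub>C (x::'a::complex_vector) = - x"
  by (simp add: scaleC_minus_left scaleC_one)

lemma scaleC_minus_right: "c *\<^sub>C (- x :: 'a::complex_vector) = - (c *\<^sub>C x)"
  using scaleC_add_right[of c "- x" x] by (simp add: eq_neg_iff_add_eq_0)

lemma scaleC_diff_right: "c *\<^sub>C (x - y :: 'a::complex_vector) = c *\<^sub>C x - c *\<^sub>C y"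
  using scaleC_add_right[of c x "- y"] by (simp add: scaleC_minus_right)

lemma scaleC_diff_left: "(b - c) *\<^sub>C (x :: 'a::complex_vector) = b *\<^sub>C x - c *\<^sub>C x"
  using scaleC_add_left[of b "- c" x] by (simp add: scaleC_minus_left)

lemma scaleC_sum_right: "c *\<^sub>C (\<Sum>i\<in>A. f i :: 'a::complex_vector) = (\<Sum>i\<in>A. c *\<^sub>C f i)"
  by (induction A rule: infinite_finite_induct) (simp_all add: scaleC_add_right)

lemma scaleC_sum_left: "(\<Sum>i\<in>A. f i) *\<^sub>C (x :: 'a::complex_vector) = (\<Sum>i\<in>A. f i *\<^sub>C x)"
  by (induction A rule: infinite_finite_induct) (simp_all add: scaleC_add_left)

section \<open>Inner product spaces\<close>

locale inner_space =
  fixes H :: "'a::complex_vector hilbert"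
  assumes zero_mem [simp, intro]: "0 \<in> hcarrier H"
    and add_mem [intro]: "\<lbrakk>x \<in> hcarrier H; y \<in> hcarrier H\<rbrakk> \<Longrightarrow> x + y \<in> hcarrier H"
    and scale_mem [intro]: "x \<in> hcarrier H \<Longrightarrow> c *\<^sub>C x \<in> hcarrier H"
    and inner_add_left: "\<lbrakk>x \<in> hcarrier H; y \<in> hcarrier H; z \<in> hcarrier H\<rbrakk> \<Longrightarrow>
      hinner H (x + y) z = hinner H x z + hinner H y z"
    and inner_scale_left: "\<lbrakk>x \<in> hcarrier H; y \<in> hcarrier H\<rbrakk> \<Longrightarrow>
      hinner H (c *\<^sub>C x) y = c * hinner H x y"
    and inner_commute: "\<lbrakk>x \<in> hcarrier H; y \<in> hcarrier H\<rbrakk> \<Longrightarrow>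
      hinner H y x = cnj (hinner H x y)"
    and inner_ge_0: "x \<in> hcarrier H \<Longrightarrow> 0 \<le> Re (hinner H x x)"
    and inner_eq_0D: "\<lbrakk>x \<in> hcarrier H; hinner H x x = 0\<rbrakk> \<Longrightarrow> x = 0"
begin

lemma uminus_mem [intro]: "x \<in> hcarrier H \<Longrightarrow> - x \<in> hcarrier H"
  using scale_mem[of x "-1"] by simp

lemma diff_mem [intro]: "\<lbrakk>x \<in> hcarrier H; y \<in> hcarrier H\<rbrakk> \<Longrightarrow> x - y \<in> hcarrier H"
  using add_mem[of x "- y"] by auto

lemma sum_mem [intro]: "(\<And>i. i \<in> A \<Longrightarrow> f i \<in> hcarrier H) \<Longrightarrow> sum f A \<in> hcarrier H"
  by (induction A rule: infinite_finite_induct) auto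

lemma inner_add_right: "\<lbrakk>x \<in> hcarrier H; y \<in> hcarrier H; z \<in> hcarrier H\<rbrakk> \<Longrightarrow>
    hinner H z (x + y) = hinner H z x + hinner H z y"
  by (metis inner_commute inner_add_left add_mem complex_cnj_add)

lemma inner_scale_right: "\<lbrakk>x \<in> hcarrier H; y \<in> hcarrier H\<rbrakk> \<Longrightarrow>
    hinner H x (c *\<^sub>C y) = cnj c * hinner H x y"
  by (metis inner_commute inner_scale_left scale_mem complex_cnj_mult)

lemma inner_minus_left: "\<lbrakk>x \<in> hcarrier H; y \<in> hcarrier H\<rbrakk> \<Longrightarrow> hinner H (- x) y = - hinner H x y"
  using inner_scale_left[of x y "-1"] by simp

lemma inner_minus_right: "\<lbrakk>x \<in> hcarrier H; y \<in> hcarrier H\<rbrakk> \<Longrightarrow> hinner H x (- y) = - hinner H x y"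
  using inner_scale_right[of x y "-1"] by simp

lemma inner_diff_left: "\<lbrakk>x \<in> hcarrier H; y \<in> hcarrier H; z \<in> hcarrier H\<rbrakk> \<Longrightarrow>
    hinner H (x - y) z = hinner H x z - hinner H y z"
  using inner_add_left[of x "- y" z] by (simp add: uminus_mem inner_minus_left)

lemma inner_diff_right: "\<lbrakk>x \<in> hcarrier H; y \<in> hcarrier H; z \<in> hcarrier H\<rbrakk> \<Longrightarrow>
    hinner H z (x - y) = hinner H z x - hinner H z y"
  using inner_add_right[of x "- y" z] by (simp add: uminus_mem inner_minus_right)

lemma inner_zero_left [simp]: "x \<in> hcarrier H \<Longrightarrow> hinner H 0 x = 0"
  using inner_scale_left[of 0 x 0] by simp

lemma inner_zero_right [simp]: "x \<in> hcarrier H \<Longrightarrow> hinner H x 0 = 0"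
  using inner_scale_right[of x 0 0] by simp

lemma inner_sum_left: "\<lbrakk>\<And>i. i \<in> A \<Longrightarrow> f i \<in> hcarrier H; y \<in> hcarrier H\<rbrakk> \<Longrightarrow>
    hinner H (sum f A) y = (\<Sum>i\<in>A. hinner H (f i) y)"
  by (induction A rule: infinite_finite_induct) (auto simp: inner_add_left sum_mem)

lemma inner_sum_right: "\<lbrakk>\<And>i. i \<in> A \<Longrightarrow> f i \<in> hcarrier H; y \<in> hcarrier H\<rbrakk> \<Longrightarrow>
    hinner H y (sum f A) = (\<Sum>i\<in>A. hinner H y (f i))"
  by (induction A rule: infinite_finite_induct) (auto simp: inner_add_right sum_mem)

lemma norm_ge_0 [simp]: "x \<in> hcarrier H \<Longrightarrow> 0 \<le> hnorm H x"
  by (simp add: hnorm_def inner_ge_0)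

lemma inner_self: "x \<in> hcarrier H \<Longrightarrow> hinner H x x = of_real ((hnorm H x)\<^sup>2)"
  using inner_ge_0[of x] inner_commute[of x x] by (simp add: hnorm_def complex_eq_iff)

lemma norm_sq: "x \<in> hcarrier H \<Longrightarrow> (hnorm H x)\<^sup>2 = Re (hinner H x x)"
  by (simp add: inner_self)

lemma norm_eq_0_iff: "x \<in> hcarrier H \<Longrightarrow> hnorm H x = 0 \<longleftrightarrow> x = 0"
  using inner_self[of x] inner_eq_0D[of x] by (auto simp: hnorm_def)

lemma norm_zero [simp]: "hnorm H 0 = 0"
  by (simp add: norm_eq_0_iff)

lemma norm_scale: "x \<in> hcarrier H \<Longrightarrow> hnorm H (c *\<^sub>C x) = cmod c * hnorm H x"
proof -
  assume x: "x \<in> hcarrier H"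
  have "hinner H (c *\<^sub>C x) (c *\<^sub>C x) = (c * cnj c) * hinner H x x"
    using x by (simp add: inner_scale_left inner_scale_right scale_mem mult.assoc)
  also have "\<dots> = of_real ((cmod c * hnorm H x)\<^sup>2)"
    using x by (simp only: inner_self power_mult_distrib of_real_mult complex_norm_square [symmetric])
  finally show ?thesis
    using x by (simp add: hnorm_def [of H "c *\<^sub>C x"])
qed

lemma norm_minus: "x \<in> hcarrier H \<Longrightarrow> hnorm H (- x) = hnorm H x"
  using norm_scale[of x "-1"] by simp

lemma norm_minus_commute: "\<lbrakk>x \<in> hcarrier H; y \<in> hcarrier H\<rbrakk> \<Longrightarrow> hnorm H (x - y) = hnorm H (y - x)"
  using norm_minus[of "x - y"] by (simp add: diff_mem)

lemma cauchy_schwarz: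
  assumes x: "x \<in> hcarrier H" and y: "y \<in> hcarrier H"
  shows "cmod (hinner H x y) \<le> hnorm H x * hnorm H y"
proof (cases "y = 0")
  case False
  define b where "b = (hnorm H y)\<^sup>2"
  have b: "b > 0"
    using False y norm_eq_0_iff[of y] by (simp add: b_def)
  define t where "t = hinner H x y / of_real b"
  have m: "t *\<^sub>C y \<in> hcarrier H" "x - t *\<^sub>C y \<in> hcarrier H"
    using x y by auto
  have yx: "hinner H y x = cnj (hinner H x y)"
    using inner_commute[of x y] x y by simp
  have "hinner H (x - t *\<^sub>C y) (x - t *\<^sub>C y) =
      hinner H x x - cnj t * hinner H x y - t * hinner H y x + t * cnj t * hinner H y y"
    using x y m by (simp add: inner_diff_left inner_diff_right inner_scale_left inner_scale_right algebra_simps)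
  also have "\<dots> = hinner H x x - hinner H x y * cnj (hinner H x y) / of_real b"
    using b inner_self[OF y] by (simp add: yx t_def b_def[symmetric] field_simps)
  also have "\<dots> = of_real ((hnorm H x)\<^sup>2 - (cmod (hinner H x y))\<^sup>2 / b)"
    by (simp add: inner_self[OF x] complex_norm_square [symmetric])
  finally have "0 \<le> (hnorm H x)\<^sup>2 - (cmod (hinner H x y))\<^sup>2 / b"
    using inner_ge_0[OF m(2)] by simp
  hence "(cmod (hinner H x y))\<^sup>2 \<le> (hnorm H x * hnorm H y)\<^sup>2"
    using b by (simp add: b_def field_simps power_mult_distrib)
  thus ?thesis
    using x y by (meson mult_nonneg_nonneg norm_ge_0 power2_le_imp_le)
qed (use x in simp)

lemma norm_add_sq: "\<lbrakk>x \<in> hcarrier H; y \<in> hcarrier H\<rbrakk> \<Longrightarrow>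
    (hnorm H (x + y))\<^sup>2 = (hnorm H x)\<^sup>2 + 2 * Re (hinner H x y) + (hnorm H y)\<^sup>2"
  using inner_commute[of x y]
  by (simp add: norm_sq add_mem inner_add_left inner_add_right)

lemma norm_triangle: "\<lbrakk>x \<in> hcarrier H; y \<in> hcarrier H\<rbrakk> \<Longrightarrow> hnorm H (x + y) \<le> hnorm H x + hnorm H y"
proof -
  assume x: "x \<in> hcarrier H" and y: "y \<in> hcarrier H"
  have "Re (hinner H x y) \<le> hnorm H x * hnorm H y"
    using cauchy_schwarz[OF x y] complex_Re_le_cmod order_trans by blast
  hence "(hnorm H (x + y))\<^sup>2 \<le> (hnorm H x + hnorm H y)\<^sup>2"
    using norm_add_sq[OF x y] by (simp add: power2_sum)
  thus ?thesis
    by (rule power2_le_imp_le) (simp add: x y)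
qed

lemma norm_diff_triangle: "\<lbrakk>x \<in> hcarrier H; y \<in> hcarrier H; z \<in> hcarrier H\<rbrakk> \<Longrightarrow>
    hnorm H (x - z) \<le> hnorm H (x - y) + hnorm H (y - z)"
  using norm_triangle[of "x - y" "y - z"] by auto

lemma norm_sum: "(\<And>i. i \<in> A \<Longrightarrow> f i \<in> hcarrier H) \<Longrightarrow> hnorm H (sum f A) \<le> (\<Sum>i\<in>A. hnorm H (f i))"
proof (induction A rule: infinite_finite_induct)
  case (insert i A)
  thus ?case
    using norm_triangle[of "f i" "sum f A"] by (simp add: sum_mem)
qed auto

lemma eqI_inner:
  assumes "x \<in> hcarrier H" "y \<in> hcarrier H" "\<And>z. z \<in> hcarrier H \<Longrightarrow> hinner H z x = hinner H z y"
  shows "x = y"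
proof -
  have "hinner H (x - y) (x - y) = 0"
    using assms by (simp add: inner_diff_right diff_mem)
  thus ?thesis
    using inner_eq_0D[of "x - y"] assms by auto
qed

text \<open>Pairing x with itself gives the norm back. Norm bounds for adjoints, projections and
  sums of series, which are known through their pairings, are obtained this way.\<close>

lemma norm_le_inner_bound:
  assumes x: "x \<in> hcarrier H" and "0 \<le> M"
    and le: "\<And>y. y \<in> hcarrier H \<Longrightarrow> cmod (hinner H y x) \<le> M * hnorm H y"
  shows "hnorm H x \<le> M"
proof (cases "x = 0")
  case False
  hence pos: "hnorm H x > 0"
    using x norm_ge_0[of x] norm_eq_0_iff[of x] by linarith
  have "hnorm H x * hnorm H x \<le> M * hnorm H x"
    using le[OF x] inner_self[OF x] by (simp add: power2_eq_square norm_mult)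
  thus ?thesis
    using pos by simp
qed (use assms in simp)

lemma tendsto_unique:
  assumes "F \<noteq> bot" "htendsto H X y F" "htendsto H X z F" "\<And>n. X n \<in> hcarrier H"
  shows "y = z"
proof -
  have mem: "y \<in> hcarrier H" "z \<in> hcarrier H"
    and lim: "((\<lambda>n. hnorm H (X n - y)) \<longlongrightarrow> 0) F" "((\<lambda>n. hnorm H (X n - z)) \<longlongrightarrow> 0) F"
    using assms by (auto simp: htendsto_def)
  have "hnorm H (y - z) \<le> hnorm H (X n - y) + hnorm H (X n - z)" for n
    using norm_diff_triangle[of y "X n" z] mem assms(4)[of n] norm_minus_commute[of y "X n"] by simp
  moreover have "((\<lambda>n. hnorm H (X n - y) + hnorm H (X n - z)) \<longlongrightarrow> 0 + 0) F"
    by (intro tendsto_add lim)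
  ultimately have "hnorm H (y - z) \<le> 0"
    using assms(1) by (intro tendsto_lowerbound[of _ _ F]) auto
  hence "hnorm H (y - z) = 0"
    using norm_ge_0[OF diff_mem[OF mem]] by linarith
  thus ?thesis
    using norm_eq_0_iff[OF diff_mem[OF mem]] by simp
qed

lemma hlim_eqI:
  assumes "F \<noteq> bot" "htendsto H X y F" "\<And>n. X n \<in> hcarrier H"
  shows "hlim H F X = y"
  unfolding hlim_def using assms tendsto_unique by (intro the_equality) blast+

lemma tendsto_inner_left:
  assumes "htendsto H X y F" "\<And>n. X n \<in> hcarrier H" "z \<in> hcarrier H"
  shows "((\<lambda>n. hinner H (X n) z) \<longlongrightarrow> hinner H y z) F"
proof -
  have y: "y \<in> hcarrier H" and lim: "((\<lambda>n. hnorm H (X n - y)) \<longlongrightarrow> 0) F"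
    using assms(1) by (auto simp: htendsto_def)
  have "((\<lambda>n. hinner H (X n) z - hinner H y z) \<longlongrightarrow> 0) F"
  proof (rule Lim_null_comparison)
    show "\<forall>\<^sub>F n in F. norm (hinner H (X n) z - hinner H y z) \<le> hnorm H (X n - y) * hnorm H z"
      using assms y cauchy_schwarz[of "X _ - y" z]
      by (intro always_eventually allI) (simp add: inner_diff_left[symmetric] diff_mem)
    show "((\<lambda>n. hnorm H (X n - y) * hnorm H z) \<longlongrightarrow> 0) F"
      using tendsto_mult_left_zero[OF lim] .
  qed
  thus ?thesis
    by (rule LIM_zero_cancel)
qed

text \<open>Polarization: the vectors x + y and x + \<i> y kill the symmetric and the antisymmetric
  combination of A x y and A y x. Phrased for a form vanishing on the diagonal, it applies to the
  difference of two forms.\<close>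

lemma sesquilinear_eq_0:
  assumes addl: "\<And>x y z. \<lbrakk>x \<in> hcarrier H; y \<in> hcarrier H; z \<in> hcarrier H\<rbrakk> \<Longrightarrow> A (x + y) z = A x z + A y z"
    and addr: "\<And>x y z. \<lbrakk>x \<in> hcarrier H; y \<in> hcarrier H; z \<in> hcarrier H\<rbrakk> \<Longrightarrow> A z (x + y) = A z x + A z y"
    and scl: "\<And>c x y. \<lbrakk>x \<in> hcarrier H; y \<in> hcarrier H\<rbrakk> \<Longrightarrow> A (c *\<^sub>C x) y = c * A x y"
    and scr: "\<And>c x y. \<lbrakk>x \<in> hcarrier H; y \<in> hcarrier H\<rbrakk> \<Longrightarrow> A x (c *\<^sub>C y) = cnj c * A x y"
    and z: "\<And>x. x \<in> hcarrier H \<Longrightarrow> A x x = 0"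
    and x: "x \<in> hcarrier H" and y: "y \<in> hcarrier H"
  shows "A x y = (0::complex)"
proof -
  have 1: "A x y + A y x = 0"
    using z[of "x + y"] x y z[OF x] z[OF y] by (simp add: add_mem addl addr add.commute)
  have 2: "\<i> * A y x - \<i> * A x y = 0"
    using z[of "x + \<i> *\<^sub>C y"] x y z[OF x] z[OF y]
    by (simp add: add_mem scale_mem addl addr scl scr)
  have "A y x = A x y"
    using 2 by simp
  thus ?thesis
    using 1 by simp
qed

end

section \<open>Hilbert spaces\<close>

lemma hilbert_spaceI:
  assumes "inner_space H"
    and "\<And>X. \<lbrakk>\<And>n. X n \<in> hcarrier H; \<And>e. e > 0 \<Longrightarrow> \<exists>N. \<forall>m\<ge>N. \<forall>n\<ge>N. hnorm H (X m - X n) < e\<rbrakk>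
      \<Longrightarrow> \<exists>x\<in>hcarrier H. (\<lambda>n. hnorm H (X n - x)) \<longlonglongrightarrow> 0"
  shows "hilbert_space H"
proof -
  interpret inner_space H by fact
  show ?thesis
    unfolding hilbert_space_def
  proof (intro conjI ballI allI impI)
    fix X :: "nat \<Rightarrow> 'a"
    assume "(\<forall>n. X n \<in> hcarrier H) \<and> (\<forall>e>0. \<exists>N. \<forall>m\<ge>N. \<forall>n\<ge>N. hnorm H (X m - X n) < e)"
    thus "\<exists>x\<in>hcarrier H. (\<lambda>n. hnorm H (X n - x)) \<longlonglongrightarrow> 0"
      using assms(2) by blast
  qed (erule (2) inner_add_left | erule (1) inner_scale_left inner_commute add_mem inner_eq_0D
      | erule inner_ge_0 scale_mem | rule zero_mem)+
qed

text \<open>The predicate \<open>hilbert_space\<close> is split into its algebraic part,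
  \<open>inner_space\<close>, and completeness, so that the algebra is at hand before completeness
  of a concrete space is proved.\<close>

locale hilbert = inner_space H for H :: "'a::complex_vector hilbert" +
  assumes complete: "\<lbrakk>\<And>n. X n \<in> hcarrier H; \<And>e. e > 0 \<Longrightarrow> \<exists>N. \<forall>m\<ge>N. \<forall>n\<ge>N. hnorm H (X m - X n) < e\<rbrakk>
      \<Longrightarrow> \<exists>x\<in>hcarrier H. (\<lambda>n. hnorm H (X n - x)) \<longlonglongrightarrow> 0"

lemma (in hilbert) hilbert_space: "hilbert_space H"
proof (rule hilbert_spaceI[OF inner_space_axioms])
  fix X :: "nat \<Rightarrow> 'a"
  assume "\<And>n. X n \<in> hcarrier H"
    "\<And>e. e > 0 \<Longrightarrow> \<exists>N. \<forall>m\<ge>N. \<forall>n\<ge>N. hnorm H (X m - X n) < e"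
  thus "\<exists>x\<in>hcarrier H. (\<lambda>n. hnorm H (X n - x)) \<longlonglongrightarrow> 0"
    by (rule complete)
qed

lemma hilbertI:
  assumes "hilbert_space H"
  shows "hilbert H"
proof -
  note * = assms[unfolded hilbert_space_def]
  note algebraic = *[THEN conjunct1] *[THEN conjunct2, THEN conjunct1] *[THEN conjunct2, THEN conjunct2, THEN conjunct1]
    *[THEN conjunct2, THEN conjunct2, THEN conjunct2, THEN conjunct1] *[THEN conjunct2, THEN conjunct2, THEN conjunct2, THEN conjunct2, THEN conjunct1]
    *[THEN conjunct2, THEN conjunct2, THEN conjunct2, THEN conjunct2, THEN conjunct2, THEN conjunct1] *[THEN conjunct2, THEN conjunct2, THEN conjunct2, THEN conjunct2, THEN conjunct2, THEN conjunct2, THEN conjunct1]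
    *[THEN conjunct2, THEN conjunct2, THEN conjunct2, THEN conjunct2, THEN conjunct2, THEN conjunct2, THEN conjunct2, THEN conjunct1]
  note complete = *[THEN conjunct2, THEN conjunct2, THEN conjunct2, THEN conjunct2, THEN conjunct2, THEN conjunct2, THEN conjunct2, THEN conjunct2]
  show ?thesis
  proof
    fix X :: "nat \<Rightarrow> 'a"
    assume "\<And>n. X n \<in> hcarrier H"
      "\<And>e. e > 0 \<Longrightarrow> \<exists>N. \<forall>m\<ge>N. \<forall>n\<ge>N. hnorm H (X m - X n) < e"
    thus "\<exists>x\<in>hcarrier H. (\<lambda>n. hnorm H (X n - x)) \<longlonglongrightarrow> 0"
      using complete[THEN spec[of _ X]] by simp
  qed (use algebraic in blast)+
qed

context hilbert
begin

text \<open>The representing vector is obtained as the minimizer of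
  \<open>x \<mapsto> \<parallel>x\<parallel>\<^sup>2 - 2 Re \<phi>(x)\<close>; by the parallelogram identity every minimizing sequence is Cauchy.\<close>

theorem riesz:
  assumes add: "\<And>x y. \<lbrakk>x \<in> hcarrier H; y \<in> hcarrier H\<rbrakk> \<Longrightarrow> \<phi> (x + y) = \<phi> x + \<phi> y"
    and scale: "\<And>c x. x \<in> hcarrier H \<Longrightarrow> \<phi> (c *\<^sub>C x) = c * \<phi> x"
    and bound: "\<And>x. x \<in> hcarrier H \<Longrightarrow> cmod (\<phi> x) \<le> M * hnorm H x"
  obtains y where "y \<in> hcarrier H" "\<And>x. x \<in> hcarrier H \<Longrightarrow> \<phi> x = hinner H x y"
proof -
  define J where "J x = (hnorm H x)\<^sup>2 - 2 * Re (\<phi> x)" for x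
  have J_bound: "J x \<ge> - M\<^sup>2" if "x \<in> hcarrier H" for x
  proof -
    have "Re (\<phi> x) \<le> M * hnorm H x"
      using bound[OF that] complex_Re_le_cmod order_trans by blast
    moreover have "0 \<le> (hnorm H x - M)\<^sup>2"
      by simp
    ultimately show ?thesis
      by (simp add: J_def power2_diff) (simp add: power2_eq_square mult.commute)
  qed
  define m where "m = (INF x\<in>hcarrier H. J x)"
  have bdd: "bdd_below (J ` hcarrier H)"
    using J_bound by (intro bdd_belowI[of _ "- M\<^sup>2"]) auto
  have m_le: "m \<le> J x" if "x \<in> hcarrier H" for x
    unfolding m_def using bdd that by (rule cINF_lower)
  have "\<exists>x\<in>hcarrier H. J x < m + 1 / real (Suc n)" for n
  proof -
    have "Inf (J ` hcarrier H) < m + 1 / real (Suc n)"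
      by (simp add: m_def)
    thus ?thesis
      using cInf_lessD[of "J ` hcarrier H"] zero_mem by blast
  qed
  then obtain X where X: "\<And>n. X n \<in> hcarrier H" "\<And>n. J (X n) < m + 1 / real (Suc n)"
    by metis
  have parallelogram: "(hnorm H (x - y))\<^sup>2 \<le> 2 * J x + 2 * J y - 4 * m"
    if x: "x \<in> hcarrier H" and y: "y \<in> hcarrier H" for x y
  proof -
    have half: "(1/2) *\<^sub>C (x + y) \<in> hcarrier H"
      using x y by auto
    have "J ((1/2) *\<^sub>C (x + y)) = (hnorm H (x + y))\<^sup>2 / 4 - Re (\<phi> x) - Re (\<phi> y)"
      using x y by (simp add: J_def norm_scale scale add add_mem power_divide field_simps)
    moreover have "(hnorm H (x + y))\<^sup>2 + (hnorm H (x - y))\<^sup>2 = 2 * (hnorm H x)\<^sup>2 + 2 * (hnorm H y)\<^sup>2"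
      using norm_add_sq[OF x y] norm_add_sq[OF x, of "- y"] y
      by (simp add: uminus_mem norm_minus inner_minus_right x)
    ultimately show ?thesis
      using m_le[OF half] by (simp add: J_def)
  qed
  have "\<exists>N. \<forall>i\<ge>N. \<forall>j\<ge>N. hnorm H (X i - X j) < e" if e: "e > 0" for e
  proof -
    obtain N where N: "real (Suc N) > 4 / e\<^sup>2"
      by (metis reals_Archimedean2 less_trans of_nat_less_iff lessI)
    have "hnorm H (X i - X j) < e" if "i \<ge> N" "j \<ge> N" for i j
    proof -
      have le: "1 / real (Suc i) \<le> 1 / real (Suc N)" "1 / real (Suc j) \<le> 1 / real (Suc N)"
        using that by (auto intro!: divide_left_mono)
      have "(hnorm H (X i - X j))\<^sup>2 < 4 * (1 / real (Suc N))"
        using parallelogram[OF X(1)[of i] X(1)[of j]] X(2)[of i] X(2)[of j] le by linarith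
      also have "\<dots> < e\<^sup>2"
        using N e by (simp add: field_simps)
      finally show ?thesis
        using e by (simp add: power2_less_imp_less)
    qed
    thus ?thesis by blast
  qed
  from complete[OF X(1) this] obtain y
    where y: "y \<in> hcarrier H" and lim: "(\<lambda>n. hnorm H (X n - y)) \<longlonglongrightarrow> 0" by blast
  have Xy: "htendsto H X y sequentially"
    using y lim by (simp add: htendsto_def)
  have re: "Re (hinner H y h) = Re (\<phi> h)" if h: "h \<in> hcarrier H" for h
  proof -
    \<comment> \<open>D is half the derivative of J (y + t h) at t = 0. The inequality
      \<open>quad\<close>, which says that y minimizes J on this line, is obtained as a limit along
      the minimizing sequence.\<close>
    define D where "D = Re (hinner H y h) - Re (\<phi> h)"
    have quad: "0 \<le> t\<^sup>2 * (hnorm H h)\<^sup>2 + 2 * t * D" for t :: real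
    proof -
      have lower: "t\<^sup>2 * (hnorm H h)\<^sup>2 + 2 * t * (Re (hinner H (X n) h) - Re (\<phi> h)) \<ge> - (1 / real (Suc n))" for n
      proof -
        have "J (X n + of_real t *\<^sub>C h) = J (X n) + t\<^sup>2 * (hnorm H h)\<^sup>2
            + 2 * t * (Re (hinner H (X n) h) - Re (\<phi> h))"
          using X(1)[of n] h norm_add_sq[OF X(1)[of n], of "of_real t *\<^sub>C h"]
          by (simp add: J_def norm_scale scale add scale_mem inner_scale_right power_mult_distrib algebra_simps)
        moreover have "m \<le> J (X n + of_real t *\<^sub>C h)"
          using X(1)[of n] h by (intro m_le) auto
        ultimately show ?thesis
          using X(2)[of n] by linarith
      qed
      have "(\<lambda>n. t\<^sup>2 * (hnorm H h)\<^sup>2 + 2 * t * (Re (hinner H (X n) h) - Re (\<phi> h)))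
          \<longlonglongrightarrow> t\<^sup>2 * (hnorm H h)\<^sup>2 + 2 * t * D"
        unfolding D_def by (intro tendsto_intros tendsto_inner_left[OF Xy] X(1) h)
      moreover have "(\<lambda>n. - (1 / real (Suc n))) \<longlonglongrightarrow> - 0"
        by (intro tendsto_minus) (use lim_1_over_n filterlim_sequentially_Suc[of "\<lambda>n. 1 / real n"] in auto)
      ultimately show ?thesis
        using lower by (intro LIMSEQ_le[of "\<lambda>n. - (1 / real (Suc n))" 0]) auto
    qed
    have "D = 0"
    proof (rule ccontr)
      assume "D \<noteq> 0"
      \<comment> \<open>The quadratic in t is smallest at -D divided by the squared norm of h;
        adding 1 keeps the quotient meaningful when h = 0.\<close>
      define q where "q = (hnorm H h)\<^sup>2 + 1"
      have q: "q > 0" by (simp add: q_def add_nonneg_pos)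
      have "0 \<le> (- D / q)\<^sup>2 * (hnorm H h)\<^sup>2 + 2 * (- D / q) * D"
        by (rule quad)
      also have "\<dots> \<le> (- D / q)\<^sup>2 * q + 2 * (- D / q) * D"
        by (intro add_right_mono mult_left_mono) (auto simp: q_def)
      also have "\<dots> = - (D\<^sup>2 / q)"
      proof -
        have "(- D / q)\<^sup>2 * q = D\<^sup>2 / q"
          using q by (simp add: power2_eq_square)
        thus ?thesis by (simp add: power2_eq_square)
      qed
      also have "\<dots> < 0"
        using q \<open>D \<noteq> 0\<close> by simp
      finally show False by simp
    qed
    thus ?thesis by (simp add: D_def)
  qed
  have "\<phi> x = hinner H x y" if x: "x \<in> hcarrier H" for x
  proof -
    have com: "hinner H x y = cnj (hinner H y x)"
      using inner_commute[OF y x] .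
    \<comment> \<open>The identity of real parts at \<i> x yields the one of imaginary parts at
      x.\<close>
    have "Re (\<phi> (\<i> *\<^sub>C x)) = Re (hinner H y (\<i> *\<^sub>C x))"
      using x re[of "\<i> *\<^sub>C x"] by (simp add: scale_mem)
    hence "Im (\<phi> x) = - Im (hinner H y x)"
      using x y by (simp add: scale inner_scale_right)
    thus ?thesis
      using re[OF x] com by (simp add: complex_eq_iff)
  qed
  with y show ?thesis using that by blast
qed

end

section \<open>Bounded operators\<close>

lemma hnorm_cong: "hinner H = hinner G \<Longrightarrow> hnorm H = hnorm G"
  by (simp add: hnorm_def fun_eq_iff)

lemma bounded_opI:
  assumes "\<And>x. x \<in> hcarrier H \<Longrightarrow> A x \<in> hcarrier G"
    and "\<And>x y. \<lbrakk>x \<in> hcarrier H; y \<in> hcarrier H\<rbrakk> \<Longrightarrow> A (x + y) = A x + A y"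
    and "\<And>c x. x \<in> hcarrier H \<Longrightarrow> A (c *\<^sub>C x) = c *\<^sub>C A x"
    and "\<And>x. x \<in> hcarrier H \<Longrightarrow> hnorm G (A x) \<le> M * hnorm H x"
  shows "bounded_op H G A"
  using assms unfolding bounded_op_def by blast

lemma bounded_op_mem: "\<lbrakk>bounded_op H G A; x \<in> hcarrier H\<rbrakk> \<Longrightarrow> A x \<in> hcarrier G"
  and bounded_op_add: "\<lbrakk>bounded_op H G A; x \<in> hcarrier H; y \<in> hcarrier H\<rbrakk> \<Longrightarrow> A (x + y) = A x + A y"
  and bounded_op_scale: "\<lbrakk>bounded_op H G A; x \<in> hcarrier H\<rbrakk> \<Longrightarrow> A (c *\<^sub>C x) = c *\<^sub>C A x"
  by (simp_all add: bounded_op_def)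

lemma bounded_op_bound:
  assumes "bounded_op H G A" "inner_space H"
  obtains M where "M \<ge> 0" "\<And>x. x \<in> hcarrier H \<Longrightarrow> hnorm G (A x) \<le> M * hnorm H x"
proof -
  interpret inner_space H by fact
  obtain M where M: "\<And>x. x \<in> hcarrier H \<Longrightarrow> hnorm G (A x) \<le> M * hnorm H x"
    using assms(1) unfolding bounded_op_def by blast
  have "hnorm G (A x) \<le> max M 0 * hnorm H x" if "x \<in> hcarrier H" for x
    using M[OF that] mult_right_mono[of M "max M 0" "hnorm H x"] that by simp
  thus ?thesis
    using that[of "max M 0"] by simp
qed

lemma bounded_op_zero: "\<lbrakk>bounded_op H G A; inner_space H\<rbrakk> \<Longrightarrow> A 0 = 0"
  using bounded_op_scale[of H G A 0 0] inner_space.zero_mem[of H] by simp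

lemma bounded_op_uminus: "\<lbrakk>bounded_op H G A; x \<in> hcarrier H\<rbrakk> \<Longrightarrow> A (- x) = - A x"
  using bounded_op_scale[of H G A x "-1"] by simp

lemma bounded_op_diff:
  "\<lbrakk>bounded_op H G A; inner_space H; x \<in> hcarrier H; y \<in> hcarrier H\<rbrakk> \<Longrightarrow> A (x - y) = A x - A y"
  using bounded_op_add[of H G A x "- y"] inner_space.uminus_mem[of H y]
  by (simp add: bounded_op_uminus)

lemma bounded_op_sum:
  assumes "bounded_op H G A" "inner_space H" "\<And>i. i \<in> I \<Longrightarrow> f i \<in> hcarrier H"
  shows "A (\<Sum>i\<in>I. f i) = (\<Sum>i\<in>I. A (f i))"
  using assms(3)
proof (induction I rule: infinite_finite_induct)
  case (insert i I)
  have "sum f I \<in> hcarrier H"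
    using insert.prems by (intro inner_space.sum_mem[OF assms(2)]) simp
  thus ?case
    using insert by (simp add: bounded_op_add[OF assms(1)])
qed (simp_all add: bounded_op_zero[OF assms(1,2)])

lemma bounded_op_htendsto:
  assumes A: "bounded_op H G A" and H: "inner_space H" and G: "inner_space G"
    and X: "\<And>n. X n \<in> hcarrier H" and lim: "htendsto H X y F"
  shows "htendsto G (\<lambda>n. A (X n)) (A y) F"
proof -
  interpret H: inner_space H by fact
  interpret G: inner_space G by fact
  obtain M where M: "M \<ge> 0" "\<And>x. x \<in> hcarrier H \<Longrightarrow> hnorm G (A x) \<le> M * hnorm H x"
    using bounded_op_bound[OF A H] by blast
  have y: "y \<in> hcarrier H" and lim: "((\<lambda>n. hnorm H (X n - y)) \<longlongrightarrow> 0) F"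
    using lim by (auto simp: htendsto_def)
  have "((\<lambda>n. hnorm G (A (X n) - A y)) \<longlongrightarrow> 0) F"
  proof (rule Lim_null_comparison)
    show "\<forall>\<^sub>F n in F. norm (hnorm G (A (X n) - A y)) \<le> M * hnorm H (X n - y)"
    proof (intro always_eventually allI)
      fix n
      have d: "X n - y \<in> hcarrier H"
        using X[of n] y by auto
      show "norm (hnorm G (A (X n) - A y)) \<le> M * hnorm H (X n - y)"
        using M(2)[OF d] G.norm_ge_0[OF bounded_op_mem[OF A d]]
        by (simp add: bounded_op_diff[OF A H X[of n] y])
    qed
    show "((\<lambda>n. M * hnorm H (X n - y)) \<longlongrightarrow> 0) F"
      using tendsto_mult_right_zero[OF lim] .
  qed
  thus ?thesis
    using bounded_op_mem[OF A y] by (simp add: htendsto_def)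
qed

lemma bounded_op_compose:
  assumes A: "bounded_op H G A" and B: "bounded_op G L B" and H: "inner_space H" and G: "inner_space G"
  shows "bounded_op H L (\<lambda>x. B (A x))"
proof -
  obtain M where M: "M \<ge> 0" "\<And>x. x \<in> hcarrier H \<Longrightarrow> hnorm G (A x) \<le> M * hnorm H x"
    using bounded_op_bound[OF A H] by blast
  obtain N where N: "N \<ge> 0" "\<And>x. x \<in> hcarrier G \<Longrightarrow> hnorm L (B x) \<le> N * hnorm G x"
    using bounded_op_bound[OF B G] by blast
  show ?thesis
  proof (rule bounded_opI[where M = "N * M"])
    fix x assume x: "x \<in> hcarrier H"
    have "hnorm L (B (A x)) \<le> N * hnorm G (A x)"
      by (rule N(2)[OF bounded_op_mem[OF A x]])
    also have "\<dots> \<le> N * (M * hnorm H x)"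
      using M(2)[OF x] N(1) by (rule mult_left_mono)
    finally show "hnorm L (B (A x)) \<le> N * M * hnorm H x"
      by simp
  qed (auto simp: bounded_op_mem[OF A] bounded_op_mem[OF B] bounded_op_add[OF A] bounded_op_add[OF B]
      bounded_op_scale[OF A] bounded_op_scale[OF B])
qed

lemma bounded_op_cong:
  assumes "bounded_op H G A" "inner_space H" "\<And>x. x \<in> hcarrier H \<Longrightarrow> B x = A x"
  shows "bounded_op H G B"
proof -
  interpret inner_space H by fact
  obtain M where M: "M \<ge> 0" "\<And>x. x \<in> hcarrier H \<Longrightarrow> hnorm G (A x) \<le> M * hnorm H x"
    using bounded_op_bound[OF assms(1,2)] by blast
  show ?thesis
    by (rule bounded_opI[where M = M])
      (auto simp: assms(3) M(2) bounded_op_mem[OF assms(1)] bounded_op_add[OF assms(1)]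
        bounded_op_scale[OF assms(1)] add_mem scale_mem)
qed

section \<open>Adjoints\<close>

text \<open>The description inside THE is unique because vectors are determined by their pairings,
  so any vector with the right pairings is the value of the adjoint. The explicit adjoints of the
  model are computed through it.\<close>

lemma hadjoint_eqI:
  assumes H: "inner_space H" and x: "x \<in> hcarrier H"
    and eq: "\<And>h. h \<in> hcarrier H \<Longrightarrow> hinner G (A h) y = hinner H h x"
  shows "hadjoint H G A y = x"
  unfolding hadjoint_def
proof (rule the_equality)
  show "x \<in> hcarrier H \<and> (\<forall>h\<in>hcarrier H. hinner G (A h) y = hinner H h x)"
    using x eq by blast
next
  fix x' assume x': "x' \<in> hcarrier H \<and> (\<forall>h\<in>hcarrier H. hinner G (A h) y = hinner H h x')"
  show "x' = x"
    by (rule inner_space.eqI_inner[OF H]) (use x x' eq in auto)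
qed

text \<open>Riesz representation of the bounded functional h \<mapsto> <A h, y>. The two facts are
  the defining properties of the definite description \<open>hadjoint\<close>, available once a
  representing vector exists.\<close>

lemma
  assumes H: "hilbert H" and G: "inner_space G" and A: "bounded_op H G A" and y: "y \<in> hcarrier G"
  shows hadjoint_mem: "hadjoint H G A y \<in> hcarrier H"
    and hadjoint_inner: "h \<in> hcarrier H \<Longrightarrow> hinner H h (hadjoint H G A y) = hinner G (A h) y"
proof -
  interpret H: hilbert H by fact
  interpret G: inner_space G by fact
  obtain M where M: "M \<ge> 0" "\<And>x. x \<in> hcarrier H \<Longrightarrow> hnorm G (A x) \<le> M * hnorm H x"
    using bounded_op_bound[OF A H.inner_space_axioms] by blast
  obtain x where x: "x \<in> hcarrier H" "\<And>h. h \<in> hcarrier H \<Longrightarrow> hinner G (A h) y = hinner H h x"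
  proof (rule H.riesz[of "\<lambda>h. hinner G (A h) y" "M * hnorm G y"])
    fix h assume h: "h \<in> hcarrier H"
    have "cmod (hinner G (A h) y) \<le> hnorm G (A h) * hnorm G y"
      using G.cauchy_schwarz[OF bounded_op_mem[OF A h] y] .
    also have "\<dots> \<le> (M * hnorm H h) * hnorm G y"
      using M(2)[OF h] y by (simp add: mult_right_mono)
    finally show "cmod (hinner G (A h) y) \<le> M * hnorm G y * hnorm H h"
      by (simp add: mult.commute mult.left_commute)
  qed (auto simp: bounded_op_add[OF A] bounded_op_scale[OF A] bounded_op_mem[OF A] y
        G.inner_add_left G.inner_scale_left)
  have "hadjoint H G A y = x"
    by (rule hadjoint_eqI[OF H.inner_space_axioms x])
  with x show "hadjoint H G A y \<in> hcarrier H"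
    "h \<in> hcarrier H \<Longrightarrow> hinner H h (hadjoint H G A y) = hinner G (A h) y"
    by simp_all
qed

lemma bounded_op_hadjoint:
  assumes H: "hilbert H" and G: "inner_space G" and A: "bounded_op H G A"
  shows "bounded_op G H (hadjoint H G A)"
proof -
  interpret H: hilbert H by fact
  interpret G: inner_space G by fact
  note mem = hadjoint_mem[OF H G A] and inner = hadjoint_inner[OF H G A]
  obtain M where M: "M \<ge> 0" "\<And>x. x \<in> hcarrier H \<Longrightarrow> hnorm G (A x) \<le> M * hnorm H x"
    using bounded_op_bound[OF A H.inner_space_axioms] by blast
  show ?thesis
  proof (rule bounded_opI[where M = M])
    fix x y assume x: "x \<in> hcarrier G" and y: "y \<in> hcarrier G"
    show "hadjoint H G A (x + y) = hadjoint H G A x + hadjoint H G A y"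
      by (rule H.eqI_inner) (use x y in \<open>auto simp: mem inner H.inner_add_right G.inner_add_right
          bounded_op_mem[OF A] G.add_mem H.add_mem\<close>)
  next
    fix c x assume x: "x \<in> hcarrier G"
    show "hadjoint H G A (c *\<^sub>C x) = c *\<^sub>C hadjoint H G A x"
      by (rule H.eqI_inner) (use x in \<open>auto simp: mem inner H.inner_scale_right G.inner_scale_right
          bounded_op_mem[OF A] G.scale_mem H.scale_mem\<close>)
  next
    fix x assume x: "x \<in> hcarrier G"
    show "hnorm H (hadjoint H G A x) \<le> M * hnorm G x"
    proof (rule H.norm_le_inner_bound[OF mem[OF x]])
      fix h assume h: "h \<in> hcarrier H"
      have "cmod (hinner H h (hadjoint H G A x)) \<le> hnorm G (A h) * hnorm G x"
        using G.cauchy_schwarz[OF bounded_op_mem[OF A h] x] by (simp add: inner[OF x h])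
      also have "\<dots> \<le> (M * hnorm H h) * hnorm G x"
        using M(2)[OF h] x by (simp add: mult_right_mono)
      finally show "cmod (hinner H h (hadjoint H G A x)) \<le> M * hnorm G x * hnorm H h"
        by (simp add: mult.commute mult.left_commute)
    qed (use M x in simp)
  qed (rule mem)
qed

section \<open>Subspaces and sums\<close>

text \<open>A Cauchy sequence of the subspace has a limit in the ambient space, and sequential
  closedness puts it inside. Serves both the defect space and the model space.\<close>

lemma closed_subspace_hilbert:
  assumes G: "hilbert G"
    and H: "hinner H = hinner G" "hcarrier H \<subseteq> hcarrier G" "0 \<in> hcarrier H"
    and add: "\<And>x y. \<lbrakk>x \<in> hcarrier H; y \<in> hcarrier H\<rbrakk> \<Longrightarrow> x + y \<in> hcarrier H"
    and scale: "\<And>c x. x \<in> hcarrier H \<Longrightarrow> c *\<^sub>C x \<in> hcarrier H"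
    and closed: "\<And>X y. \<lbrakk>\<And>n. X n \<in> hcarrier H; htendsto G X y sequentially\<rbrakk> \<Longrightarrow> y \<in> hcarrier H"
  shows "hilbert H"
proof -
  interpret G: hilbert G by fact
  have G_mem: "x \<in> hcarrier G" if "x \<in> hcarrier H" for x
    using that H(2) by blast
  show ?thesis
  proof
    fix X :: "nat \<Rightarrow> 'a"
    assume X: "\<And>n. X n \<in> hcarrier H"
      and "\<And>e. 0 < e \<Longrightarrow> \<exists>N. \<forall>m\<ge>N. \<forall>n\<ge>N. hnorm H (X m - X n) < e"
    hence "\<exists>x\<in>hcarrier G. (\<lambda>n. hnorm G (X n - x)) \<longlonglongrightarrow> 0"
      by (intro G.complete) (auto simp: hnorm_cong[OF H(1)] G_mem)
    then obtain x where "x \<in> hcarrier G" "(\<lambda>n. hnorm G (X n - x)) \<longlonglongrightarrow> 0"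
      by blast
    with closed[OF X] show "\<exists>x\<in>hcarrier H. (\<lambda>n. hnorm H (X n - x)) \<longlonglongrightarrow> 0"
      by (auto simp: htendsto_def hnorm_cong[OF H(1)])
  qed (use H(3) in \<open>auto simp: H(1) add scale G_mem G.inner_add_left G.inner_scale_left
      G.inner_ge_0 intro: G.inner_commute G.inner_eq_0D\<close>)
qed

lemma closed_image_hilbert:
  assumes H: "inner_space H" and G: "hilbert G" and A: "bounded_op H G A"
  shows "hilbert (closed_image H G A)"
proof (rule closed_subspace_hilbert[OF G])
  interpret H: inner_space H by fact
  interpret G: hilbert G by fact
  let ?K = "closed_image H G A"
  note A_mem = bounded_op_mem[OF A]
  have memI: "y \<in> hcarrier ?K" if "y \<in> hcarrier G" "\<And>e. e > 0 \<Longrightarrow> \<exists>x\<in>hcarrier H. hnorm G (A x - y) < e" for y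
    using that by (simp add: closed_image_def)
  have memD: "\<exists>x\<in>hcarrier H. hnorm G (A x - y) < e" if "y \<in> hcarrier ?K" "e > 0" for y e
    using that by (simp add: closed_image_def)
  show sub: "hcarrier ?K \<subseteq> hcarrier G"
    by (auto simp: closed_image_def)
  show "hinner ?K = hinner G"
    by (simp add: closed_image_def)
  show "0 \<in> hcarrier ?K"
    by (rule memI) (auto intro!: bexI[of _ 0] simp: bounded_op_zero[OF A H])
  show "x + y \<in> hcarrier ?K" if x: "x \<in> hcarrier ?K" and y: "y \<in> hcarrier ?K" for x y
  proof (rule memI)
    fix e :: real assume e: "e > 0"
    obtain u v where uv: "u \<in> hcarrier H" "hnorm G (A u - x) < e / 2"
      "v \<in> hcarrier H" "hnorm G (A v - y) < e / 2"
      using memD[OF x, of "e / 2"] memD[OF y, of "e / 2"] e by auto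
    have "hnorm G ((A u - x) + (A v - y)) \<le> hnorm G (A u - x) + hnorm G (A v - y)"
      using uv x y sub by (intro G.norm_triangle) (auto simp: A_mem)
    moreover have "(A u - x) + (A v - y) = A (u + v) - (x + y)"
      using uv by (simp add: bounded_op_add[OF A])
    ultimately show "\<exists>w\<in>hcarrier H. hnorm G (A w - (x + y)) < e"
      using uv by (intro bexI[of _ "u + v"]) auto
  qed (use x y sub in auto)
  show "c *\<^sub>C x \<in> hcarrier ?K" if x: "x \<in> hcarrier ?K" for c x
  proof (rule memI)
    fix e :: real assume e: "e > 0"
    \<comment> \<open>The 1 avoids a division by zero when c = 0.\<close>
    have p: "cmod c + 1 > 0"
      by (simp add: add_nonneg_pos)
    obtain u where u: "u \<in> hcarrier H" "hnorm G (A u - x) < e / (cmod c + 1)"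
      using memD[OF x, of "e / (cmod c + 1)"] e p by auto
    have m: "A u - x \<in> hcarrier G"
      using u x sub by (auto simp: A_mem)
    have "hnorm G (A (c *\<^sub>C u) - c *\<^sub>C x) = cmod c * hnorm G (A u - x)"
      using u m by (simp add: bounded_op_scale[OF A] scaleC_diff_right[symmetric] G.norm_scale)
    also have "\<dots> \<le> (cmod c + 1) * hnorm G (A u - x)"
      using m by (intro mult_right_mono) auto
    also have "\<dots> < e"
      using u(2) p by (simp add: field_simps)
    finally show "\<exists>w\<in>hcarrier H. hnorm G (A w - c *\<^sub>C x) < e"
      using u by blast
  qed (use x sub in auto)
  show "y \<in> hcarrier ?K" if X: "\<And>n. X n \<in> hcarrier ?K" and lim: "htendsto G X y sequentially" for X y
  proof (rule memI)
    show y: "y \<in> hcarrier G"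
      using lim by (simp add: htendsto_def)
    fix e :: real assume e: "e > 0"
    have "(\<lambda>n. hnorm G (X n - y)) \<longlonglongrightarrow> 0"
      using lim by (simp add: htendsto_def)
    from order_tendstoD(2)[OF this, of "e / 2"] e obtain n where n: "hnorm G (X n - y) < e / 2"
      by (auto simp: eventually_sequentially)
    obtain u where u: "u \<in> hcarrier H" "hnorm G (A u - X n) < e / 2"
      using memD[OF X[of n], of "e / 2"] e by auto
    have "hnorm G (A u - y) \<le> hnorm G (A u - X n) + hnorm G (X n - y)"
      using u X[of n] y sub by (intro G.norm_diff_triangle) (auto simp: A_mem)
    thus "\<exists>u\<in>hcarrier H. hnorm G (A u - y) < e"
      using u n by (intro bexI[of _ u]) auto
  qed
qed

lemma closed_image_memI:
  assumes "bounded_op H G A" "inner_space G" "x \<in> hcarrier H"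
  shows "A x \<in> hcarrier (closed_image H G A)"
  using assms by (auto simp: closed_image_def bounded_op_mem inner_space.norm_zero intro!: bexI[of _ x])

lemma inner_space_hpower:
  fixes H :: "'a::complex_vector hilbert"
  assumes "inner_space H"
  shows "inner_space (hpower H :: ('a ^ 'd::finite) hilbert)"
proof -
  interpret inner_space H by fact
  show ?thesis
  proof
    fix x y :: "'a ^ 'd"
    assume x: "x \<in> hcarrier (hpower H)" and y: "y \<in> hcarrier (hpower H)"
    have "hinner H (y $ i) (x $ i) = cnj (hinner H (x $ i) (y $ i))" for i
      using x y by (intro inner_commute) (simp_all add: hpower_def)
    thus "hinner (hpower H) y x = cnj (hinner (hpower H) x y)"
      by (simp add: hpower_def)
  next
    fix x :: "'a ^ 'd"
    assume x: "x \<in> hcarrier (hpower H)" and 0: "hinner (hpower H) x x = 0"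
    have "0 = (\<Sum>i\<in>UNIV. (hnorm H (x $ i))\<^sup>2)"
      using arg_cong[OF 0, of Re] x by (simp add: hpower_def inner_self)
    hence "\<forall>i. (hnorm H (x $ i))\<^sup>2 = 0"
      using sum_nonneg_eq_0_iff[of UNIV "\<lambda>i. (hnorm H (x $ i))\<^sup>2"] by simp
    thus "x = 0"
      using x by (auto simp: vec_eq_iff hpower_def norm_eq_0_iff)
  qed (auto simp: hpower_def scaleC_vec_def inner_add_left inner_scale_left sum.distrib
      sum_distrib_left inner_ge_0 intro!: sum_nonneg)
qed

lemma hnorm_hpower:
  assumes "inner_space H" "v \<in> hcarrier (hpower H)"
  shows "(hnorm (hpower H) v)\<^sup>2 = (\<Sum>i\<in>UNIV. (hnorm H (v $ i))\<^sup>2)"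
  using assms inner_space.norm_sq[OF inner_space_hpower[OF assms(1)] assms(2)]
  by (simp add: hpower_def inner_space.inner_self)

lemma hnorm_hpower_le:
  assumes "inner_space H" "v \<in> hcarrier (hpower H)"
  shows "hnorm (hpower H) v \<le> (\<Sum>i\<in>UNIV. hnorm H (v $ i))"
proof -
  have m: "v $ i \<in> hcarrier H" for i
    using assms by (simp add: hpower_def)
  have "(hnorm (hpower H) v)\<^sup>2 \<le> (\<Sum>i\<in>UNIV. hnorm H (v $ i))\<^sup>2"
    unfolding hnorm_hpower[OF assms] unfolding power2_eq_square sum_distrib_right
    using m by (intro sum_mono mult_left_mono member_le_sum) (auto intro: inner_space.norm_ge_0[OF assms(1)])
  thus ?thesis
    by (rule power2_le_imp_le) (use m in \<open>auto intro!: sum_nonneg inner_space.norm_ge_0[OF assms(1)]\<close>)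
qed

lemma inner_space_hdirect_sum:
  assumes "inner_space H" "inner_space G"
  shows "inner_space (hdirect_sum H G)"
proof -
  interpret H: inner_space H by fact
  interpret G: inner_space G by fact
  show ?thesis
  proof
    fix x y
    assume x: "x \<in> hcarrier (hdirect_sum H G)" and y: "y \<in> hcarrier (hdirect_sum H G)"
    have "hinner H (fst y) (fst x) = cnj (hinner H (fst x) (fst y))"
      "hinner G (snd y) (snd x) = cnj (hinner G (snd x) (snd y))"
      using x y by (auto intro!: H.inner_commute G.inner_commute simp: hdirect_sum_def)
    thus "hinner (hdirect_sum H G) y x = cnj (hinner (hdirect_sum H G) x y)"
      by (simp add: hdirect_sum_def)
  next
    fix x
    assume x: "x \<in> hcarrier (hdirect_sum H G)" and 0: "hinner (hdirect_sum H G) x x = 0"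
    have "0 = (hnorm H (fst x))\<^sup>2 + (hnorm G (snd x))\<^sup>2"
      using arg_cong[OF 0, of Re] x
      by (auto simp: hdirect_sum_def H.inner_self G.inner_self simp flip: of_real_power)
    hence "hnorm H (fst x) = 0" "hnorm G (snd x) = 0"
      by (simp_all add: sum_power2_eq_zero_iff eq_commute[of 0])
    thus "x = 0"
      using x by (auto simp: prod_eq_iff hdirect_sum_def H.norm_eq_0_iff G.norm_eq_0_iff)
  qed (auto simp: hdirect_sum_def scaleC_prod_def zero_prod_def H.inner_add_left H.inner_scale_left
      G.inner_add_left G.inner_scale_left algebra_simps H.inner_ge_0 G.inner_ge_0)
qed

lemma hnorm_hdirect_sum:
  assumes "inner_space H" "inner_space G" "x \<in> hcarrier H" "y \<in> hcarrier G"
  shows "(hnorm (hdirect_sum H G) (x, y))\<^sup>2 = (hnorm H x)\<^sup>2 + (hnorm G y)\<^sup>2"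
  using assms inner_space.norm_sq[OF inner_space_hdirect_sum[OF assms(1,2)], of "(x, y)"]
  by (simp add: hdirect_sum_def inner_space.inner_self)

lemma bounded_op_matrix:
  assumes H: "inner_space H" and F: "inner_space F" and G: "inner_space G" and E: "inner_space E"
    and A: "bounded_op H G A" and B: "bounded_op F G B" and C: "bounded_op H E C" and D: "bounded_op F E D"
  shows "bounded_op (hdirect_sum H F) (hdirect_sum G E) (matrix_op A B C D)"
proof -
  interpret H: inner_space H by fact
  interpret F: inner_space F by fact
  interpret G: inner_space G by fact
  interpret E: inner_space E by fact
  obtain a where a: "a \<ge> 0" "\<And>x. x \<in> hcarrier H \<Longrightarrow> hnorm G (A x) \<le> a * hnorm H x"
    using bounded_op_bound[OF A H] by blast
  obtain b where b: "b \<ge> 0" "\<And>x. x \<in> hcarrier F \<Longrightarrow> hnorm G (B x) \<le> b * hnorm F x"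
    using bounded_op_bound[OF B F] by blast
  obtain c where c: "c \<ge> 0" "\<And>x. x \<in> hcarrier H \<Longrightarrow> hnorm E (C x) \<le> c * hnorm H x"
    using bounded_op_bound[OF C H] by blast
  obtain d where d: "d \<ge> 0" "\<And>x. x \<in> hcarrier F \<Longrightarrow> hnorm E (D x) \<le> d * hnorm F x"
    using bounded_op_bound[OF D F] by blast
  note mem = bounded_op_mem[OF A] bounded_op_mem[OF B] bounded_op_mem[OF C] bounded_op_mem[OF D]
  show ?thesis
  proof (rule bounded_opI[where M = "a + b + c + d"])
    fix p assume "p \<in> hcarrier (hdirect_sum H F)"
    then obtain h x where p: "p = (h, x)" "h \<in> hcarrier H" "x \<in> hcarrier F"
      by (auto simp: hdirect_sum_def)
    show "matrix_op A B C D p \<in> hcarrier (hdirect_sum G E)"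
      using p by (auto simp: matrix_op_def hdirect_sum_def mem)
    let ?n = "hnorm (hdirect_sum H F) p"
    have sq: "?n\<^sup>2 = (hnorm H h)\<^sup>2 + (hnorm F x)\<^sup>2"
      using p by (simp add: hnorm_hdirect_sum[OF H F])
    have n: "?n \<ge> 0"
      using p by (intro inner_space.norm_ge_0[OF inner_space_hdirect_sum[OF H F]]) (simp add: hdirect_sum_def)
    have h: "hnorm H h \<le> ?n" and x: "hnorm F x \<le> ?n"
      by (rule power2_le_imp_le[OF _ n], simp add: sq)+
    have "hnorm G (A h + B x) \<le> a * hnorm H h + b * hnorm F x"
      using G.norm_triangle[of "A h" "B x"] a(2)[OF p(2)] b(2)[OF p(3)] p mem by fastforce
    also have "\<dots> \<le> (a + b) * ?n"
      using h x a b by (simp add: distrib_right add_mono mult_left_mono)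
    finally have 1: "hnorm G (A h + B x) \<le> (a + b) * ?n" .
    have "hnorm E (C h + D x) \<le> c * hnorm H h + d * hnorm F x"
      using E.norm_triangle[of "C h" "D x"] c(2)[OF p(2)] d(2)[OF p(3)] p mem by fastforce
    also have "\<dots> \<le> (c + d) * ?n"
      using h x c d by (simp add: distrib_right add_mono mult_left_mono)
    finally have 2: "hnorm E (C h + D x) \<le> (c + d) * ?n" .
    have m: "A h + B x \<in> hcarrier G" "C h + D x \<in> hcarrier E"
      using p mem by auto
    have "(hnorm (hdirect_sum G E) (matrix_op A B C D p))\<^sup>2
        = (hnorm G (A h + B x))\<^sup>2 + (hnorm E (C h + D x))\<^sup>2"
      using p m by (simp add: matrix_op_def hnorm_hdirect_sum[OF G E])
    also have "\<dots> \<le> (hnorm G (A h + B x) + hnorm E (C h + D x))\<^sup>2"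
      using m by (simp add: power2_sum)
    also have "\<dots> \<le> ((a + b) * ?n + (c + d) * ?n)\<^sup>2"
      using m 1 2 by (intro power_mono add_mono) auto
    finally have "hnorm (hdirect_sum G E) (matrix_op A B C D p) \<le> (a + b) * ?n + (c + d) * ?n"
      by (rule power2_le_imp_le) (use a b c d n in simp)
    thus "hnorm (hdirect_sum G E) (matrix_op A B C D p) \<le> (a + b + c + d) * ?n"
      by (simp add: algebra_simps)
  qed (auto simp: hdirect_sum_def matrix_op_def scaleC_prod_def bounded_op_add[OF A]
      bounded_op_add[OF B] bounded_op_add[OF C] bounded_op_add[OF D] bounded_op_scale[OF A]
      bounded_op_scale[OF B] bounded_op_scale[OF C] bounded_op_scale[OF D] scaleC_add_right)
qed

lemma sum_fun_eval: "(\<Sum>i\<in>A. f i) z = (\<Sum>i\<in>A. f i z :: 'a::comm_monoid_add)"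
  by (induction A rule: infinite_finite_induct) simp_all

lemma bounded_op_column:
  fixes A :: "'d::finite \<Rightarrow> 'a::complex_vector \<Rightarrow> 'b::complex_vector"
  assumes A: "\<And>i. bounded_op H G (A i)" and H: "inner_space H" and G: "inner_space G"
  shows "bounded_op H (hpower G) (column_op A)"
proof -
  have "\<exists>M. \<forall>i. \<forall>x\<in>hcarrier H. hnorm G (A i x) \<le> M i * hnorm H x"
    using A by (intro choice) (auto simp: bounded_op_def)
  then obtain M where M: "\<And>i x. x \<in> hcarrier H \<Longrightarrow> hnorm G (A i x) \<le> M i * hnorm H x"
    by blast
  show ?thesis
  proof (rule bounded_opI[where M = "\<Sum>i\<in>UNIV. M i"])
    fix x assume x: "x \<in> hcarrier H"
    show mem: "column_op A x \<in> hcarrier (hpower G)"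
      using bounded_op_mem[OF A x] by (simp add: column_op_def hpower_def)
    have "hnorm (hpower G) (column_op A x) \<le> (\<Sum>i\<in>UNIV. hnorm G (column_op A x $ i))"
      by (rule hnorm_hpower_le[OF G mem])
    also have "\<dots> \<le> (\<Sum>i\<in>UNIV. M i * hnorm H x)"
      by (intro sum_mono) (simp add: column_op_def M[OF x])
    finally show "hnorm (hpower G) (column_op A x) \<le> (\<Sum>i\<in>UNIV. M i) * hnorm H x"
      by (simp add: sum_distrib_right)
  qed (auto simp: column_op_def vec_eq_iff scaleC_vec_def bounded_op_add[OF A] bounded_op_scale[OF A])
qed

section \<open>Absolutely convergent series\<close>

lemma norm_summable_comparison:
  assumes "g summable_on A" "\<And>i. i \<in> A \<Longrightarrow> norm (f i) \<le> (g i :: real)"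
  shows "(\<lambda>i. norm (f i)) summable_on A"
  by (rule summable_on_comparison_test[OF assms]) auto

context hilbert
begin

lemma summable_inner:
  assumes x: "\<And>i. x i \<in> hcarrier H" and sum: "(\<lambda>i. hnorm H (x i)) summable_on A" and h: "h \<in> hcarrier H"
  shows "(\<lambda>i. hinner H h (x i)) summable_on A"
    and "cmod (\<Sum>\<^sub>\<infinity>i\<in>A. hinner H h (x i)) \<le> (\<Sum>\<^sub>\<infinity>i\<in>A. hnorm H (x i)) * hnorm H h"
proof -
  have s: "(\<lambda>i. hnorm H h * hnorm H (x i)) summable_on A"
    using sum by (rule summable_on_cmult_right)
  have abs: "(\<lambda>i. norm (hinner H h (x i))) summable_on A"
    by (rule norm_summable_comparison[OF s]) (use cauchy_schwarz[OF h x] in simp)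
  thus "(\<lambda>i. hinner H h (x i)) summable_on A"
    by (rule abs_summable_summable)
  have "cmod (\<Sum>\<^sub>\<infinity>i\<in>A. hinner H h (x i)) \<le> (\<Sum>\<^sub>\<infinity>i\<in>A. cmod (hinner H h (x i)))"
    using norm_infsum_bound[OF abs] .
  also have "\<dots> \<le> (\<Sum>\<^sub>\<infinity>i\<in>A. hnorm H h * hnorm H (x i))"
    using abs s by (rule infsum_mono) (use cauchy_schwarz[OF h x] in simp)
  also have "\<dots> = (\<Sum>\<^sub>\<infinity>i\<in>A. hnorm H (x i)) * hnorm H h"
    by (simp add: infsum_cmult_right' mult.commute)
  finally show "cmod (\<Sum>\<^sub>\<infinity>i\<in>A. hinner H h (x i)) \<le> (\<Sum>\<^sub>\<infinity>i\<in>A. hnorm H (x i)) * hnorm H h" .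
qed

text \<open>The sum is produced weakly, by Riesz representation of h \<mapsto> the sum of <h, x_i>.
  The same estimate, applied to the tail, bounds the error of finite partial sums in norm, so no
  Cauchy argument for nets is involved.\<close>

lemma abs_summable_series:
  assumes x: "\<And>i. x i \<in> hcarrier H" and sum: "(\<lambda>i. hnorm H (x i)) summable_on UNIV"
  obtains y where "y \<in> hcarrier H" "\<And>h. h \<in> hcarrier H \<Longrightarrow> hinner H h y = (\<Sum>\<^sub>\<infinity>i. hinner H h (x i))"
    "\<And>A. finite A \<Longrightarrow> hnorm H ((\<Sum>i\<in>A. x i) - y) \<le> (\<Sum>\<^sub>\<infinity>i\<in>-A. hnorm H (x i))"
proof -
  define \<phi> where "\<phi> h = cnj (\<Sum>\<^sub>\<infinity>i. hinner H h (x i))" for h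
  have \<phi>: "\<phi> h = (\<Sum>\<^sub>\<infinity>i. hinner H (x i) h)" if "h \<in> hcarrier H" for h
    unfolding \<phi>_def infsum_cnj[symmetric] using inner_commute[OF that x] by simp
  note s = summable_inner[OF x sum]
  obtain z where z: "z \<in> hcarrier H" "\<And>h. h \<in> hcarrier H \<Longrightarrow> cnj (\<phi> h) = hinner H h z"
  proof (rule riesz[of "\<lambda>h. cnj (\<phi> h)" "\<Sum>\<^sub>\<infinity>i. hnorm H (x i)"])
    show "cnj (\<phi> (h + k)) = cnj (\<phi> h) + cnj (\<phi> k)" if "h \<in> hcarrier H" "k \<in> hcarrier H" for h k
      using that s(1) x by (simp add: \<phi>_def inner_add_left infsum_add)
    show "cnj (\<phi> (c *\<^sub>C h)) = c * cnj (\<phi> h)" if "h \<in> hcarrier H" for c h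
      using that s(1) x by (simp add: \<phi>_def inner_scale_left infsum_cmult_right')
    show "cmod (cnj (\<phi> h)) \<le> (\<Sum>\<^sub>\<infinity>i. hnorm H (x i)) * hnorm H h" if "h \<in> hcarrier H" for h
      using that s(2) by (simp add: \<phi>_def)
  qed blast
  have "hnorm H ((\<Sum>i\<in>A. x i) - z) \<le> (\<Sum>\<^sub>\<infinity>i\<in>-A. hnorm H (x i))" if A: "finite A" for A
  proof (rule norm_le_inner_bound)
    show "(\<Sum>i\<in>A. x i) - z \<in> hcarrier H"
      using x z by auto
    show "0 \<le> (\<Sum>\<^sub>\<infinity>i\<in>-A. hnorm H (x i))"
      using x by (intro infsum_nonneg) auto
    fix h assume h: "h \<in> hcarrier H"
    have sA: "(\<lambda>i. hnorm H (x i)) summable_on -A"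
      using sum by (rule summable_on_subset_banach) auto
    have "(\<Sum>\<^sub>\<infinity>i. hinner H h (x i)) = (\<Sum>\<^sub>\<infinity>i\<in>A. hinner H h (x i)) + (\<Sum>\<^sub>\<infinity>i\<in>-A. hinner H h (x i))"
      using infsum_Un_disjoint[of "\<lambda>i. hinner H h (x i)" A "-A"] A summable_inner(1)[OF x sA h]
      by (simp add: Compl_partition)
    hence "hinner H h ((\<Sum>i\<in>A. x i) - z) = - (\<Sum>\<^sub>\<infinity>i\<in>-A. hinner H h (x i))"
      using z h x A by (simp add: inner_diff_right inner_sum_right sum_mem \<phi>_def)
    thus "cmod (hinner H h ((\<Sum>i\<in>A. x i) - z)) \<le> (\<Sum>\<^sub>\<infinity>i\<in>-A. hnorm H (x i)) * hnorm H h"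
      using summable_inner(2)[OF x sA h] by simp
  qed
  with z show ?thesis
    using that[of z] by (simp add: \<phi>_def)
qed

end

lemma infsum_compl_tendsto_0:
  fixes f :: "'i \<Rightarrow> real"
  assumes "f summable_on UNIV"
  shows "((\<lambda>A. \<Sum>\<^sub>\<infinity>i\<in>-A. f i) \<longlongrightarrow> 0) (finite_subsets_at_top UNIV)"
proof -
  have "((\<lambda>A. infsum f UNIV - sum f A) \<longlongrightarrow> infsum f UNIV - infsum f UNIV) (finite_subsets_at_top UNIV)"
    using assms by (intro tendsto_diff tendsto_const infsum_tendsto)
  moreover have "\<forall>\<^sub>F A in finite_subsets_at_top UNIV. infsum f UNIV - sum f A = (\<Sum>\<^sub>\<infinity>i\<in>-A. f i)"
  proof (rule eventually_finite_subsets_at_top_weakI)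
    fix A :: "'i set" assume A: "finite A"
    have "f summable_on -A"
      using assms by (rule summable_on_subset_banach) auto
    thus "infsum f UNIV - sum f A = (\<Sum>\<^sub>\<infinity>i\<in>-A. f i)"
      using infsum_Un_disjoint[of f A "-A"] A by (simp add: Compl_partition)
  qed
  ultimately show ?thesis
    by (simp add: tendsto_cong)
qed

lemma (in hilbert) abs_summable_htendsto:
  fixes x :: "'i \<Rightarrow> 'a"
  assumes x: "\<And>i. x i \<in> hcarrier H" and sum: "(\<lambda>i. hnorm H (x i)) summable_on UNIV"
  obtains y where "htendsto H (\<lambda>A. \<Sum>i\<in>A. x i) y (finite_subsets_at_top UNIV)"
    "\<And>h. h \<in> hcarrier H \<Longrightarrow> hinner H h y = (\<Sum>\<^sub>\<infinity>i. hinner H h (x i))"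
proof -
  obtain y where y: "y \<in> hcarrier H" "\<And>h. h \<in> hcarrier H \<Longrightarrow> hinner H h y = (\<Sum>\<^sub>\<infinity>i. hinner H h (x i))"
    "\<And>A. finite A \<Longrightarrow> hnorm H ((\<Sum>i\<in>A. x i) - y) \<le> (\<Sum>\<^sub>\<infinity>i\<in>-A. hnorm H (x i))"
    using abs_summable_series[OF x sum] by blast
  have "((\<lambda>A. hnorm H ((\<Sum>i\<in>A. x i) - y)) \<longlongrightarrow> 0) (finite_subsets_at_top UNIV)"
  proof (rule Lim_null_comparison[OF _ infsum_compl_tendsto_0[OF sum]])
    show "\<forall>\<^sub>F A in finite_subsets_at_top UNIV.
        norm (hnorm H ((\<Sum>i\<in>A. x i) - y)) \<le> (\<Sum>\<^sub>\<infinity>i\<in>-A. hnorm H (x i))"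
    proof (rule eventually_finite_subsets_at_top_weakI)
      fix A :: "'i set" assume "finite A"
      moreover have "(\<Sum>i\<in>A. x i) - y \<in> hcarrier H"
        using x y(1) by auto
      ultimately show "norm (hnorm H ((\<Sum>i\<in>A. x i) - y)) \<le> (\<Sum>\<^sub>\<infinity>i\<in>-A. hnorm H (x i))"
        using y(3)[of A] by simp
    qed
  qed
  with y show ?thesis
    using that[of y] by (simp add: htendsto_def)
qed

text \<open>Weierstrass test for operators: L is defined pointwise by
  \<open>abs_summable_series\<close>, and the majorant M makes the tail estimate uniform in the
  vector. The third conclusion, the weak form of L, lets operator identities be checked on scalar
  series.\<close>

lemma (in hilbert) operator_series:
  assumes A: "\<And>n::nat. bounded_op H H (A n)"
    and M: "\<And>n x. x \<in> hcarrier H \<Longrightarrow> hnorm H (A n x) \<le> M n * hnorm H x"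
    and M0: "\<And>n. 0 \<le> M n" and sum: "summable M"
  obtains L where "bounded_op H H L" "norm_limit_op H H (\<lambda>N x. \<Sum>n\<le>N. A n x) L"
    "\<And>h x. \<lbrakk>h \<in> hcarrier H; x \<in> hcarrier H\<rbrakk> \<Longrightarrow> hinner H h (L x) = (\<Sum>\<^sub>\<infinity>n. hinner H h (A n x))"
proof -
  have sM: "M summable_on UNIV"
    using sum M0 by (simp add: summable_on_UNIV_nonneg_real_iff)
  note mem = bounded_op_mem[OF A]
  have sMx: "(\<lambda>n. M n * hnorm H x) summable_on B" for x B
    by (rule summable_on_cmult_left, rule summable_on_subset_banach[OF sM]) simp
  have sA: "(\<lambda>n. hnorm H (A n x)) summable_on B" if "x \<in> hcarrier H" for x B
    by (rule summable_on_comparison_test[OF sMx[of x]]) (use that M mem in auto)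
  have "\<exists>y\<in>hcarrier H. (\<forall>h\<in>hcarrier H. hinner H h y = (\<Sum>\<^sub>\<infinity>n. hinner H h (A n x))) \<and>
      (\<forall>B. finite B \<longrightarrow> hnorm H ((\<Sum>n\<in>B. A n x) - y) \<le> (\<Sum>\<^sub>\<infinity>n\<in>-B. hnorm H (A n x)))"
    if "x \<in> hcarrier H" for x
    using abs_summable_series[OF mem[OF that] sA[OF that]] by metis
  then obtain L where L: "\<And>x. x \<in> hcarrier H \<Longrightarrow> L x \<in> hcarrier H"
    "\<And>h x. \<lbrakk>h \<in> hcarrier H; x \<in> hcarrier H\<rbrakk> \<Longrightarrow> hinner H h (L x) = (\<Sum>\<^sub>\<infinity>n. hinner H h (A n x))"
    "\<And>x B. \<lbrakk>x \<in> hcarrier H; finite B\<rbrakk> \<Longrightarrow> hnorm H ((\<Sum>n\<in>B. A n x) - L x) \<le> (\<Sum>\<^sub>\<infinity>n\<in>-B. hnorm H (A n x))"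
    by metis
  have tail: "hnorm H ((\<Sum>n\<in>B. A n x) - L x) \<le> (\<Sum>\<^sub>\<infinity>n\<in>-B. M n) * hnorm H x"
    if x: "x \<in> hcarrier H" and B: "finite B" for x B
  proof -
    have "(\<Sum>\<^sub>\<infinity>n\<in>-B. hnorm H (A n x)) \<le> (\<Sum>\<^sub>\<infinity>n\<in>-B. M n * hnorm H x)"
      by (rule infsum_mono[OF sA[OF x] sMx]) (rule M[OF x])
    thus ?thesis
      using L(3)[OF x B] by (simp add: infsum_cmult_left')
  qed
  have "bounded_op H H L"
  proof (rule bounded_opI)
    fix x y assume x: "x \<in> hcarrier H" and y: "y \<in> hcarrier H"
    show "L (x + y) = L x + L y"
      by (rule eqI_inner) (use x y in \<open>auto simp: L add_mem bounded_op_add[OF A] inner_add_right mem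
          intro!: infsum_add summable_inner(1)[OF _ sA]\<close>)
  next
    fix c x assume x: "x \<in> hcarrier H"
    show "L (c *\<^sub>C x) = c *\<^sub>C L x"
      by (rule eqI_inner) (use x in \<open>auto simp: L scale_mem bounded_op_scale[OF A] inner_scale_right mem
          infsum_cmult_right'\<close>)
  next
    fix x assume x: "x \<in> hcarrier H"
    show "hnorm H (L x) \<le> (\<Sum>\<^sub>\<infinity>n. M n) * hnorm H x"
      using tail[OF x, of "{}"] L(1)[OF x] by (simp add: norm_minus)
  qed (rule L)
  moreover have "norm_limit_op H H (\<lambda>N x. \<Sum>n\<le>N. A n x) L"
    unfolding norm_limit_op_def
  proof (intro allI impI)
    fix e :: real assume "e > 0"
    from order_tendstoD(2)[OF infsum_compl_tendsto_0[OF sM] this]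
    obtain F where F: "finite F" "\<And>B. \<lbrakk>finite B; F \<subseteq> B\<rbrakk> \<Longrightarrow> (\<Sum>\<^sub>\<infinity>n\<in>-B. M n) < e"
      unfolding eventually_finite_subsets_at_top by auto
    obtain N where N: "F \<subseteq> {..N}"
      using F(1) finite_nat_iff_bounded_le by auto
    have "hnorm H ((\<Sum>k\<le>n. A k x) - L x) \<le> e * hnorm H x" if n: "n \<ge> N" and x: "x \<in> hcarrier H" for n x
    proof -
      have "(\<Sum>\<^sub>\<infinity>n\<in>-{..n}. M n) < e"
        using N n by (intro F(2)) auto
      thus ?thesis
        using tail[OF x, of "{..n}"] mult_right_mono[of "\<Sum>\<^sub>\<infinity>n\<in>-{..n}. M n" e "hnorm H x"] x by auto
    qed
    thus "\<exists>N. \<forall>n\<ge>N. \<forall>x\<in>hcarrier H. hnorm H ((\<Sum>n\<le>n. A n x) - L x) \<le> e * hnorm H x"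
      by blast
  qed
  ultimately show ?thesis
    using that L(2) by blast
qed

section \<open>Positive square roots\<close>

text \<open>The form <S x, y> - <x, S y> vanishes on the diagonal, since <S x, x> is real;
  polarization does the rest.\<close>

lemma (in inner_space) positive_op_symmetric:
  assumes S: "bounded_op H H S" "positive_op H S" and x: "x \<in> hcarrier H" and y: "y \<in> hcarrier H"
  shows "hinner H (S x) y = hinner H x (S y)"
proof -
  note mem = bounded_op_mem[OF S(1)]
  have "hinner H (S x) y - hinner H x (S y) = 0"
  proof (rule sesquilinear_eq_0[where A = "\<lambda>x y. hinner H (S x) y - hinner H x (S y)", OF _ _ _ _ _ x y])
    fix x assume x: "x \<in> hcarrier H"
    have "Im (hinner H (S x) x) = 0"
      using S(2) x by (simp add: positive_op_def)
    thus "hinner H (S x) x - hinner H x (S x) = 0"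
      using inner_commute[OF mem[OF x] x] by (simp add: complex_eq_iff)
  qed (auto simp: bounded_op_add[OF S(1)] bounded_op_scale[OF S(1)] inner_add_left inner_add_right
      inner_scale_left inner_scale_right mem algebra_simps)
  thus ?thesis by simp
qed

text \<open>The coefficients of \<open>(1 - x)\<^bsup>1/2\<^esup>\<close>.\<close>

definition sqrt_coeff :: "nat \<Rightarrow> real"
  where "sqrt_coeff n = pochhammer (- 1 / 2) n / fact n"

lemma sqrt_coeff_0 [simp]: "sqrt_coeff 0 = 1"
  by (simp add: sqrt_coeff_def)

lemma sqrt_coeff_nonpos: "sqrt_coeff (Suc n) \<le> 0"
  by (induction n) (auto simp: sqrt_coeff_def pochhammer_rec' divide_nonpos_pos mult_nonneg_nonpos
      simp: divide_le_0_iff mult_le_0_iff)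

text \<open>The right side is the coefficient of (1 - x)^(-1/2), since multiplying by 1/(1 - x) sums
  coefficients. It is nonnegative, which yields both the absolute summability and the sign of the
  total sum.\<close>

lemma sqrt_coeff_sum: "(\<Sum>k\<le>n. sqrt_coeff k) = pochhammer (1 / 2) n / fact n"
proof (induction n)
  case (Suc n)
  have "pochhammer (- 1 / 2) (Suc n) = - (1 / 2) * (pochhammer (1 / 2) n :: real)"
    using pochhammer_rec[of "- 1 / 2 :: real" n] by simp
  hence "sqrt_coeff (Suc n) = - (1 / 2) * pochhammer (1 / 2) n / fact (Suc n)"
    by (simp only: sqrt_coeff_def)
  moreover have "p / F + - (1 / 2) * p / (N * F) = (N - 1 / 2) * p / (N * F)"
    if "F > 0" "N > 0" for p F N :: real
    using that by (simp add: field_simps)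
  from this[of "fact n" "real n + 1" "pochhammer (1 / 2) n"]
  have "pochhammer (1 / 2) n / fact n + - (1 / 2) * pochhammer (1 / 2) n / fact (Suc n)
      = pochhammer (1 / 2) (Suc n) / (fact (Suc n) :: real)"
    by (simp add: pochhammer_rec' add.commute)
  ultimately show ?case
    by (simp only: sum.atMost_Suc Suc.IH)
qed simp

text \<open>The square of (1 - x)^(1/2) is 1 - x; on coefficients this is Vandermonde's identity
  with 1/2 + 1/2 = 1.\<close>

lemma sqrt_coeff_convolution: "(\<Sum>k\<le>n. sqrt_coeff k * sqrt_coeff (n - k)) = (if n = 0 then 1 else if n = 1 then - 1 else 0)"
proof -
  have c: "sqrt_coeff k = (- 1) ^ k * ((1 / 2) gchoose k)" for k
    by (simp add: sqrt_coeff_def gbinomial_pochhammer)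
  have "(\<Sum>k\<le>n. sqrt_coeff k * sqrt_coeff (n - k)) =
      (\<Sum>k\<le>n. (- 1) ^ n * (((1 / 2) gchoose k) * ((1 / 2) gchoose (n - k))))"
  proof (rule sum.cong)
    fix k assume "k \<in> {..n}"
    hence "(- 1 :: real) ^ n = (- 1) ^ k * (- 1) ^ (n - k)"
      by (simp flip: power_add)
    thus "sqrt_coeff k * sqrt_coeff (n - k) = (- 1) ^ n * (((1 / 2) gchoose k) * ((1 / 2) gchoose (n - k)))"
      by (simp add: c)
  qed simp
  also have "\<dots> = (- 1) ^ n * ((1::real) gchoose n)"
    using gbinomial_Vandermonde[of "1/2 :: real" "1/2" n]
    by (simp add: sum_distrib_left[symmetric] atMost_atLeast0)
  also have "(1::real) gchoose n = of_nat (1 choose n)"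
    using binomial_gbinomial[of 1 n, where 'a = real] by simp
  finally show ?thesis
    by (auto simp: binomial_eq_0 not_le)
qed

text \<open>All coefficients after the first are nonpositive, so the absolute partial sums are 2
  minus the partial sums and never exceed 2. This makes the binomial series usable up to norm 1 of
  its argument.\<close>

lemma summable_abs_sqrt_coeff: "summable (\<lambda>n. \<bar>sqrt_coeff n\<bar>)"
proof (rule bounded_imp_summable)
  fix n
  have "(\<Sum>k\<le>n. \<bar>sqrt_coeff k\<bar>) = (\<Sum>k\<le>n. (if k = 0 then 2 else 0) - sqrt_coeff k)"
  proof (rule sum.cong)
    fix k show "\<bar>sqrt_coeff k\<bar> = (if k = 0 then 2 else 0) - sqrt_coeff k"
      using sqrt_coeff_nonpos[of "k - 1"] by (cases k) auto
  qed simp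
  also have "\<dots> = 2 - (\<Sum>k\<le>n. sqrt_coeff k)"
    by (simp add: sum_subtractf)
  also have "\<dots> \<le> 2"
    by (simp add: sqrt_coeff_sum pochhammer_nonneg)
  finally show "(\<Sum>k\<le>n. \<bar>sqrt_coeff k\<bar>) \<le> 2" .
qed simp

lemma infsum_sqrt_coeff_nonneg: "0 \<le> (\<Sum>\<^sub>\<infinity>n. sqrt_coeff n)"
proof -
  have s: "summable sqrt_coeff"
    by (rule summable_rabs_cancel[OF summable_abs_sqrt_coeff])
  have "sqrt_coeff summable_on UNIV"
    by (rule abs_summable_summable)
      (use summable_abs_sqrt_coeff in \<open>simp add: summable_on_UNIV_nonneg_real_iff\<close>)
  hence "infsum sqrt_coeff UNIV = suminf sqrt_coeff"
    by (simp add: has_sum_imp_sums sums_unique)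
  moreover have "0 \<le> suminf sqrt_coeff"
    using summable_LIMSEQ'[OF s]
    by (rule LIMSEQ_le_const) (auto simp: sqrt_coeff_sum pochhammer_nonneg)
  ultimately show ?thesis by simp
qed

text \<open>The double series collapses along the antidiagonals.\<close>

lemma sqrt_coeff_double_series:
  fixes f :: "nat \<Rightarrow> complex"
  assumes f: "\<And>n. cmod (f n) \<le> M"
  shows "(\<Sum>\<^sub>\<infinity>m. sqrt_coeff m * (\<Sum>\<^sub>\<infinity>n. sqrt_coeff n * f (m + n))) = f 0 - f 1"
proof -
  define g where "g = (\<lambda>(m, n). complex_of_real (sqrt_coeff m) * (complex_of_real (sqrt_coeff n) * f (m + n)))"
  have M: "M \<ge> 0"
    using f[of 0] norm_ge_zero order_trans by blast
  have abs: "(\<lambda>n. \<bar>sqrt_coeff n\<bar>) summable_on UNIV"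
    using summable_abs_sqrt_coeff by (simp add: summable_on_UNIV_nonneg_real_iff)
  have "(\<lambda>(m, n). \<bar>sqrt_coeff m\<bar> * \<bar>sqrt_coeff n\<bar>) summable_on UNIV \<times> UNIV"
    using abs
    by (intro summable_on_SigmaI[where g = "\<lambda>m. \<bar>sqrt_coeff m\<bar> * (\<Sum>\<^sub>\<infinity>n. \<bar>sqrt_coeff n\<bar>)"])
      (auto intro!: has_sum_cmult_right has_sum_infsum summable_on_cmult_left)
  hence "(\<lambda>p. M * (case p of (m, n) \<Rightarrow> \<bar>sqrt_coeff m\<bar> * \<bar>sqrt_coeff n\<bar>)) summable_on UNIV \<times> UNIV"
    by (rule summable_on_cmult_right)
  hence "(\<lambda>p. norm (g p)) summable_on UNIV \<times> UNIV"
    by (rule norm_summable_comparison)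
      (use f in \<open>auto simp: g_def norm_mult intro!: mult_left_mono
        simp: mult.commute[of M] mult.assoc[symmetric]\<close>)
  hence g: "g summable_on UNIV \<times> UNIV"
    by (rule abs_summable_summable)
  have "(\<Sum>\<^sub>\<infinity>m. sqrt_coeff m * (\<Sum>\<^sub>\<infinity>n. sqrt_coeff n * f (m + n))) = (\<Sum>\<^sub>\<infinity>m. \<Sum>\<^sub>\<infinity>n. g (m, n))"
    by (simp add: g_def infsum_cmult_right')
  also have "\<dots> = infsum g (UNIV \<times> UNIV)"
    using infsum_Sigma'_banach[of "\<lambda>m n. g (m, n)" UNIV "\<lambda>_. UNIV"] g by simp
  also have "\<dots> = infsum (\<lambda>(k, m). g (m, k - m)) (Sigma UNIV (\<lambda>k. {..k}))"
    by (rule infsum_reindex_bij_witness[where j = "\<lambda>(m, n). (m + n, m)" and i = "\<lambda>(k, m). (m, k - m)"]) auto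
  also have "\<dots> = (\<Sum>\<^sub>\<infinity>k. \<Sum>\<^sub>\<infinity>m\<in>{..k}. g (m, k - m))"
  proof (rule infsum_Sigma'_banach[symmetric])
    show "(\<lambda>(k, m). g (m, k - m)) summable_on Sigma UNIV (\<lambda>k. {..k})"
      using g by (subst summable_on_reindex_bij_witness[where i = "\<lambda>(m, n). (m + n, m)"
            and j = "\<lambda>(k, m). (m, k - m)" and T = "UNIV \<times> UNIV" and h = g]) auto
  qed
  also have "\<dots> = (\<Sum>\<^sub>\<infinity>k. of_real (if k = 0 then 1 else if k = 1 then - 1 else 0) * f k)"
  proof (rule infsum_cong)
    fix k
    have "(\<Sum>\<^sub>\<infinity>m\<in>{..k}. g (m, k - m)) = (\<Sum>m\<le>k. of_real (sqrt_coeff m * sqrt_coeff (k - m)) * f k)"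
      by (auto simp: g_def intro!: sum.cong)
    also have "\<dots> = of_real (\<Sum>m\<le>k. sqrt_coeff m * sqrt_coeff (k - m)) * f k"
      by (simp add: sum_distrib_right)
    finally show "(\<Sum>\<^sub>\<infinity>m\<in>{..k}. g (m, k - m)) = of_real (if k = 0 then 1 else if k = 1 then - 1 else 0) * f k"
      by (simp only: sqrt_coeff_convolution)
  qed
  also have "\<dots> = (\<Sum>\<^sub>\<infinity>k\<in>{0, 1}. of_real (if k = 0 then 1 else if k = 1 then - 1 else 0) * f k)"
    by (rule infsum_cong_neutral) auto
  also have "\<dots> = f 0 - f 1"
    by simp
  finally show ?thesis .
qed

text \<open>The hypothesis \<open>le\<close> bounds the square of P by P, that is 0 \<le> P \<le> 1,
  and makes 1 - P a contraction. Then S is the binomial series of (1 - x)^(1/2) at x = 1 - P, which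
  converges absolutely even if 1 - P has norm 1.\<close>

theorem (in hilbert) sqrt_exists:
  assumes P: "bounded_op H H P" "positive_op H P"
    and le: "\<And>x. x \<in> hcarrier H \<Longrightarrow> (hnorm H (P x))\<^sup>2 \<le> Re (hinner H (P x) x)"
  shows "\<exists>S. bounded_op H H S \<and> positive_op H S \<and> (\<forall>x\<in>hcarrier H. S (S x) = P x)"
proof -
  define A where "A n = (\<lambda>x. x - P x) ^^ n" for n
  note P_mem = bounded_op_mem[OF P(1)] and P_sym = positive_op_symmetric[OF P]
  have A_Suc: "A (Suc n) x = A n x - P (A n x)" for n x
    by (simp add: A_def)
  have A_mem: "A n x \<in> hcarrier H" if "x \<in> hcarrier H" for n x
    using that by (induction n) (auto simp: A_Suc P_mem, simp add: A_def)
  have A_add: "A (m + n) x = A m (A n x)" for m n x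
    by (simp add: A_def funpow_add)
  have contr: "hnorm H (x - P x) \<le> hnorm H x" if x: "x \<in> hcarrier H" for x
  proof (rule power2_le_imp_le)
    have "(hnorm H (x - P x))\<^sup>2 = (hnorm H x)\<^sup>2 - 2 * Re (hinner H (P x) x) + (hnorm H (P x))\<^sup>2"
      using norm_add_sq[OF x, of "- P x"] x P_mem[OF x] P_sym[OF x x]
      by (simp add: uminus_mem norm_minus inner_minus_right)
    also have "\<dots> \<le> (hnorm H x)\<^sup>2"
      using le[OF x] zero_le_power2[of "hnorm H (P x)"] by linarith
    finally show "(hnorm H (x - P x))\<^sup>2 \<le> (hnorm H x)\<^sup>2" .
  qed (use x in simp)
  have A_norm: "hnorm H (A n x) \<le> hnorm H x" if "x \<in> hcarrier H" for n x
    using that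
  proof (induction n)
    case (Suc n)
    thus ?case
      using contr[OF A_mem[OF Suc.prems, of n]] by (simp add: A_Suc)
  qed (simp add: A_def)
  have A_sym: "hinner H (A n x) y = hinner H x (A n y)" if "x \<in> hcarrier H" "y \<in> hcarrier H" for n x y
    using that
  proof (induction n arbitrary: x)
    case (Suc n)
    have "A (Suc n) x = A n (x - P x)"
      by (simp add: A_def funpow_Suc_right del: funpow.simps)
    thus ?case
      using Suc by (simp add: A_Suc diff_mem P_mem A_mem inner_diff_left inner_diff_right P_sym)
  qed (simp add: A_def)
  have A_bounded: "bounded_op H H (A n)" for n
  proof (rule bounded_opI[where M = 1])
    show "A n (x + y) = A n x + A n y" if "x \<in> hcarrier H" "y \<in> hcarrier H" for x y
      using that by (induction n) (auto simp: A_Suc bounded_op_add[OF P(1)] A_mem, simp add: A_def)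
    show "A n (c *\<^sub>C x) = c *\<^sub>C A n x" if "x \<in> hcarrier H" for c x
      using that by (induction n)
        (auto simp: A_Suc bounded_op_scale[OF P(1)] A_mem scaleC_diff_right, simp add: A_def)
  qed (auto simp: A_mem A_norm)
  obtain S where S: "bounded_op H H S"
    and S_inner: "\<And>h x. \<lbrakk>h \<in> hcarrier H; x \<in> hcarrier H\<rbrakk> \<Longrightarrow>
      hinner H h (S x) = (\<Sum>\<^sub>\<infinity>n. hinner H h (of_real (sqrt_coeff n) *\<^sub>C A n x))"
  proof (rule operator_series[of "\<lambda>n x. of_real (sqrt_coeff n) *\<^sub>C A n x" "\<lambda>n. \<bar>sqrt_coeff n\<bar>"])
    fix n
    have "hnorm H (of_real (sqrt_coeff n) *\<^sub>C A n x) \<le> \<bar>sqrt_coeff n\<bar> * hnorm H x"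
      if x: "x \<in> hcarrier H" for x
      using A_norm[OF x] A_mem[OF x] by (simp add: norm_scale mult_left_mono)
    thus "\<And>x. x \<in> hcarrier H \<Longrightarrow> hnorm H (of_real (sqrt_coeff n) *\<^sub>C A n x) \<le> \<bar>sqrt_coeff n\<bar> * hnorm H x"
      and "bounded_op H H (\<lambda>x. of_real (sqrt_coeff n) *\<^sub>C A n x)"
      by (auto intro!: bounded_opI[where M = "\<bar>sqrt_coeff n\<bar>"] simp: bounded_op_add[OF A_bounded]
          bounded_op_scale[OF A_bounded] scaleC_add_right scaleC_scaleC mult.commute A_mem)
  qed (use summable_abs_sqrt_coeff in auto)
  have S_mem: "S x \<in> hcarrier H" if "x \<in> hcarrier H" for x
    using bounded_op_mem[OF S that] .
  have S_inner': "hinner H h (S x) = (\<Sum>\<^sub>\<infinity>n. of_real (sqrt_coeff n) * hinner H h (A n x))"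
    if "h \<in> hcarrier H" "x \<in> hcarrier H" for h x
    using that by (simp add: S_inner inner_scale_right A_mem)
  have "S (S x) = P x" if x: "x \<in> hcarrier H" for x
  proof (rule eqI_inner)
    fix h assume h: "h \<in> hcarrier H"
    \<comment> \<open>Symmetry moves A m to the other side of the pairing, so the double series for
      S S depends on m + n only.\<close>
    define f where "f n = hinner H h (A n x)" for n
    have "hinner H h (S (S x)) = (\<Sum>\<^sub>\<infinity>m. of_real (sqrt_coeff m) * hinner H (A m h) (S x))"
      using h x by (simp add: S_inner' S_mem A_sym)
    also have "\<dots> = (\<Sum>\<^sub>\<infinity>m. of_real (sqrt_coeff m) * (\<Sum>\<^sub>\<infinity>n. of_real (sqrt_coeff n) * f (m + n)))"
      using h x by (simp add: S_inner' A_mem A_sym f_def A_add)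
    also have "\<dots> = f 0 - f 1"
    proof (rule sqrt_coeff_double_series)
      fix n
      have "cmod (f n) \<le> hnorm H h * hnorm H (A n x)"
        unfolding f_def by (rule cauchy_schwarz[OF h A_mem[OF x]])
      also have "\<dots> \<le> hnorm H h * hnorm H x"
        using h A_norm[OF x] by (simp add: mult_left_mono)
      finally show "cmod (f n) \<le> hnorm H h * hnorm H x" .
    qed
    also have "\<dots> = hinner H h (P x)"
      using h x by (simp add: f_def A_def inner_diff_right P_mem)
    finally show "hinner H h (S (S x)) = hinner H h (P x)" .
  qed (use x in \<open>auto simp: S_mem P_mem\<close>)
  moreover have "positive_op H S"
    unfolding positive_op_def
  proof
    fix x assume x: "x \<in> hcarrier H"
    define f where "f n = hinner H x (A n x)" for n
    have f_real: "f n = of_real (Re (f n))" for n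
      using A_sym[OF x x] inner_commute[OF x A_mem[OF x]] by (simp add: f_def complex_eq_iff)
    have f_le: "\<bar>Re (f n)\<bar> \<le> (hnorm H x)\<^sup>2" for n
    proof -
      have "cmod (f n) \<le> hnorm H x * hnorm H (A n x)"
        unfolding f_def by (rule cauchy_schwarz[OF x A_mem[OF x]])
      also have "\<dots> \<le> hnorm H x * hnorm H x"
        using x A_norm[OF x] by (simp add: mult_left_mono)
      finally show ?thesis
        using abs_Re_le_cmod[of "f n"] by (simp add: power2_eq_square)
    qed
    have abs: "(\<lambda>n. \<bar>sqrt_coeff n\<bar>) summable_on UNIV"
      using summable_abs_sqrt_coeff by (simp add: summable_on_UNIV_nonneg_real_iff)
    have s1: "(\<lambda>n. sqrt_coeff n * Re (f n)) summable_on UNIV"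
    proof (rule abs_summable_summable, rule norm_summable_comparison)
      show "(\<lambda>n. \<bar>sqrt_coeff n\<bar> * (hnorm H x)\<^sup>2) summable_on UNIV"
        using abs by (rule summable_on_cmult_left)
    qed (use f_le in \<open>simp add: abs_mult mult_left_mono\<close>)
    have s2: "(\<lambda>n. sqrt_coeff n * (hnorm H x)\<^sup>2) summable_on UNIV"
      by (rule summable_on_cmult_left, rule abs_summable_summable) (use abs in simp)
    have "hinner H x (S x) = (\<Sum>\<^sub>\<infinity>n. of_real (sqrt_coeff n) * of_real (Re (f n)))"
      using S_inner'[OF x x] f_real by (simp add: f_def)
    also have "\<dots> = of_real (\<Sum>\<^sub>\<infinity>n. sqrt_coeff n * Re (f n))"
      using has_sum_of_real[OF has_sum_infsum[OF s1]] by (intro infsumI) simp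
    finally have *: "hinner H (S x) x = of_real (\<Sum>\<^sub>\<infinity>n. sqrt_coeff n * Re (f n))"
      using inner_commute[OF x S_mem[OF x]] by simp
    have "0 \<le> (\<Sum>\<^sub>\<infinity>n. sqrt_coeff n) * (hnorm H x)\<^sup>2"
      by (simp add: infsum_sqrt_coeff_nonneg)
    also have "\<dots> = (\<Sum>\<^sub>\<infinity>n. sqrt_coeff n * (hnorm H x)\<^sup>2)"
      by (simp add: infsum_cmult_left')
    also have "\<dots> \<le> (\<Sum>\<^sub>\<infinity>n. sqrt_coeff n * Re (f n))"
    \<comment> \<open>Replacing the squared norm of x by <x, A n x>, which is at most as large, can
      only raise each term: at n = 0 the two agree, afterwards the coefficient is
      nonpositive.\<close>
    proof (rule infsum_mono[OF s2 s1])
      fix n show "sqrt_coeff n * (hnorm H x)\<^sup>2 \<le> sqrt_coeff n * Re (f n)"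
      proof (cases n)
        case 0
        thus ?thesis
          using x by (simp add: f_def A_def inner_self flip: of_real_power)
      next
        case (Suc m)
        thus ?thesis
          using f_le[of n] sqrt_coeff_nonpos[of m] by (intro mult_left_mono_neg) auto
      qed
    qed
    finally show "Im (hinner H (S x) x) = 0 \<and> 0 \<le> Re (hinner H (S x) x)"
      by (simp add: *)
  qed
  ultimately show ?thesis
    using S by blast
qed

section \<open>Weighted square-summable families\<close>

text \<open>The coefficient side of H_K(E), isometric to it when w \<alpha> is a_|\<alpha>| times
  \<gamma>_\<alpha>. Kept over an arbitrary index type, free of functions on the ball, so that
  completeness is a statement about families.\<close>

definition weighted_l2 :: "('i \<Rightarrow> real) \<Rightarrow> 'e::complex_vector hilbert \<Rightarrow> ('i \<Rightarrow> 'e) hilbert"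
  where "weighted_l2 w E =
    \<lparr>hcarrier = {\<phi>. (\<forall>\<alpha>. \<phi> \<alpha> \<in> hcarrier E) \<and> (\<lambda>\<alpha>. (hnorm E (\<phi> \<alpha>))\<^sup>2 / w \<alpha>) summable_on UNIV},
     hinner = (\<lambda>\<phi> \<psi>. \<Sum>\<^sub>\<infinity>\<alpha>. hinner E (\<phi> \<alpha>) (\<psi> \<alpha>) / of_real (w \<alpha>))\<rparr>"

lemma weighted_l2_mem_iff:
  "\<phi> \<in> hcarrier (weighted_l2 w E) \<longleftrightarrow>
    (\<forall>\<alpha>. \<phi> \<alpha> \<in> hcarrier E) \<and> (\<lambda>\<alpha>. (hnorm E (\<phi> \<alpha>))\<^sup>2 / w \<alpha>) summable_on UNIV"
  by (simp add: weighted_l2_def)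

locale weighted = hilbert E for E :: "'e::complex_vector hilbert" +
  fixes w :: "'i \<Rightarrow> real"
  assumes w_pos: "w \<alpha> > 0"
begin

abbreviation "L2 \<equiv> weighted_l2 w E"

lemma w_simps [simp]: "w \<alpha> \<noteq> 0" "0 \<le> w \<alpha>" "\<not> w \<alpha> \<le> 0"
  using w_pos[of \<alpha>] by auto

lemma L2D: "\<phi> \<in> hcarrier L2 \<Longrightarrow> \<phi> \<alpha> \<in> hcarrier E"
  and L2_summable: "\<phi> \<in> hcarrier L2 \<Longrightarrow> (\<lambda>\<alpha>. (hnorm E (\<phi> \<alpha>))\<^sup>2 / w \<alpha>) summable_on UNIV"
  by (simp_all add: weighted_l2_mem_iff)

lemma L2I_le:
  assumes "\<And>\<alpha>. \<phi> \<alpha> \<in> hcarrier E" "\<And>\<alpha>. (hnorm E (\<phi> \<alpha>))\<^sup>2 / w \<alpha> \<le> g \<alpha>" "g summable_on UNIV"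
  shows "\<phi> \<in> hcarrier L2"
  unfolding weighted_l2_mem_iff
  using assms(1) by (auto intro!: summable_on_comparison_test[OF assms(3)] assms(2))

lemma L2_inner_abs_summable:
  assumes \<phi>: "\<phi> \<in> hcarrier L2" and \<psi>: "\<psi> \<in> hcarrier L2"
  shows "(\<lambda>\<alpha>. cmod (hinner E (\<phi> \<alpha>) (\<psi> \<alpha>) / of_real (w \<alpha>))) summable_on UNIV"
proof (rule norm_summable_comparison)
  show "(\<lambda>\<alpha>. (hnorm E (\<phi> \<alpha>))\<^sup>2 / w \<alpha> + (hnorm E (\<psi> \<alpha>))\<^sup>2 / w \<alpha>) summable_on UNIV"
    using assms by (intro summable_on_add L2_summable)
  fix \<alpha>
  let ?a = "hnorm E (\<phi> \<alpha>)" and ?b = "hnorm E (\<psi> \<alpha>)"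
  have "cmod (hinner E (\<phi> \<alpha>) (\<psi> \<alpha>)) \<le> ?a * ?b"
    using L2D[OF \<phi>] L2D[OF \<psi>] by (rule cauchy_schwarz)
  also have "\<dots> \<le> ?a\<^sup>2 + ?b\<^sup>2"
    using sum_squares_bound[of ?a ?b] zero_le_power2[of ?a] zero_le_power2[of ?b]
      L2D[OF \<phi>, of \<alpha>] L2D[OF \<psi>, of \<alpha>] mult_nonneg_nonneg[of ?a ?b] by (simp only: norm_ge_0)
  finally show "cmod (hinner E (\<phi> \<alpha>) (\<psi> \<alpha>) / of_real (w \<alpha>)) \<le> ?a\<^sup>2 / w \<alpha> + ?b\<^sup>2 / w \<alpha>"
    by (simp add: norm_divide divide_right_mono flip: add_divide_distrib)
qed

lemma L2_inner_summable:
  "\<lbrakk>\<phi> \<in> hcarrier L2; \<psi> \<in> hcarrier L2\<rbrakk> \<Longrightarrow>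
    (\<lambda>\<alpha>. hinner E (\<phi> \<alpha>) (\<psi> \<alpha>) / of_real (w \<alpha>)) summable_on UNIV"
  by (rule abs_summable_summable[OF L2_inner_abs_summable])

lemma L2_inner: "hinner L2 \<phi> \<psi> = (\<Sum>\<^sub>\<infinity>\<alpha>. hinner E (\<phi> \<alpha>) (\<psi> \<alpha>) / of_real (w \<alpha>))"
  by (simp add: weighted_l2_def)

lemma L2_inner_self:
  assumes "\<phi> \<in> hcarrier L2"
  shows "hinner L2 \<phi> \<phi> = of_real (\<Sum>\<^sub>\<infinity>\<alpha>. (hnorm E (\<phi> \<alpha>))\<^sup>2 / w \<alpha>)"
proof -
  have "hinner L2 \<phi> \<phi> = (\<Sum>\<^sub>\<infinity>\<alpha>. of_real ((hnorm E (\<phi> \<alpha>))\<^sup>2 / w \<alpha>))"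
    using L2D[OF assms] by (simp add: L2_inner inner_self)
  also have "\<dots> = of_real (\<Sum>\<^sub>\<infinity>\<alpha>. (hnorm E (\<phi> \<alpha>))\<^sup>2 / w \<alpha>)"
    by (intro infsumI has_sum_of_real has_sum_infsum L2_summable assms)
  finally show ?thesis .
qed

lemma L2_norm_sq:
  assumes "\<phi> \<in> hcarrier L2"
  shows "(hnorm L2 \<phi>)\<^sup>2 = (\<Sum>\<^sub>\<infinity>\<alpha>. (hnorm E (\<phi> \<alpha>))\<^sup>2 / w \<alpha>)"
proof -
  have "0 \<le> (\<Sum>\<^sub>\<infinity>\<alpha>. (hnorm E (\<phi> \<alpha>))\<^sup>2 / w \<alpha>)"
    by (rule infsum_nonneg) simp
  thus ?thesis
    by (simp add: hnorm_def[of L2] L2_inner_self[OF assms])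
qed

lemma L2_norm_le:
  assumes "\<phi> \<in> hcarrier L2" "0 \<le> M"
    and "\<And>F. finite F \<Longrightarrow> (\<Sum>\<alpha>\<in>F. (hnorm E (\<phi> \<alpha>))\<^sup>2 / w \<alpha>) \<le> M\<^sup>2"
  shows "hnorm L2 \<phi> \<le> M"
proof (rule power2_le_imp_le)
  show "(hnorm L2 \<phi>)\<^sup>2 \<le> M\<^sup>2"
    unfolding L2_norm_sq[OF assms(1)]
    by (rule infsum_le_finite_sums[OF L2_summable[OF assms(1)]]) (use assms(3) in blast)
qed (rule assms)

lemma L2_finite_sum_le:
  assumes "\<phi> \<in> hcarrier L2" "finite F"
  shows "(\<Sum>\<alpha>\<in>F. (hnorm E (\<phi> \<alpha>))\<^sup>2 / w \<alpha>) \<le> (hnorm L2 \<phi>)\<^sup>2"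
  unfolding L2_norm_sq[OF assms(1)]
  by (rule finite_sum_le_infsum[OF L2_summable[OF assms(1)]]) (use assms in auto)

text \<open>Continuity of the coefficient functionals. It drives coordinatewise convergence, the
  bound for evaluation at 0 and the identification of limits by their coefficients.\<close>

lemma L2_coeff_le:
  assumes "\<phi> \<in> hcarrier L2"
  shows "(hnorm E (\<phi> \<alpha>))\<^sup>2 \<le> w \<alpha> * (hnorm L2 \<phi>)\<^sup>2"
  using L2_finite_sum_le[OF assms, of "{\<alpha>}"] w_pos[of \<alpha>] by (simp add: field_simps)

lemma L2_scale_mem:
  assumes "\<phi> \<in> hcarrier L2"
  shows "c *\<^sub>C \<phi> \<in> hcarrier L2"
proof (rule L2I_le)
  show "(hnorm E ((c *\<^sub>C \<phi>) \<alpha>))\<^sup>2 / w \<alpha> \<le> (cmod c)\<^sup>2 * ((hnorm E (\<phi> \<alpha>))\<^sup>2 / w \<alpha>)" for \<alpha>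
    using L2D[OF assms] by (simp add: scaleC_fun_def norm_scale power_mult_distrib)
  show "(\<lambda>\<alpha>. (cmod c)\<^sup>2 * ((hnorm E (\<phi> \<alpha>))\<^sup>2 / w \<alpha>)) summable_on UNIV"
    by (rule summable_on_cmult_right[OF L2_summable[OF assms]])
qed (use L2D[OF assms] in \<open>auto simp: scaleC_fun_def\<close>)

lemma L2_add_mem:
  assumes \<phi>: "\<phi> \<in> hcarrier L2" and \<psi>: "\<psi> \<in> hcarrier L2"
  shows "\<phi> + \<psi> \<in> hcarrier L2"
proof (rule L2I_le)
  fix \<alpha>
  let ?a = "hnorm E (\<phi> \<alpha>)" and ?b = "hnorm E (\<psi> \<alpha>)"
  have m: "\<phi> \<alpha> \<in> hcarrier E" "\<psi> \<alpha> \<in> hcarrier E"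
    using L2D assms by auto
  have "(hnorm E (\<phi> \<alpha> + \<psi> \<alpha>))\<^sup>2 \<le> (?a + ?b)\<^sup>2"
    using norm_triangle[OF m] m by (intro power_mono) (auto simp: add_mem)
  also have "\<dots> \<le> 2 * ?a\<^sup>2 + 2 * ?b\<^sup>2"
    using sum_squares_bound[of ?a ?b] by (simp add: power2_sum)
  finally show "(hnorm E ((\<phi> + \<psi>) \<alpha>))\<^sup>2 / w \<alpha> \<le> 2 * (?a\<^sup>2 / w \<alpha>) + 2 * (?b\<^sup>2 / w \<alpha>)"
    using w_pos[of \<alpha>] by (simp add: field_simps)
next
  show "(\<lambda>\<alpha>. 2 * ((hnorm E (\<phi> \<alpha>))\<^sup>2 / w \<alpha>) + 2 * ((hnorm E (\<psi> \<alpha>))\<^sup>2 / w \<alpha>)) summable_on UNIV"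
    by (intro summable_on_add summable_on_cmult_right L2_summable assms)
qed (use L2D assms in auto)

lemma L2_inner_space: "inner_space L2"
proof
  fix \<phi> \<psi> assume m: "\<phi> \<in> hcarrier L2" "\<psi> \<in> hcarrier L2"
  have "hinner E (\<psi> \<alpha>) (\<phi> \<alpha>) = cnj (hinner E (\<phi> \<alpha>) (\<psi> \<alpha>))" for \<alpha>
    using m by (intro inner_commute L2D)
  thus "hinner L2 \<psi> \<phi> = cnj (hinner L2 \<phi> \<psi>)"
    by (simp add: L2_inner flip: infsum_cnj)
next
  fix \<phi> assume m: "\<phi> \<in> hcarrier L2" and 0: "hinner L2 \<phi> \<phi> = 0"
  have "(hnorm E (\<phi> \<alpha>))\<^sup>2 / w \<alpha> = 0" for \<alpha>
    by (rule nonneg_infsum_le_0D[where f = "\<lambda>\<alpha>. (hnorm E (\<phi> \<alpha>))\<^sup>2 / w \<alpha>" and A = UNIV])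
      (use 0 m L2_summable in \<open>auto simp: L2_inner_self\<close>)
  thus "\<phi> = 0"
    using norm_eq_0_iff[OF L2D[OF m]] by (simp add: fun_eq_iff)
next
  fix \<phi> assume m: "\<phi> \<in> hcarrier L2"
  show "0 \<le> Re (hinner L2 \<phi> \<phi>)"
    by (simp add: L2_inner_self[OF m] infsum_nonneg)
next
  show "0 \<in> hcarrier L2"
    by (simp add: weighted_l2_mem_iff)
next
  fix \<phi> \<psi> \<theta> assume m: "\<phi> \<in> hcarrier L2" "\<psi> \<in> hcarrier L2" "\<theta> \<in> hcarrier L2"
  show "hinner L2 (\<phi> + \<psi>) \<theta> = hinner L2 \<phi> \<theta> + hinner L2 \<psi> \<theta>"
    unfolding L2_inner infsum_add[OF L2_inner_summable[OF m(1,3)] L2_inner_summable[OF m(2,3)], symmetric]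
    using m by (simp add: inner_add_left L2D add_divide_distrib)
next
  fix c \<phi> \<psi> assume m: "\<phi> \<in> hcarrier L2" "\<psi> \<in> hcarrier L2"
  show "hinner L2 (c *\<^sub>C \<phi>) \<psi> = c * hinner L2 \<phi> \<psi>"
    unfolding L2_inner infsum_cmult_right'[symmetric]
    using m by (simp add: inner_scale_left L2D scaleC_fun_def)
qed (auto intro: L2_add_mem L2_scale_mem)

text \<open>The coordinatewise limit is the only candidate. Finite partial sums of the squared
  distance pass to the limit with one common bound, as in Fatou's lemma.\<close>

lemma L2_hilbert: "hilbert L2"
proof -
  interpret L2: inner_space L2 by (rule L2_inner_space)
  show ?thesis
  proof
    fix X :: "nat \<Rightarrow> 'i \<Rightarrow> 'e"
    assume X: "\<And>n. X n \<in> hcarrier L2"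
      and cauchy: "\<And>e. e > 0 \<Longrightarrow> \<exists>N. \<forall>m\<ge>N. \<forall>n\<ge>N. hnorm L2 (X m - X n) < e"
    have X_mem: "X n \<alpha> \<in> hcarrier E" for n \<alpha>
      using X by (rule L2D)
    have "\<exists>y\<in>hcarrier E. (\<lambda>n. hnorm E (X n \<alpha> - y)) \<longlonglongrightarrow> 0" for \<alpha>
    proof (rule complete)
      fix e :: real assume e: "e > 0"
      then obtain N where N: "\<And>m n. \<lbrakk>m \<ge> N; n \<ge> N\<rbrakk> \<Longrightarrow> hnorm L2 (X m - X n) < e / sqrt (w \<alpha>)"
        using cauchy[of "e / sqrt (w \<alpha>)"] w_pos[of \<alpha>] by auto
      have "hnorm E (X m \<alpha> - X n \<alpha>) < e" if "m \<ge> N" "n \<ge> N" for m n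
      proof -
        have d: "X m - X n \<in> hcarrier L2"
          using X by auto
        have "(hnorm E (X m \<alpha> - X n \<alpha>))\<^sup>2 \<le> (sqrt (w \<alpha>) * hnorm L2 (X m - X n))\<^sup>2"
          using L2_coeff_le[OF d, of \<alpha>] by (simp add: power_mult_distrib)
        hence "hnorm E (X m \<alpha> - X n \<alpha>) \<le> sqrt (w \<alpha>) * hnorm L2 (X m - X n)"
          by (rule power2_le_imp_le) (use d in simp)
        also have "\<dots> < e"
          using N[OF that] w_pos[of \<alpha>] by (simp add: field_simps)
        finally show ?thesis .
      qed
      thus "\<exists>N. \<forall>m\<ge>N. \<forall>n\<ge>N. hnorm E (X m \<alpha> - X n \<alpha>) < e"
        by blast
    qed (rule X_mem)
    then obtain y where y: "\<And>\<alpha>. y \<alpha> \<in> hcarrier E" "\<And>\<alpha>. (\<lambda>n. hnorm E (X n \<alpha> - y \<alpha>)) \<longlonglongrightarrow> 0"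
      by metis
    \<comment> \<open>Membership and closeness of the difference come out together; the limit itself
      then lies in the space, being a difference of two members.\<close>
    have near: "\<exists>N. \<forall>m\<ge>N. X m - y \<in> hcarrier L2 \<and> hnorm L2 (X m - y) \<le> e" if e: "e > 0" for e
    proof -
      obtain N where N: "\<And>m n. \<lbrakk>m \<ge> N; n \<ge> N\<rbrakk> \<Longrightarrow> hnorm L2 (X m - X n) < e"
        using cauchy[OF e] by blast
      have "X m - y \<in> hcarrier L2 \<and> hnorm L2 (X m - y) \<le> e" if m: "m \<ge> N" for m
      proof -
        have le: "(\<Sum>\<alpha>\<in>F. (hnorm E ((X m - y) \<alpha>))\<^sup>2 / w \<alpha>) \<le> e\<^sup>2" if F: "finite F" for F
        proof (rule Lim_bounded)
          have "(\<lambda>n. hnorm E (X m \<alpha> - X n \<alpha>)) \<longlonglongrightarrow> hnorm E (X m \<alpha> - y \<alpha>)" for \<alpha>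
          proof (rule LIM_zero_cancel, rule Lim_null_comparison)
            show "\<forall>\<^sub>F n in sequentially.
              norm (hnorm E (X m \<alpha> - X n \<alpha>) - hnorm E (X m \<alpha> - y \<alpha>)) \<le> hnorm E (X n \<alpha> - y \<alpha>)"
            proof (intro always_eventually allI)
              fix n
              have "hnorm E (X m \<alpha> - X n \<alpha>) \<le> hnorm E (X m \<alpha> - y \<alpha>) + hnorm E (y \<alpha> - X n \<alpha>)"
                "hnorm E (X m \<alpha> - y \<alpha>) \<le> hnorm E (X m \<alpha> - X n \<alpha>) + hnorm E (X n \<alpha> - y \<alpha>)"
                by (rule norm_diff_triangle; simp add: X_mem y(1))+
              moreover have "hnorm E (y \<alpha> - X n \<alpha>) = hnorm E (X n \<alpha> - y \<alpha>)"
                by (rule norm_minus_commute) (simp_all add: X_mem y(1))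
              ultimately show "norm (hnorm E (X m \<alpha> - X n \<alpha>) - hnorm E (X m \<alpha> - y \<alpha>)) \<le> hnorm E (X n \<alpha> - y \<alpha>)"
                by simp
            qed
          qed (rule y(2))
          thus "(\<lambda>n. \<Sum>\<alpha>\<in>F. (hnorm E ((X m - X n) \<alpha>))\<^sup>2 / w \<alpha>) \<longlonglongrightarrow> (\<Sum>\<alpha>\<in>F. (hnorm E ((X m - y) \<alpha>))\<^sup>2 / w \<alpha>)"
            by (auto intro!: tendsto_sum tendsto_divide tendsto_power)
          show "\<forall>n\<ge>N. (\<Sum>\<alpha>\<in>F. (hnorm E ((X m - X n) \<alpha>))\<^sup>2 / w \<alpha>) \<le> e\<^sup>2"
          proof (intro allI impI)
            fix n assume "n \<ge> N"
            have d: "X m - X n \<in> hcarrier L2"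
              using X by auto
            have "(\<Sum>\<alpha>\<in>F. (hnorm E ((X m - X n) \<alpha>))\<^sup>2 / w \<alpha>) \<le> (hnorm L2 (X m - X n))\<^sup>2"
              by (rule L2_finite_sum_le[OF d F])
            also have "\<dots> \<le> e\<^sup>2"
              using N[OF m \<open>n \<ge> N\<close>] d by (intro power_mono) auto
            finally show "(\<Sum>\<alpha>\<in>F. (hnorm E ((X m - X n) \<alpha>))\<^sup>2 / w \<alpha>) \<le> e\<^sup>2" .
          qed
        qed
        have mem: "X m - y \<in> hcarrier L2"
          unfolding weighted_l2_mem_iff
        proof (intro conjI allI nonneg_bdd_above_summable_on)
          show "bdd_above (sum (\<lambda>\<alpha>. (hnorm E ((X m - y) \<alpha>))\<^sup>2 / w \<alpha>) ` {F. F \<subseteq> UNIV \<and> finite F})"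
            using le by (intro bdd_aboveI[of _ "e\<^sup>2"]) auto
        qed (use X_mem y in auto)
        moreover have "hnorm L2 (X m - y) \<le> e"
          by (rule L2_norm_le[OF mem]) (use e le in auto)
        ultimately show ?thesis ..
      qed
      thus ?thesis by blast
    qed
    obtain m where "X m - y \<in> hcarrier L2"
      using near[of 1] by auto
    from L2.diff_mem[OF X this] have "X m - (X m - y) \<in> hcarrier L2" .
    moreover have "X m - (X m - y) = y"
      by (simp add: fun_eq_iff)
    ultimately have y_mem: "y \<in> hcarrier L2"
      by simp
    have "(\<lambda>n. hnorm L2 (X n - y)) \<longlonglongrightarrow> 0"
    proof (rule LIMSEQ_I)
      fix e :: real assume "e > 0"
      then obtain N where N: "\<And>m. m \<ge> N \<Longrightarrow> X m - y \<in> hcarrier L2 \<and> hnorm L2 (X m - y) \<le> e / 2"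
        using near[of "e / 2"] by auto
      have "norm (hnorm L2 (X n - y) - 0) < e" if "n \<ge> N" for n
        using N[OF that] \<open>e > 0\<close> by auto
      thus "\<exists>N. \<forall>n\<ge>N. norm (hnorm L2 (X n - y) - 0) < e"
        by blast
    qed
    with y_mem show "\<exists>y\<in>hcarrier L2. (\<lambda>n. hnorm L2 (X n - y)) \<longlonglongrightarrow> 0"
      by blast
  qed
qed

end

text \<open>Pulls completeness back along a linear isometric bijection U, with injectivity in the
  form of a trivial kernel. Meant for function spaces whose inner product is defined through
  coefficients.\<close>

lemma hilbert_transfer:
  assumes G: "hilbert G"
    and mem: "\<And>x. x \<in> hcarrier H \<Longrightarrow> U x \<in> hcarrier G"
    and surj: "\<And>y. y \<in> hcarrier G \<Longrightarrow> \<exists>x\<in>hcarrier H. U x = y"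
    and inj: "\<And>x. \<lbrakk>x \<in> hcarrier H; U x = 0\<rbrakk> \<Longrightarrow> x = 0"
    and zero: "0 \<in> hcarrier H"
    and add: "\<And>x y. \<lbrakk>x \<in> hcarrier H; y \<in> hcarrier H\<rbrakk> \<Longrightarrow> x + y \<in> hcarrier H \<and> U (x + y) = U x + U y"
    and scale: "\<And>c x. x \<in> hcarrier H \<Longrightarrow> c *\<^sub>C x \<in> hcarrier H \<and> U (c *\<^sub>C x) = c *\<^sub>C U x"
    and inner: "\<And>x y. \<lbrakk>x \<in> hcarrier H; y \<in> hcarrier H\<rbrakk> \<Longrightarrow> hinner H x y = hinner G (U x) (U y)"
  shows "hilbert H"
proof -
  interpret G: hilbert G by fact
  have norm: "hnorm H x = hnorm G (U x)" if "x \<in> hcarrier H" for x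
    using that by (simp add: hnorm_def inner)
  have diff: "x - y \<in> hcarrier H \<and> U (x - y) = U x - U y" if "x \<in> hcarrier H" "y \<in> hcarrier H" for x y
    using add[OF that(1), of "- y"] scale[OF that(2), of "-1"] by simp
  show ?thesis
  proof
    fix X :: "nat \<Rightarrow> 'b"
    assume X: "\<And>n. X n \<in> hcarrier H"
      and cauchy: "\<And>e. 0 < e \<Longrightarrow> \<exists>N. \<forall>m\<ge>N. \<forall>n\<ge>N. hnorm H (X m - X n) < e"
    have "hnorm H (X m - X n) = hnorm G (U (X m) - U (X n))" for m n
      using diff[OF X X, of m n] norm[of "X m - X n"] by simp
    hence "\<exists>y\<in>hcarrier G. (\<lambda>n. hnorm G (U (X n) - y)) \<longlonglongrightarrow> 0"
      using cauchy by (intro G.complete) (simp_all add: mem X)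
    then obtain x where x: "x \<in> hcarrier H" "(\<lambda>n. hnorm G (U (X n) - U x)) \<longlonglongrightarrow> 0"
      using surj by blast
    have "hnorm H (X n - x) = hnorm G (U (X n) - U x)" for n
      using diff[OF X x(1), of n] norm[of "X n - x"] by simp
    with x show "\<exists>x\<in>hcarrier H. (\<lambda>n. hnorm H (X n - x)) \<longlonglongrightarrow> 0"
      by (intro bexI[of _ x]) simp_all
  next
    fix x y assume "x \<in> hcarrier H" "y \<in> hcarrier H"
    thus "hinner H y x = cnj (hinner H x y)"
      unfolding inner[OF \<open>x \<in> hcarrier H\<close> \<open>y \<in> hcarrier H\<close>] inner[OF \<open>y \<in> hcarrier H\<close> \<open>x \<in> hcarrier H\<close>]
      by (intro G.inner_commute mem)
  qed (use zero in \<open>auto simp: inner mem add scale G.inner_add_left G.inner_scale_left G.inner_ge_0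
      intro!: inj dest!: G.inner_eq_0D[rotated]\<close>)
qed

section \<open>Multi-indices\<close>

definition unit_index :: "'d \<Rightarrow> 'd multiindex"
  where "unit_index i = (\<lambda>j. if j = i then 1 else 0)"

lemma unit_index_same [simp]: "unit_index i i = 1"
  by (simp add: unit_index_def)

lemma msize_zero [simp]: "msize (\<lambda>_. 0) = 0"
  by (simp add: msize_def)

lemma msize_eq_0_iff: "msize \<alpha> = 0 \<longleftrightarrow> \<alpha> = (\<lambda>_. 0)"
  by (auto simp: msize_def fun_eq_iff)

lemma msize_add [simp]: "msize (\<alpha> + \<beta>) = msize \<alpha> + msize \<beta>"
  by (simp add: msize_def sum.distrib)

lemma msize_unit [simp]: "msize (unit_index i :: 'd::finite multiindex) = 1"
  by (simp add: msize_def unit_index_def)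

lemma mgamma_pos [simp]: "mgamma \<alpha> > 0"
  by (auto simp: mgamma_def intro!: divide_pos_pos prod_pos)

lemma mgamma_zero [simp]: "mgamma (\<lambda>_. 0) = 1"
  by (simp add: mgamma_def)

lemma finite_msize_eq [simp]: "finite {\<alpha> :: 'd::finite multiindex. msize \<alpha> = n}"
proof (rule finite_subset)
  show "finite (PiE (UNIV :: 'd set) (\<lambda>_. {..n}))"
    by (intro finite_PiE) auto
  show "{\<alpha> :: 'd multiindex. msize \<alpha> = n} \<subseteq> PiE UNIV (\<lambda>_. {..n})"
    by (auto simp: msize_def PiE_UNIV_domain intro!: member_le_sum[of _ UNIV])
qed

lemma finite_msize_le [simp]: "finite {\<alpha> :: 'd::finite multiindex. msize \<alpha> \<le> n}"
proof -
  have "{\<alpha> :: 'd multiindex. msize \<alpha> \<le> n} = (\<Union>m\<le>n. {\<alpha>. msize \<alpha> = m})"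
    by auto
  thus ?thesis by simp
qed

lemma sum_msize_le:
  "(\<Sum>\<alpha> | msize \<alpha> \<le> N. f \<alpha>) = (\<Sum>n\<le>N. \<Sum>\<alpha> | msize (\<alpha> :: 'd::finite multiindex) = n. f \<alpha>)"
proof -
  have "{\<alpha> :: 'd multiindex. msize \<alpha> \<le> N} = (\<Union>m\<le>N. {\<alpha>. msize \<alpha> = m})"
    by auto
  thus ?thesis
    by (simp add: sum.UNION_disjoint disjoint_iff)
qed

text \<open>The sets of all multi-indices up to a given degree are cofinal among the finite sets, so
  an unordered sum may be evaluated degree by degree. This links Taylor sums with series graded by
  n.\<close>

lemma filterlim_msize_le:
  "filterlim (\<lambda>N. {\<alpha> :: 'd::finite multiindex. msize \<alpha> \<le> N}) (finite_subsets_at_top UNIV) sequentially"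
  unfolding filterlim_iff eventually_finite_subsets_at_top
proof (intro allI impI, elim exE conjE)
  fix P :: "'d multiindex set \<Rightarrow> bool" and F
  assume F: "finite F" and P: "\<forall>Y. finite Y \<and> F \<subseteq> Y \<and> Y \<subseteq> UNIV \<longrightarrow> P Y"
  obtain N where N: "\<forall>n\<in>msize ` F. n \<le> N"
    using F finite_nat_set_iff_bounded_le[of "msize ` F"] by auto
  show "\<forall>\<^sub>F N in sequentially. P {\<alpha>. msize \<alpha> \<le> N}"
    unfolding eventually_sequentially
  proof (intro exI[of _ N] allI impI)
    fix n assume "n \<ge> N"
    hence "F \<subseteq> {\<alpha>. msize \<alpha> \<le> n}"
      using N by fastforce
    thus "P {\<alpha>. msize \<alpha> \<le> n}"
      using P by simp
  qed
qed

text \<open>Passing from \<alpha> to \<alpha> + e_i multiplies the numerator by |\<alpha>| + 1 and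
  the denominator by \<alpha>_i + 1.\<close>

lemma mgamma_add_unit:
  "mgamma (\<alpha> + unit_index i) * real (Suc (\<alpha> i)) = mgamma \<alpha> * real (Suc (msize \<alpha>))"
proof -
  have "(\<Prod>j\<in>UNIV. fact ((\<alpha> + unit_index i) j)) = fact (Suc (\<alpha> i)) * (\<Prod>j\<in>UNIV - {i}. fact (\<alpha> j) :: real)"
    by (subst prod.remove[of _ i]) (auto simp: unit_index_def intro!: prod.cong)
  moreover have "(\<Prod>j\<in>UNIV. fact (\<alpha> j)) = fact (\<alpha> i) * (\<Prod>j\<in>UNIV - {i}. fact (\<alpha> j) :: real)"
    by (subst prod.remove[of _ i]) auto
  moreover have "(s * f) / ((k * g) * p) * k = (f / (g * p)) * s" if "k \<noteq> 0" for s f k g p :: real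
    using that by simp
  from this[of "real (Suc (\<alpha> i))" "real (Suc (msize \<alpha>))" "fact (msize \<alpha>)" "fact (\<alpha> i)"
      "\<Prod>j\<in>UNIV - {i}. fact (\<alpha> j)"]
  have "fact (Suc (msize \<alpha>)) / (fact (Suc (\<alpha> i)) * (\<Prod>j\<in>UNIV - {i}. fact (\<alpha> j))) * real (Suc (\<alpha> i)) =
      fact (msize \<alpha>) / (fact (\<alpha> i) * (\<Prod>j\<in>UNIV - {i}. fact (\<alpha> j))) * real (Suc (msize \<alpha>))"
    by (simp only: fact_Suc)
  ultimately show ?thesis
    by (simp only: mgamma_def msize_add msize_unit Suc_eq_plus1)
qed

text \<open>Since \<open>\<gamma>\<^sub>\<beta> = \<Sum>\<^bsub>i\<^esub> \<gamma>\<^bsub>\<beta> - e\<^sub>i\<^esub>\<close>.\<close>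

lemma sum_mgamma_Suc:
  fixes f :: "'d::finite multiindex \<Rightarrow> 'a::complex_vector"
  shows "(\<Sum>\<beta> | msize \<beta> = Suc n. complex_of_real (mgamma \<beta>) *\<^sub>C f \<beta>) =
    (\<Sum>i\<in>UNIV. \<Sum>\<alpha> | msize \<alpha> = n. complex_of_real (mgamma \<alpha>) *\<^sub>C f (\<alpha> + unit_index i))"
proof -
  \<comment> \<open>After the substitution \<beta> = \<alpha> + e_i the weight \<gamma>_\<alpha> is
    the share \<beta>_i / (n + 1) of \<gamma>_\<beta>, which vanishes at the indices \<beta> not
    reached. Over all i the shares add up to 1.\<close>
  have step: "(\<Sum>\<alpha> | msize \<alpha> = n. complex_of_real (mgamma \<alpha>) *\<^sub>C f (\<alpha> + unit_index i)) =
      (\<Sum>\<beta> | msize \<beta> = Suc n. complex_of_real (mgamma \<beta> * real (\<beta> i) / real (Suc n)) *\<^sub>C f \<beta>)" for i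
  proof -
    have "(\<Sum>\<alpha> | msize \<alpha> = n. complex_of_real (mgamma \<alpha>) *\<^sub>C f (\<alpha> + unit_index i)) =
      (\<Sum>\<beta> | msize \<beta> = Suc n \<and> \<beta> i > 0. complex_of_real (mgamma \<beta> * real (\<beta> i) / real (Suc n)) *\<^sub>C f \<beta>)"
    proof (rule sum.reindex_bij_witness[where j = "\<lambda>\<alpha>. \<alpha> + unit_index i" and i = "\<lambda>\<beta>. \<beta> - unit_index i"])
      fix \<beta> assume b: "\<beta> \<in> {\<beta>. msize \<beta> = Suc n \<and> \<beta> i > 0}"
      thus eq: "\<beta> - unit_index i + unit_index i = \<beta>"
        by (auto simp: fun_eq_iff unit_index_def)
      have "msize (\<beta> - unit_index i + unit_index i) = Suc n"
        using b by (simp only: eq) simp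
      thus "\<beta> - unit_index i \<in> {\<alpha>. msize \<alpha> = n}"
        by simp
    next
      fix \<alpha> :: "'d multiindex" assume a: "\<alpha> \<in> {\<alpha>. msize \<alpha> = n}"
      show "\<alpha> + unit_index i - unit_index i = \<alpha>"
        by (auto simp: fun_eq_iff)
      show "\<alpha> + unit_index i \<in> {\<beta>. msize \<beta> = Suc n \<and> \<beta> i > 0}"
        using a by auto
      have "mgamma \<alpha> = mgamma (\<alpha> + unit_index i) * real ((\<alpha> + unit_index i) i) / real (Suc n)"
        using mgamma_add_unit[of \<alpha> i] a by (simp add: field_simps)
      thus "complex_of_real (mgamma (\<alpha> + unit_index i) * real ((\<alpha> + unit_index i) i) / real (Suc n)) *\<^sub>C
          f (\<alpha> + unit_index i) = complex_of_real (mgamma \<alpha>) *\<^sub>C f (\<alpha> + unit_index i)"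
        by simp
    qed
    also have "\<dots> = (\<Sum>\<beta> | msize \<beta> = Suc n. complex_of_real (mgamma \<beta> * real (\<beta> i) / real (Suc n)) *\<^sub>C f \<beta>)"
      by (rule sum.mono_neutral_left) auto
    finally show ?thesis .
  qed
  have "(\<Sum>i\<in>UNIV. \<Sum>\<alpha> | msize \<alpha> = n. complex_of_real (mgamma \<alpha>) *\<^sub>C f (\<alpha> + unit_index i)) =
    (\<Sum>\<beta> | msize \<beta> = Suc n. \<Sum>i\<in>UNIV. complex_of_real (mgamma \<beta> * real (\<beta> i) / real (Suc n)) *\<^sub>C f \<beta>)"
    unfolding step by (rule sum.swap)
  also have "\<dots> = (\<Sum>\<beta> | msize \<beta> = Suc n. complex_of_real (mgamma \<beta>) *\<^sub>C f \<beta>)"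
  proof (rule sum.cong)
    fix \<beta> :: "'d multiindex" assume "\<beta> \<in> {\<beta>. msize \<beta> = Suc n}"
    hence "(\<Sum>i\<in>UNIV. real (\<beta> i)) = real (Suc n)"
      by (simp add: msize_def flip: of_nat_sum)
    hence "(\<Sum>i\<in>UNIV. mgamma \<beta> * real (\<beta> i) / real (Suc n)) = mgamma \<beta>"
      by (simp flip: sum_divide_distrib sum_distrib_left)
    thus "(\<Sum>i\<in>UNIV. complex_of_real (mgamma \<beta> * real (\<beta> i) / real (Suc n)) *\<^sub>C f \<beta>) =
        complex_of_real (mgamma \<beta>) *\<^sub>C f \<beta>"
      by (simp only: scaleC_sum_left[symmetric] of_real_sum[symmetric])
  qed simp
  finally show ?thesis ..
qed

lemma sum_mgamma_Suc_real:
  fixes f :: "'d::finite multiindex \<Rightarrow> real"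
  shows "(\<Sum>\<beta> | msize \<beta> = Suc n. mgamma \<beta> * f \<beta>) =
    (\<Sum>i\<in>UNIV. \<Sum>\<alpha> | msize \<alpha> = n. mgamma \<alpha> * f (\<alpha> + unit_index i))"
  using sum_mgamma_Suc[where n = n and f = "\<lambda>\<alpha>. complex_of_real (f \<alpha>)"]
  by (simp add: scaleC_complex_def flip: of_real_mult of_real_sum del: of_real_mult of_real_sum)

text \<open>By the Pascal rule for \<gamma>, raising the degree by one multiplies the left side by
  the sum of the x_i.\<close>

lemma multinomial:
  fixes x :: "'d::finite \<Rightarrow> real"
  shows "(\<Sum>\<alpha> | msize \<alpha> = n. mgamma \<alpha> * (\<Prod>i\<in>UNIV. x i ^ \<alpha> i)) = (\<Sum>i\<in>UNIV. x i) ^ n"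
proof (induction n)
  case 0
  have "{\<alpha> :: 'd multiindex. msize \<alpha> = 0} = {\<lambda>_. 0}"
    by (auto simp: msize_eq_0_iff)
  thus ?case by simp
next
  case (Suc n)
  have p: "(\<Prod>j\<in>UNIV. x j ^ (\<alpha> + unit_index i) j) = x i * (\<Prod>j\<in>UNIV. x j ^ \<alpha> j)" for \<alpha> i
  proof -
    have "(\<Prod>j\<in>UNIV. x j ^ unit_index i j) = (\<Prod>j\<in>UNIV. if j = i then x i else 1)"
      by (intro prod.cong) (auto simp: unit_index_def)
    thus ?thesis
      by (simp add: power_add prod.distrib)
  qed
  show ?case
    unfolding sum_mgamma_Suc_real p
    by (subst sum.swap, simp add: Suc.IH[symmetric] sum_distrib_right sum_distrib_left mult.left_commute)
qed

lemma zpow_zero_index [simp]: "zpow z (\<lambda>_. 0) = 1"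
  by (simp add: zpow_def)

lemma zpow_add: "zpow z (\<alpha> + \<beta>) = zpow z \<alpha> * zpow z \<beta>"
  by (simp add: zpow_def power_add prod.distrib)

lemma zpow_unit [simp]: "zpow z (unit_index i) = z $ i"
proof -
  have "zpow z (unit_index i) = (\<Prod>j\<in>UNIV. if j = i then z $ i else 1)"
    unfolding zpow_def by (intro prod.cong) (auto simp: unit_index_def)
  thus ?thesis by simp
qed

lemma zpow_0_left: "\<alpha> \<noteq> (\<lambda>_. 0) \<Longrightarrow> zpow 0 \<alpha> = 0"
  by (auto simp: zpow_def fun_eq_iff power_0_left)

lemma norm_vec_sq: "(norm (z :: complex ^ 'd::finite))\<^sup>2 = (\<Sum>i\<in>UNIV. (cmod (z $ i))\<^sup>2)"
  by (simp add: norm_vec_def L2_set_def sum_nonneg)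

text \<open>The multinomial theorem at the numbers |z_i|^2. Up to the factor a_n this is the degree
  n part of the kernel on the diagonal.\<close>

lemma sum_mgamma_zpow:
  "(\<Sum>\<alpha> | msize \<alpha> = n. mgamma \<alpha> * (cmod (zpow z \<alpha>))\<^sup>2) = norm z ^ (2 * n)"
proof -
  have "(cmod (zpow z \<alpha>))\<^sup>2 = (\<Prod>i\<in>UNIV. ((cmod (z $ i))\<^sup>2) ^ \<alpha> i)" for \<alpha>
    by (simp add: zpow_def prod_norm[symmetric] norm_power prod_power_distrib power_mult[symmetric] mult.commute)
  thus ?thesis
    by (simp add: multinomial power_mult flip: norm_vec_sq)
qed

text \<open>For the coefficients a of k the sum is k(|z|^2), grouped by degree; its finiteness is
  what makes evaluation at z bounded on H_K(E).\<close>

lemma summable_weight_zpow: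
  fixes z :: "complex ^ 'd::finite"
  assumes a: "\<And>n. a n \<ge> (0::real)" and s: "summable (\<lambda>n. a n * (norm z ^ 2) ^ n)"
  shows "(\<lambda>\<alpha>. a (msize \<alpha>) * mgamma \<alpha> * (cmod (zpow z \<alpha>))\<^sup>2) summable_on UNIV"
proof (rule nonneg_bdd_above_summable_on)
  have eq: "(\<Sum>\<alpha> | msize \<alpha> \<le> N. a (msize \<alpha>) * mgamma \<alpha> * (cmod (zpow z \<alpha>))\<^sup>2) = (\<Sum>n\<le>N. a n * (norm z ^ 2) ^ n)" for N
  proof -
    have "(\<Sum>\<alpha> | msize \<alpha> = n. a (msize \<alpha>) * mgamma \<alpha> * (cmod (zpow z \<alpha>))\<^sup>2) = a n * (norm z ^ 2) ^ n" for n
    proof -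
      have "(\<Sum>\<alpha> | msize \<alpha> = n. a (msize \<alpha>) * mgamma \<alpha> * (cmod (zpow z \<alpha>))\<^sup>2) =
          (\<Sum>\<alpha> | msize \<alpha> = n. a n * (mgamma \<alpha> * (cmod (zpow z \<alpha>))\<^sup>2))"
        by (intro sum.cong) auto
      thus ?thesis
        by (simp add: sum_mgamma_zpow power_mult flip: sum_distrib_left)
    qed
    thus ?thesis
      by (simp add: sum_msize_le)
  qed
  show "bdd_above (sum (\<lambda>\<alpha>. a (msize \<alpha>) * mgamma \<alpha> * (cmod (zpow z \<alpha>))\<^sup>2) ` {F. F \<subseteq> UNIV \<and> finite F})"
  proof (rule bdd_aboveI2)
    fix F :: "'d multiindex set" assume "F \<in> {F. F \<subseteq> UNIV \<and> finite F}"
    then obtain N where N: "F \<subseteq> {\<alpha>. msize \<alpha> \<le> N}"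
      using finite_nat_set_iff_bounded_le[of "msize ` F"] by auto
    have "(\<Sum>\<alpha>\<in>F. a (msize \<alpha>) * mgamma \<alpha> * (cmod (zpow z \<alpha>))\<^sup>2) \<le>
        (\<Sum>\<alpha> | msize \<alpha> \<le> N. a (msize \<alpha>) * mgamma \<alpha> * (cmod (zpow z \<alpha>))\<^sup>2)"
      using N a by (intro sum_mono2) (auto intro!: mult_nonneg_nonneg less_imp_le[OF mgamma_pos])
    also have "\<dots> \<le> (\<Sum>n. a n * (norm z ^ 2) ^ n)"
      unfolding eq by (intro sum_le_suminf s) (auto simp: a)
    finally show "(\<Sum>\<alpha>\<in>F. a (msize \<alpha>) * mgamma \<alpha> * (cmod (zpow z \<alpha>))\<^sup>2) \<le> (\<Sum>n. a n * (norm z ^ 2) ^ n)" .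
  qed
qed (use a in \<open>auto intro!: mult_nonneg_nonneg less_imp_le[OF mgamma_pos]\<close>)

section \<open>Uniqueness of Taylor coefficients\<close>

text \<open>Once the lower coefficients are known to vanish, division by w^n leaves a series whose
  limit at 0 is b n.\<close>

lemma power_series_zero:
  fixes b :: "nat \<Rightarrow> complex"
  assumes \<delta>: "\<delta> > 0" and s: "\<And>w. \<lbrakk>w \<noteq> 0; cmod w < \<delta>\<rbrakk> \<Longrightarrow> (\<lambda>n. b n * w ^ n) sums 0"
  shows "b n = 0"
proof (induction n rule: less_induct)
  case (less n)
  have "((\<lambda>_. 0) \<longlongrightarrow> b (0 + n)) (at (0::complex))"
  proof (rule powser_limit_0_strong[OF \<delta>, where a = "\<lambda>k. b (k + n)"])
    fix w :: complex assume w: "w \<noteq> 0" "norm w < \<delta>"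
    have "(\<lambda>k. b (k + n) * w ^ (k + n)) sums (0 - (\<Sum>k<n. b k * w ^ k))"
      by (rule sums_split_initial_segment[OF s[OF w]])
    hence "(\<lambda>k. b (k + n) * w ^ (k + n)) sums 0"
      using less by simp
    hence "(\<lambda>k. b (k + n) * w ^ (k + n) / w ^ n) sums (0 / w ^ n)"
      by (rule sums_divide)
    thus "(\<lambda>k. b (k + n) * w ^ k) sums 0"
      using w by (simp add: power_add)
  qed
  thus ?case
    using tendsto_unique[of "at (0::complex)" "\<lambda>_. 0" "b n" 0] by simp
qed

text \<open>The coordinates are eliminated one after the other, each by uniqueness of the coefficients of
  a power series in one variable.\<close>

lemma multi_power_series_zero:
  fixes \<phi> :: "'d::finite multiindex \<Rightarrow> complex"
  assumes s: "\<And>z. z \<in> ball 0 1 \<Longrightarrow> ((\<lambda>\<alpha>. zpow z \<alpha> * \<phi> \<alpha>) has_sum 0) UNIV"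
  shows "\<phi> \<beta> = 0"
proof -
  have *: "((\<lambda>\<alpha>. (\<Prod>i\<in>-I. (z $ i) ^ \<alpha> i) * \<phi> \<alpha>) has_sum 0) {\<alpha>. \<forall>i\<in>I. \<alpha> i = \<beta> i}"
    if "finite I" "z \<in> ball 0 1" for I z
    using that
  proof (induction I arbitrary: z rule: finite_induct)
    case empty
    thus ?case
      using s[of z] by (simp add: zpow_def)
  next
    case (insert j I)
    let ?A = "{\<alpha>. \<forall>i\<in>I. \<alpha> i = \<beta> i}"
    let ?B = "\<lambda>m. {\<alpha>\<in>?A. \<alpha> j = m}"
    let ?g = "\<lambda>\<alpha>. (\<Prod>i\<in>-insert j I. (z $ i) ^ \<alpha> i) * \<phi> \<alpha>"
    define \<delta> where "\<delta> = 1 - norm z"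
    have \<delta>: "\<delta> > 0"
      using insert.prems by (simp add: \<delta>_def)
    \<comment> \<open>The j-th coordinate of z is replaced by a free variable w; the bound |w| < 1 -
      |z| keeps the new point in the ball.\<close>
    have series: "((\<lambda>\<alpha>. w ^ \<alpha> j * ?g \<alpha>) has_sum 0) ?A" if w: "cmod w < \<delta>" for w
    proof -
      define z' where "z' = (\<chi> i. if i = j then w else z $ i)"
      have "norm z' \<le> norm (\<chi> i. if i = j then 0 else z $ i) + norm (axis j w :: complex ^ 'd)"
      proof -
        have "z' = (\<chi> i. if i = j then 0 else z $ i) + axis j w"
          by (auto simp: z'_def vec_eq_iff axis_def)
        thus ?thesis
          by (simp add: norm_triangle_ineq)
      qed
      also have "norm (axis j w :: complex ^ 'd) \<le> (\<Sum>i\<in>UNIV. norm ((axis j w :: complex ^ 'd) $ i))"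
        unfolding norm_vec_def by (rule L2_set_le_sum) simp
      also have "\<dots> = (\<Sum>i\<in>UNIV. if i = j then cmod w else 0)"
        by (intro sum.cong) (auto simp: axis_def)
      also have "norm (\<chi> i. if i = j then 0 else z $ i) \<le> norm z"
        unfolding norm_vec_def by (rule L2_set_mono) auto
      finally have "z' \<in> ball 0 1"
        using w by (simp add: \<delta>_def)
      from insert.IH[OF this]
      have "((\<lambda>\<alpha>. (\<Prod>i\<in>-I. (z' $ i) ^ \<alpha> i) * \<phi> \<alpha>) has_sum 0) ?A" .
      moreover have "(\<Prod>i\<in>-I. (z' $ i) ^ \<alpha> i) = w ^ \<alpha> j * (\<Prod>i\<in>-insert j I. (z $ i) ^ \<alpha> i)" for \<alpha>
      proof -
        have "- I - {j} = - insert j I"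
          by auto
        moreover have "(\<Prod>i\<in>-I. (z' $ i) ^ \<alpha> i) = (z' $ j) ^ \<alpha> j * (\<Prod>i\<in>-I - {j}. (z' $ i) ^ \<alpha> i)"
          using insert.hyps by (intro prod.remove) auto
        ultimately show ?thesis
          by (auto simp: z'_def intro!: prod.cong)
      qed
      ultimately show ?thesis
        by (simp add: mult.assoc)
    qed
    define S where "S m = infsum ?g (?B m)" for m
    have gB: "(?g has_sum S m) (?B m)" for m
    proof -
      \<comment> \<open>Any admissible nonzero value works: it only serves to cancel the constant
        factor w^m on the slice.\<close>
      define w where "w = complex_of_real (\<delta> / 2)"
      have w: "w \<noteq> 0" "cmod w < \<delta>"
        using \<delta> by (auto simp: w_def)
      have "(\<lambda>\<alpha>. w ^ \<alpha> j * ?g \<alpha>) summable_on ?B m"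
        by (rule summable_on_subset_banach[OF has_sum_imp_summable[OF series[OF w(2)]]]) auto
      hence "(\<lambda>\<alpha>. w ^ m * ?g \<alpha>) summable_on ?B m"
        by (rule summable_on_cong[THEN iffD1, rotated]) auto
      hence "?g summable_on ?B m"
        using summable_on_cmult_right'[of "w ^ m" ?g "?B m"] w by simp
      thus ?thesis
        by (simp add: S_def)
    qed
    have "S m = 0" for m
    proof (rule power_series_zero[OF \<delta>])
      fix w assume "w \<noteq> 0" and w: "cmod w < \<delta>"
      have "((\<lambda>(m, \<alpha>). w ^ m * ?g \<alpha>) has_sum 0) (Sigma UNIV ?B)"
        using series[OF w]
        by (subst has_sum_reindex_bij_witness[where j = snd and i = "\<lambda>\<alpha>. (\<alpha> j, \<alpha>)" and T = ?A
              and h = "\<lambda>\<alpha>. w ^ \<alpha> j * ?g \<alpha>" and s' = 0]) auto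
      hence "((\<lambda>m. w ^ m * S m) has_sum 0) UNIV"
        by (rule has_sum_SigmaD) (use gB in \<open>auto intro: has_sum_cmult_right\<close>)
      thus "(\<lambda>m. S m * w ^ m) sums 0"
        by (simp add: has_sum_imp_sums mult.commute)
    qed
    with gB[of "\<beta> j"] show ?case
      by (simp add: conj_commute Collect_conj_eq[symmetric])
  qed
  \<comment> \<open>With all coordinates eliminated, the sum runs over \<beta> alone.\<close>
  have "{\<alpha>. \<forall>i\<in>UNIV. \<alpha> i = \<beta> i} = {\<beta>}"
    by auto
  with *[of UNIV 0] have "(\<phi> has_sum 0) {\<beta>}"
    by simp
  thus ?thesis
    by (metis finite.emptyI finite_insert has_sum_finite has_sum_unique sum.empty sum.insert empty_iff add.right_neutral)
qed

section \<open>The space \<open>H_K(E)\<close> in terms of coefficients\<close>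

lemma (in inner_space) htendsto_add:
  assumes "htendsto H X x F" "htendsto H Y y F" "\<And>n. X n \<in> hcarrier H" "\<And>n. Y n \<in> hcarrier H"
  shows "htendsto H (\<lambda>n. X n + Y n) (x + y) F"
proof -
  have m: "x \<in> hcarrier H" "y \<in> hcarrier H"
    and l: "((\<lambda>n. hnorm H (X n - x) + hnorm H (Y n - y)) \<longlongrightarrow> 0) F"
    using assms(1,2) tendsto_add[of "\<lambda>n. hnorm H (X n - x)" 0 F "\<lambda>n. hnorm H (Y n - y)" 0]
    by (auto simp: htendsto_def)
  have "((\<lambda>n. hnorm H (X n + Y n - (x + y))) \<longlongrightarrow> 0) F"
  proof (rule Lim_null_comparison[OF _ l], intro always_eventually allI)
    fix n
    have eq: "X n + Y n - (x + y) = (X n - x) + (Y n - y)" by simp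
    have d: "X n - x \<in> hcarrier H" "Y n - y \<in> hcarrier H"
      using m assms(3,4) by auto
    show "norm (hnorm H (X n + Y n - (x + y))) \<le> hnorm H (X n - x) + hnorm H (Y n - y)"
      using norm_triangle[OF d] norm_ge_0[OF add_mem[OF d]] by (simp only: eq real_norm_def abs_of_nonneg)
  qed
  thus ?thesis
    using m by (auto simp: htendsto_def)
qed

lemma (in inner_space) htendsto_scale:
  assumes "htendsto H X x F" "\<And>n. X n \<in> hcarrier H"
  shows "htendsto H (\<lambda>n. c *\<^sub>C X n) (c *\<^sub>C x) F"
proof -
  have m: "x \<in> hcarrier H" and l: "((\<lambda>n. hnorm H (X n - x)) \<longlongrightarrow> 0) F"
    using assms(1) by (auto simp: htendsto_def)
  have "hnorm H (c *\<^sub>C X n - c *\<^sub>C x) = cmod c * hnorm H (X n - x)" for n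
    using m assms(2) by (simp add: diff_mem norm_scale flip: scaleC_diff_right)
  thus ?thesis
    using m tendsto_mult_right_zero[OF l, of "cmod c"] by (auto simp: htendsto_def)
qed

text \<open>The type of the weight \<open>w\<close> fixes the number of variables.\<close>

locale HK_space = hilbert E for E :: "'e::complex_vector hilbert" +
  fixes a :: "nat \<Rightarrow> real" and w :: "'d::finite multiindex \<Rightarrow> real"
  assumes a_pos: "\<And>n. 0 < a n" and a_0: "a 0 = 1"
    and a_summable: "\<And>t. \<lbrakk>0 \<le> t; t < 1\<rbrakk> \<Longrightarrow> summable (\<lambda>n. a n * t ^ n)"
    and a_decrease: "\<exists>M. \<forall>n. a n \<le> M * a (Suc n)"
    and a_increase: "\<exists>M. \<forall>n. a (Suc n) \<le> M * a n"
    and w_eq: "w = (\<lambda>\<alpha>. a (msize \<alpha>) * mgamma \<alpha>)"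

sublocale HK_space \<subseteq> weighted E w
  by unfold_locales (simp add: w_eq a_pos)

context HK_space
begin

abbreviation K :: "(complex ^ 'd \<Rightarrow> 'e) hilbert"
  where "K \<equiv> HK a E"

lemma a_simps [simp]: "a n \<noteq> 0" "0 \<le> a n"
  using a_pos[of n] by auto

lemma w_zero [simp]: "w (\<lambda>_. 0) = 1"
  by (simp add: w_eq a_0)

lemma taylor_mem: "taylor_coeffs E f \<phi> \<Longrightarrow> \<phi> \<alpha> \<in> hcarrier E"
  by (simp add: taylor_coeffs_def)

lemma taylor_sum_mem: "taylor_coeffs E f \<phi> \<Longrightarrow> (\<Sum>\<alpha>\<in>A. zpow z \<alpha> *\<^sub>C \<phi> \<alpha>) \<in> hcarrier E"
  using taylor_mem by (intro sum_mem scale_mem)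

lemma taylor_eval_mem: "\<lbrakk>taylor_coeffs E f \<phi>; z \<in> ball 0 1\<rbrakk> \<Longrightarrow> f z \<in> hcarrier E"
  unfolding taylor_coeffs_def htendsto_def by blast

text \<open>Pairing with a fixed h turns the vector-valued expansion into a scalar unordered sum,
  where the \<open>has_sum\<close> calculus and the uniqueness of power series apply.\<close>

lemma taylor_weak:
  assumes f: "taylor_coeffs E f \<phi>" and z: "z \<in> ball 0 1" and h: "h \<in> hcarrier E"
  shows "((\<lambda>\<alpha>. zpow z \<alpha> * hinner E (\<phi> \<alpha>) h) has_sum hinner E (f z) h) UNIV"
proof -
  have "htendsto E (\<lambda>A. \<Sum>\<alpha>\<in>A. zpow z \<alpha> *\<^sub>C \<phi> \<alpha>) (f z) (finite_subsets_at_top UNIV)"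
    using f z by (simp add: taylor_coeffs_def)
  hence "((\<lambda>A. hinner E (\<Sum>\<alpha>\<in>A. zpow z \<alpha> *\<^sub>C \<phi> \<alpha>) h) \<longlongrightarrow> hinner E (f z) h) (finite_subsets_at_top UNIV)"
    by (rule tendsto_inner_left) (use taylor_sum_mem[OF f] h in auto)
  moreover have "hinner E (\<Sum>\<alpha>\<in>A. zpow z \<alpha> *\<^sub>C \<phi> \<alpha>) h = (\<Sum>\<alpha>\<in>A. zpow z \<alpha> * hinner E (\<phi> \<alpha>) h)" for A
    using taylor_mem[OF f] h by (simp add: inner_sum_left inner_scale_left scale_mem)
  ultimately show ?thesis
    by (simp add: has_sum_def)
qed

lemma taylor_unique:
  fixes f g :: "complex ^ 'd \<Rightarrow> 'e"
  assumes f: "taylor_coeffs E f \<phi>" and g: "taylor_coeffs E g \<psi>" and eq: "\<And>z. z \<in> ball 0 1 \<Longrightarrow> f z = g z"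
  shows "\<phi> = \<psi>"
proof
  fix \<beta>
  show "\<phi> \<beta> = \<psi> \<beta>"
  proof (rule eqI_inner)
    fix h assume h: "h \<in> hcarrier E"
    have "hinner E (\<phi> \<beta>) h - hinner E (\<psi> \<beta>) h = 0"
    proof (rule multi_power_series_zero[where \<phi> = "\<lambda>\<alpha>. hinner E (\<phi> \<alpha>) h - hinner E (\<psi> \<alpha>) h"])
      fix z :: "complex ^ 'd" assume z: "z \<in> ball 0 1"
      have "((\<lambda>\<alpha>. zpow z \<alpha> * hinner E (\<phi> \<alpha>) h + - (zpow z \<alpha> * hinner E (\<psi> \<alpha>) h)) has_sum
          hinner E (f z) h + - hinner E (g z) h) UNIV"
        by (intro has_sum_add has_sum_uminusI taylor_weak f g z h)
      thus "((\<lambda>\<alpha>. zpow z \<alpha> * (hinner E (\<phi> \<alpha>) h - hinner E (\<psi> \<alpha>) h)) has_sum 0) UNIV"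
        using eq[OF z] by (simp add: right_diff_distrib)
    qed
    thus "hinner E h (\<phi> \<beta>) = hinner E h (\<psi> \<beta>)"
      using inner_commute[OF taylor_mem[OF f, of \<beta>] h] inner_commute[OF taylor_mem[OF g, of \<beta>] h] by simp
  qed (use taylor_mem f g in blast)+
qed

lemma coeff_of_eqI:
  fixes f :: "complex ^ 'd \<Rightarrow> 'e"
  shows "taylor_coeffs E f \<phi> \<Longrightarrow> coeff_of E f = \<phi>"
  unfolding coeff_of_def by (rule the_equality) (auto intro: taylor_unique)

text \<open>Uniqueness of the expansion lets \<open>coeff_of\<close> replace the existential over
  coefficient families; membership becomes a statement about these coefficients.\<close>

lemma K_mem_iff:
  "f \<in> hcarrier K \<longleftrightarrow> (\<forall>z. z \<notin> ball 0 1 \<longrightarrow> f z = 0) \<and> taylor_coeffs E f (coeff_of E f) \<and> coeff_of E f \<in> hcarrier L2"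
proof -
  have *: "(\<lambda>\<alpha>. (hnorm E (\<phi> \<alpha>))\<^sup>2 / (a (msize \<alpha>) * mgamma \<alpha>)) summable_on UNIV \<longleftrightarrow> \<phi> \<in> hcarrier L2"
    if "taylor_coeffs E f \<phi>" for \<phi>
    using taylor_mem[OF that] by (simp add: weighted_l2_mem_iff w_eq)
  have "f \<in> hcarrier K \<longleftrightarrow>
      (\<forall>z. z \<notin> ball 0 1 \<longrightarrow> f z = 0) \<and> (\<exists>\<phi>. taylor_coeffs E f \<phi> \<and> \<phi> \<in> hcarrier L2)"
    using * by (auto simp: HK_def)
  thus ?thesis
    using coeff_of_eqI by metis
qed

lemma K_taylor: "f \<in> hcarrier K \<Longrightarrow> taylor_coeffs E f (coeff_of E f)"
  and K_coeff: "f \<in> hcarrier K \<Longrightarrow> coeff_of E f \<in> hcarrier L2"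
  and K_outside: "\<lbrakk>f \<in> hcarrier K; z \<notin> ball 0 1\<rbrakk> \<Longrightarrow> f z = 0"
  by (simp_all add: K_mem_iff)

lemma K_coeff_mem: "f \<in> hcarrier K \<Longrightarrow> coeff_of E f \<alpha> \<in> hcarrier E"
  by (rule L2D[OF K_coeff])

lemma K_eval_mem:
  assumes "f \<in> hcarrier K"
  shows "f z \<in> hcarrier E"
  using K_outside[OF assms, of z] taylor_eval_mem[OF K_taylor[OF assms], of z] by (cases "z \<in> ball 0 1") auto

text \<open>With the weight split as sqrt w times 1 / sqrt w, the arithmetic-geometric mean
  inequality gives a majorant made of two summable families: the terms of k(|z|^2) and those of the
  squared norm of \<phi>.\<close>

lemma L2_taylor_summable:
  assumes \<phi>: "\<phi> \<in> hcarrier L2" and z: "z \<in> ball 0 1"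
  shows "(\<lambda>\<alpha>. hnorm E (zpow z \<alpha> *\<^sub>C \<phi> \<alpha>)) summable_on UNIV"
proof (rule summable_on_comparison_test)
  have "(norm z)\<^sup>2 < 1"
    using z by (simp add: power_less_one_iff)
  hence "summable (\<lambda>n. a n * ((norm z)\<^sup>2) ^ n)"
    by (intro a_summable) auto
  thus "(\<lambda>\<alpha>. w \<alpha> * (cmod (zpow z \<alpha>))\<^sup>2 + (hnorm E (\<phi> \<alpha>))\<^sup>2 / w \<alpha>) summable_on UNIV"
    using summable_weight_zpow[of a z] by (intro summable_on_add L2_summable \<phi>) (simp add: w_eq)
  fix \<alpha>
  let ?s = "sqrt (w \<alpha>)" and ?u = "cmod (zpow z \<alpha>)" and ?v = "hnorm E (\<phi> \<alpha>)"
  have v: "?v \<ge> 0"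
    using L2D[OF \<phi>] by simp
  have s: "?s > 0"
    using w_pos by simp
  have "2 * (?s * ?u) * (?v / ?s) \<le> (?s * ?u)\<^sup>2 + (?v / ?s)\<^sup>2"
    by (rule sum_squares_bound)
  moreover have "(?s * ?u) * (?v / ?s) = ?u * ?v"
    using s by simp
  moreover have "(?s * ?u)\<^sup>2 = w \<alpha> * ?u\<^sup>2" "(?v / ?s)\<^sup>2 = ?v\<^sup>2 / w \<alpha>"
    by (simp_all add: power_mult_distrib power_divide)
  moreover have "0 \<le> ?u * ?v"
    using v by simp
  ultimately have "?u * ?v \<le> w \<alpha> * ?u\<^sup>2 + ?v\<^sup>2 / w \<alpha>"
    by linarith
  thus "hnorm E (zpow z \<alpha> *\<^sub>C \<phi> \<alpha>) \<le> w \<alpha> * ?u\<^sup>2 + ?v\<^sup>2 / w \<alpha>"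
    using L2D[OF \<phi>] by (simp add: norm_scale)
  show "0 \<le> hnorm E (zpow z \<alpha> *\<^sub>C \<phi> \<alpha>)"
    using L2D[OF \<phi>] by (simp add: scale_mem)
qed

lemma taylor_of_coeffs:
  fixes \<phi> :: "'d multiindex \<Rightarrow> 'e"
  assumes \<phi>: "\<phi> \<in> hcarrier L2"
  shows "taylor_coeffs E (of_coeffs E \<phi>) \<phi>"
  unfolding taylor_coeffs_def
proof (intro conjI allI ballI)
  fix z :: "complex ^ 'd" assume z: "z \<in> ball 0 1"
  have m: "zpow z \<alpha> *\<^sub>C \<phi> \<alpha> \<in> hcarrier E" for \<alpha>
    using L2D[OF \<phi>] by (rule scale_mem)
  obtain y where y: "htendsto E (\<lambda>A. \<Sum>\<alpha>\<in>A. zpow z \<alpha> *\<^sub>C \<phi> \<alpha>) y (finite_subsets_at_top UNIV)"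
    using abs_summable_htendsto[OF m L2_taylor_summable[OF \<phi> z]] by blast
  moreover have "hlim E (finite_subsets_at_top UNIV) (\<lambda>A. \<Sum>\<alpha>\<in>A. zpow z \<alpha> *\<^sub>C \<phi> \<alpha>) = y"
    by (rule hlim_eqI[OF _ y]) (use m in auto)
  ultimately show "htendsto E (\<lambda>A. \<Sum>\<alpha>\<in>A. zpow z \<alpha> *\<^sub>C \<phi> \<alpha>) (of_coeffs E \<phi> z) (finite_subsets_at_top UNIV)"
    using z by (simp add: of_coeffs_def ball_fun_def)
qed (rule L2D[OF \<phi>])

lemma coeff_of_coeffs [simp]:
  "\<phi> \<in> hcarrier L2 \<Longrightarrow> coeff_of E (of_coeffs E \<phi> :: complex ^ 'd \<Rightarrow> 'e) = \<phi>"
  by (rule coeff_of_eqI[OF taylor_of_coeffs])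

lemma of_coeffs_mem [intro]: "\<phi> \<in> hcarrier L2 \<Longrightarrow> of_coeffs E \<phi> \<in> hcarrier K"
  using taylor_of_coeffs[of \<phi>] by (simp add: K_mem_iff) (simp add: of_coeffs_def ball_fun_def)

lemma K_eqI:
  assumes f: "f \<in> hcarrier K" and g: "g \<in> hcarrier K" and eq: "\<And>\<alpha>. coeff_of E f \<alpha> = coeff_of E g \<alpha>"
  shows "f = g"
proof
  fix z
  show "f z = g z"
  proof (cases "z \<in> ball 0 1")
    case True
    have e: "coeff_of E f = coeff_of E g"
      using eq by auto
    show ?thesis
      by (rule tendsto_unique[where F = "finite_subsets_at_top UNIV"
            and X = "\<lambda>A. \<Sum>\<alpha>\<in>A. zpow z \<alpha> *\<^sub>C coeff_of E g \<alpha>"])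
        (use K_taylor[OF f] K_taylor[OF g] True taylor_sum_mem[OF K_taylor[OF g]] in \<open>auto simp: taylor_coeffs_def e\<close>)
  qed (simp add: K_outside f g)
qed

lemma of_coeffs_coeff [simp]: "f \<in> hcarrier K \<Longrightarrow> of_coeffs E (coeff_of E f) = f"
  by (rule K_eqI) (auto simp: K_coeff)

lemma K_inner: "hinner K f g = hinner L2 (coeff_of E f) (coeff_of E g)"
  by (simp add: HK_def weighted_l2_def w_eq)

lemma K_norm: "hnorm K f = hnorm L2 (coeff_of E f)"
  by (simp add: hnorm_def K_inner)

lemma
  assumes f: "f \<in> hcarrier K" and g: "g \<in> hcarrier K"
  shows K_add_mem: "f + g \<in> hcarrier K"
    and coeff_add: "coeff_of E (f + g) = coeff_of E f + coeff_of E g"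
proof -
  have "taylor_coeffs E (f + g) (coeff_of E f + coeff_of E g)"
    unfolding taylor_coeffs_def
  proof (intro conjI allI ballI)
    fix z :: "complex ^ 'd" assume z: "z \<in> ball 0 1"
    have "htendsto E (\<lambda>A. (\<Sum>\<alpha>\<in>A. zpow z \<alpha> *\<^sub>C coeff_of E f \<alpha>) + (\<Sum>\<alpha>\<in>A. zpow z \<alpha> *\<^sub>C coeff_of E g \<alpha>))
        (f z + g z) (finite_subsets_at_top UNIV)"
      by (rule htendsto_add) (use K_taylor[OF f] K_taylor[OF g] z taylor_sum_mem in \<open>auto simp: taylor_coeffs_def\<close>)
    thus "htendsto E (\<lambda>A. \<Sum>\<alpha>\<in>A. zpow z \<alpha> *\<^sub>C (coeff_of E f + coeff_of E g) \<alpha>) ((f + g) z) (finite_subsets_at_top UNIV)"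
      by (simp add: scaleC_add_right sum.distrib)
  qed (use K_coeff_mem f g in auto)
  thus "f + g \<in> hcarrier K" "coeff_of E (f + g) = coeff_of E f + coeff_of E g"
    using coeff_of_eqI L2_add_mem[OF K_coeff[OF f] K_coeff[OF g]] K_outside[OF f] K_outside[OF g]
    by (auto simp: K_mem_iff)
qed

lemma
  assumes f: "f \<in> hcarrier K"
  shows K_scale_mem: "c *\<^sub>C f \<in> hcarrier K"
    and coeff_scale: "coeff_of E (c *\<^sub>C f) = c *\<^sub>C coeff_of E f"
proof -
  have "taylor_coeffs E (c *\<^sub>C f) (c *\<^sub>C coeff_of E f)"
    unfolding taylor_coeffs_def
  proof (intro conjI allI ballI)
    fix z :: "complex ^ 'd" assume z: "z \<in> ball 0 1"
    have "htendsto E (\<lambda>A. c *\<^sub>C (\<Sum>\<alpha>\<in>A. zpow z \<alpha> *\<^sub>C coeff_of E f \<alpha>)) (c *\<^sub>C f z) (finite_subsets_at_top UNIV)"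
      by (rule htendsto_scale) (use K_taylor[OF f] z taylor_sum_mem in \<open>auto simp: taylor_coeffs_def\<close>)
    thus "htendsto E (\<lambda>A. \<Sum>\<alpha>\<in>A. zpow z \<alpha> *\<^sub>C (c *\<^sub>C coeff_of E f) \<alpha>) ((c *\<^sub>C f) z) (finite_subsets_at_top UNIV)"
      by (simp add: scaleC_fun_def scaleC_sum_right scaleC_scaleC mult.commute)
  qed (use K_coeff_mem f in \<open>auto simp: scaleC_fun_def\<close>)
  thus "c *\<^sub>C f \<in> hcarrier K" "coeff_of E (c *\<^sub>C f) = c *\<^sub>C coeff_of E f"
    using coeff_of_eqI L2_scale_mem[OF K_coeff[OF f]] K_outside[OF f]
    by (auto simp: K_mem_iff scaleC_fun_def)
qed

lemma
  shows K_zero_mem: "0 \<in> hcarrier K" and coeff_zero: "coeff_of E (0 :: complex ^ 'd \<Rightarrow> 'e) = 0"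
proof -
  have "taylor_coeffs E (0 :: complex ^ 'd \<Rightarrow> 'e) 0"
    by (simp add: taylor_coeffs_def htendsto_def)
  thus "0 \<in> hcarrier K" "coeff_of E (0 :: complex ^ 'd \<Rightarrow> 'e) = 0"
    using coeff_of_eqI inner_space.zero_mem[OF L2_inner_space] by (auto simp: K_mem_iff)
qed

text \<open>\<open>coeff_of\<close> is an isometric isomorphism onto the weighted families, with
  inverse \<open>of_coeffs\<close>.\<close>

lemma K_hilbert: "hilbert K"
proof (rule hilbert_transfer[OF L2_hilbert, where U = "coeff_of E"])
  show "\<exists>f\<in>hcarrier K. coeff_of E f = \<phi>" if "\<phi> \<in> hcarrier L2" for \<phi>
    using that by (intro bexI[of _ "of_coeffs E \<phi>"]) auto
  show "f = 0" if "f \<in> hcarrier K" "coeff_of E f = 0" for f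
    using that by (intro K_eqI) (auto simp: K_zero_mem coeff_zero)
qed (auto simp: K_coeff K_add_mem coeff_add K_scale_mem coeff_scale K_zero_mem K_inner)

end

sublocale HK_space \<subseteq> K: hilbert K
  by (rule K_hilbert)

context HK_space
begin

lemma coeff_diff: "\<lbrakk>f \<in> hcarrier K; g \<in> hcarrier K\<rbrakk> \<Longrightarrow> coeff_of E (f - g) = coeff_of E f - coeff_of E g"
  using coeff_add[of f "- g"] coeff_scale[of g "-1"] by (simp add: K.uminus_mem)

lemma coeff_sum:
  "(\<And>i. i \<in> I \<Longrightarrow> f i \<in> hcarrier K) \<Longrightarrow> coeff_of E (\<Sum>i\<in>I. f i) \<alpha> = (\<Sum>i\<in>I. coeff_of E (f i) \<alpha>)"
  by (induction I rule: infinite_finite_induct) (simp_all add: coeff_zero coeff_add K.sum_mem)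

lemma eval_zero:
  assumes f: "f \<in> hcarrier K"
  shows "f 0 = coeff_of E f (\<lambda>_. 0)"
proof (rule eqI_inner)
  fix h assume h: "h \<in> hcarrier E"
  have "((\<lambda>\<alpha>. zpow 0 \<alpha> * hinner E (coeff_of E f \<alpha>) h) has_sum hinner E (f 0) h) UNIV"
    by (rule taylor_weak[OF K_taylor[OF f] _ h]) simp
  moreover have "((\<lambda>\<alpha>. zpow 0 \<alpha> * hinner E (coeff_of E f \<alpha>) h) has_sum hinner E (coeff_of E f (\<lambda>_. 0)) h) UNIV
      \<longleftrightarrow> ((\<lambda>\<alpha>. zpow 0 \<alpha> * hinner E (coeff_of E f \<alpha>) h) has_sum hinner E (coeff_of E f (\<lambda>_. 0)) h) {\<lambda>_. 0}"
    by (rule has_sum_cong_neutral) (auto simp: zpow_0_left)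
  ultimately have "hinner E (f 0) h = hinner E (coeff_of E f (\<lambda>_. 0)) h"
    using has_sum_unique by (simp add: has_sum_finite_iff)
  thus "hinner E h (f 0) = hinner E h (coeff_of E f (\<lambda>_. 0))"
    using inner_commute[OF K_eval_mem[OF f, of 0] h] inner_commute[OF K_coeff_mem[OF f, of "\<lambda>_. 0"] h] by simp
qed (use f in \<open>auto simp: K_coeff_mem K_eval_mem\<close>)

lemma L2_diag_mem:
  assumes "\<phi> \<in> hcarrier L2" "\<And>\<alpha>. cmod (l \<alpha>) \<le> M"
  shows "(\<lambda>\<alpha>. l \<alpha> *\<^sub>C \<phi> \<alpha>) \<in> hcarrier L2"
proof (rule L2I_le)
  show "(\<lambda>\<alpha>. M\<^sup>2 * ((hnorm E (\<phi> \<alpha>))\<^sup>2 / w \<alpha>)) summable_on UNIV"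
    by (rule summable_on_cmult_right[OF L2_summable[OF assms(1)]])
  show "(hnorm E (l \<alpha> *\<^sub>C \<phi> \<alpha>))\<^sup>2 / w \<alpha> \<le> M\<^sup>2 * ((hnorm E (\<phi> \<alpha>))\<^sup>2 / w \<alpha>)" for \<alpha>
    using L2D[OF assms(1), of \<alpha>] power_mono[OF assms(2)[of \<alpha>], of 2]
    by (auto simp: norm_scale power_mult_distrib intro!: divide_right_mono mult_right_mono)
qed (use L2D[OF assms(1)] in auto)

end

section \<open>Shifts and diagonal operators\<close>

lemma index_list: "set (index_list :: 'd::finite list) = UNIV" "distinct (index_list :: 'd::finite list)"
proof -
  have "\<exists>xs. set xs = (UNIV :: 'd set) \<and> distinct xs"
    using finite_distinct_list[of "UNIV :: 'd set"] by simp
  from someI_ex[OF this]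
  show "set (index_list :: 'd::finite list) = UNIV" "distinct (index_list :: 'd::finite list)"
    by (simp_all add: index_list_def)
qed

text \<open>\<open>tpow\<close> composes along an arbitrary enumeration and has no direct recursion
  in \<alpha>. A relation that survives one more factor A i on the operator side and one more e_i on
  the index side holds at the end, whatever the order.\<close>

lemma tpow_induct:
  assumes zero: "P (\<lambda>_. 0) x" and step: "\<And>\<beta> y i. P \<beta> y \<Longrightarrow> P (\<beta> + unit_index i) (A i y)"
  shows "P \<alpha> (tpow A \<alpha> x)"
proof -
  have iter: "P (\<beta> + (\<lambda>j. if j = i then n else 0)) ((A i ^^ n) y)" if "P \<beta> y" for \<beta> y i n
  proof (induction n)
    case 0
    have "\<beta> + (\<lambda>j. if j = i then 0 else 0) = \<beta>"
      by auto
    thus ?case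
      using that by simp
  next
    case (Suc n)
    have "\<beta> + (\<lambda>j. if j = i then n else 0) + unit_index i = \<beta> + (\<lambda>j. if j = i then Suc n else 0)"
      by (auto simp: unit_index_def)
    with step[OF Suc, of i] show ?case
      by (simp only: funpow.simps o_apply)
  qed
  \<comment> \<open>P holds for the restriction of \<alpha> to the indices already used;
    distinctness of the enumeration prevents an index from being counted twice.\<close>
  have "P (\<lambda>j. if j \<in> set xs then \<alpha> j else 0) (foldr (\<lambda>i B. (A i ^^ \<alpha> i) \<circ> B) xs id x)" if "distinct xs" for xs
    using that
  proof (induction xs)
    case (Cons i xs)
    have "(\<lambda>j. if j \<in> set xs then \<alpha> j else 0) + (\<lambda>j. if j = i then \<alpha> i else 0) =
        (\<lambda>j. if j \<in> set (i # xs) then \<alpha> j else 0)"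
      using Cons.prems by auto
    with iter[OF Cons.IH, of i "\<alpha> i"] Cons.prems show ?case
      by simp
  qed (simp add: zero)
  from this[OF index_list(2)] show ?thesis
    by (simp add: tpow_def index_list(1))
qed

lemma inj_add_unit: "inj (\<lambda>\<alpha> :: 'd multiindex. \<alpha> + unit_index i)"
  by (rule injI) simp

lemma range_add_unit: "range (\<lambda>\<alpha> :: 'd multiindex. \<alpha> + unit_index i) = {\<beta>. \<beta> i > 0}"
proof (intro equalityI subsetI)
  fix \<beta> :: "'d multiindex" assume "\<beta> \<in> {\<beta>. \<beta> i > 0}"
  hence "\<beta> = (\<beta> - unit_index i) + unit_index i"
    by (auto simp: fun_eq_iff unit_index_def)
  thus "\<beta> \<in> range (\<lambda>\<alpha>. \<alpha> + unit_index i)"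
    by blast
qed auto

lemma diff_unit_add: "\<beta> i > 0 \<Longrightarrow> \<beta> - unit_index i + unit_index i = (\<beta> :: 'd multiindex)"
  by (auto simp: fun_eq_iff unit_index_def)

lemma msize_diff_unit: "\<beta> i > 0 \<Longrightarrow> msize (\<beta> - unit_index i) = msize \<beta> - 1"
  using msize_add[of "\<beta> - unit_index i" "unit_index i"] by (simp add: diff_unit_add)

text \<open>The shift by e_i is injective with range the indices of positive i-th entry, and F
  vanishes off that range.\<close>

lemma has_sum_add_unit:
  fixes F :: "'d multiindex \<Rightarrow> 'b::{comm_monoid_add, t2_space}"
  assumes "\<And>\<beta>. \<beta> i = 0 \<Longrightarrow> F \<beta> = 0"
  shows "((\<lambda>\<alpha>. F (\<alpha> + unit_index i)) has_sum s) UNIV \<longleftrightarrow> (F has_sum s) UNIV"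
proof -
  have "(F has_sum s) UNIV \<longleftrightarrow> (F has_sum s) (range (\<lambda>\<alpha>. \<alpha> + unit_index i))"
    by (rule has_sum_cong_neutral) (auto simp: range_add_unit assms)
  thus ?thesis
    by (simp add: has_sum_reindex[OF inj_add_unit] o_def)
qed

lemma summable_add_unit:
  fixes F :: "'d multiindex \<Rightarrow> 'b::{comm_monoid_add, t2_space}"
  assumes "\<And>\<beta>. \<beta> i = 0 \<Longrightarrow> F \<beta> = 0"
  shows "(\<lambda>\<alpha>. F (\<alpha> + unit_index i)) summable_on UNIV \<longleftrightarrow> F summable_on UNIV"
  using has_sum_add_unit[where i = i and F = F, OF assms] by (simp add: summable_on_def)

lemma infsum_add_unit:
  fixes F :: "'d multiindex \<Rightarrow> 'b::{comm_monoid_add, t2_space}"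
  assumes "\<And>\<beta>. \<beta> i = 0 \<Longrightarrow> F \<beta> = 0"
  shows "(\<Sum>\<^sub>\<infinity>\<alpha>. F (\<alpha> + unit_index i)) = infsum F UNIV"
  using has_sum_add_unit[where i = i and F = F, OF assms] by (intro infsum_eqI') simp

context HK_space
begin

text \<open>A monomial has squared norm 1 / w \<alpha>, so the quotient is the squared stretching of
  the monomial of index \<alpha> under multiplication by z_i.\<close>

lemma w_ratio: "w \<alpha> / w (\<alpha> + unit_index i) = a (msize \<alpha>) / a (Suc (msize \<alpha>)) * (real (Suc (\<alpha> i)) / real (Suc (msize \<alpha>)))"
proof -
  have "mgamma (\<alpha> + unit_index i) = mgamma \<alpha> * real (Suc (msize \<alpha>)) / real (Suc (\<alpha> i))"
    using mgamma_add_unit[of \<alpha> i] by (simp add: field_simps)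
  thus ?thesis
    using mgamma_pos[of \<alpha>] by (simp add: w_eq less_imp_neq[symmetric])
qed

text \<open>Multiplication by z_i is bounded because a_n / a_(n+1) is, the factor (\<alpha>_i + 1) /
  (|\<alpha>| + 1) being at most 1. One M serves all i.\<close>

lemma w_le_w_add:
  "\<exists>M\<ge>0. \<forall>\<alpha> i. w \<alpha> \<le> M * w (\<alpha> + unit_index i)"
proof -
  obtain M where M: "\<And>n. a n \<le> M * a (Suc n)"
    using a_decrease by blast
  have "M \<ge> 0"
    using M[of 0] a_pos[of 0] a_pos[of "Suc 0"] by (smt (verit) mult_neg_pos)
  moreover have "w \<alpha> \<le> M * w (\<alpha> + unit_index i)" for \<alpha> i
  proof -
    have "\<alpha> i \<le> msize \<alpha>"
      unfolding msize_def by (rule member_le_sum) auto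
    hence "a (msize \<alpha>) / a (Suc (msize \<alpha>)) * (real (Suc (\<alpha> i)) / real (Suc (msize \<alpha>))) \<le> M * 1"
      using M[of "msize \<alpha>"] a_pos[of "Suc (msize \<alpha>)"] \<open>M \<ge> 0\<close>
      by (intro mult_mono) (auto simp: field_simps)
    hence "w \<alpha> / w (\<alpha> + unit_index i) \<le> M"
      by (simp add: w_ratio)
    thus ?thesis
      using w_pos[of "\<alpha> + unit_index i"] by (simp add: field_simps)
  qed
  ultimately show ?thesis
    by blast
qed

text \<open>The reason why \<open>\<sigma>\<close> maps diagonal operators to diagonal operators for \<open>T = M\<^sub>z\<close>.\<close>

lemma sum_w_ratio:
  assumes "msize \<beta> = Suc n"
  shows "(\<Sum>i\<in>UNIV. if \<beta> i = 0 then 0 else w (\<beta> - unit_index i) / w \<beta>) = a n / a (Suc n)"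
proof -
  have "(if \<beta> i = 0 then 0 else w (\<beta> - unit_index i) / w \<beta>) = a n / a (Suc n) * (real (\<beta> i) / real (Suc n))" for i
  proof (cases "\<beta> i = 0")
    case False
    thus ?thesis
      using w_ratio[of "\<beta> - unit_index i" i] assms by (simp add: diff_unit_add msize_diff_unit)
  qed simp
  moreover have "(\<Sum>i\<in>UNIV. real (\<beta> i)) = real (Suc n)"
    using assms by (simp add: msize_def flip: of_nat_sum)
  ultimately show ?thesis
    by (simp flip: sum_distrib_left sum_divide_distrib)
qed

definition shift :: "'d \<Rightarrow> ('d multiindex \<Rightarrow> 'e) \<Rightarrow> 'd multiindex \<Rightarrow> 'e"
  where "shift i \<phi> \<beta> = (if \<beta> i = 0 then 0 else \<phi> (\<beta> - unit_index i))"

lemma shift_add_unit [simp]: "shift i \<phi> (\<alpha> + unit_index i) = \<phi> \<alpha>"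
  by (simp add: shift_def)

lemma shift_eq_0 [simp]: "\<beta> i = 0 \<Longrightarrow> shift i \<phi> \<beta> = 0"
  by (simp add: shift_def)

lemma
  assumes \<phi>: "\<phi> \<in> hcarrier L2" and M: "\<And>\<alpha>. w \<alpha> \<le> M * w (\<alpha> + unit_index i)"
  shows shift_mem: "shift i \<phi> \<in> hcarrier L2"
    and shift_norm: "(hnorm L2 (shift i \<phi>))\<^sup>2 \<le> M * (hnorm L2 \<phi>)\<^sup>2"
proof -
  let ?F = "\<lambda>\<beta>. (hnorm E (shift i \<phi> \<beta>))\<^sup>2 / w \<beta>"
  have le: "?F (\<alpha> + unit_index i) \<le> M * ((hnorm E (\<phi> \<alpha>))\<^sup>2 / w \<alpha>)" for \<alpha>
    using mult_left_mono[OF M[of \<alpha>], of "(hnorm E (\<phi> \<alpha>))\<^sup>2"] w_pos[of \<alpha>] w_pos[of "\<alpha> + unit_index i"]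
    by (simp add: field_simps)
  have s: "(\<lambda>\<alpha>. M * ((hnorm E (\<phi> \<alpha>))\<^sup>2 / w \<alpha>)) summable_on UNIV"
    by (rule summable_on_cmult_right[OF L2_summable[OF \<phi>]])
  have s': "(\<lambda>\<alpha>. ?F (\<alpha> + unit_index i)) summable_on UNIV"
    by (rule summable_on_comparison_test[OF s le]) simp
  have "?F summable_on UNIV"
    using s' by (subst (asm) summable_add_unit) auto
  thus mem: "shift i \<phi> \<in> hcarrier L2"
    using L2D[OF \<phi>] by (auto simp: weighted_l2_mem_iff shift_def)
  have "(hnorm L2 (shift i \<phi>))\<^sup>2 = (\<Sum>\<^sub>\<infinity>\<alpha>. ?F (\<alpha> + unit_index i))"
    unfolding L2_norm_sq[OF mem] by (rule infsum_add_unit[symmetric]) simp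
  also have "\<dots> \<le> (\<Sum>\<^sub>\<infinity>\<alpha>. M * ((hnorm E (\<phi> \<alpha>))\<^sup>2 / w \<alpha>))"
    by (rule infsum_mono[OF s' s le])
  also have "\<dots> = M * (hnorm L2 \<phi>)\<^sup>2"
    unfolding L2_norm_sq[OF \<phi>] by (rule infsum_cmult_right')
  finally show "(hnorm L2 (shift i \<phi>))\<^sup>2 \<le> M * (hnorm L2 \<phi>)\<^sup>2" .
qed

lemma Mz_eq:
  assumes f: "f \<in> hcarrier K"
  shows "Mz i f = of_coeffs E (shift i (coeff_of E f))"
proof
  obtain M where M: "M \<ge> 0" "\<And>\<alpha> i. w \<alpha> \<le> M * w (\<alpha> + unit_index i)"
    using w_le_w_add by blast
  have m: "shift i (coeff_of E f) \<in> hcarrier L2"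
    by (rule shift_mem[OF K_coeff[OF f] M(2)])
  note mem = of_coeffs_mem[OF m] and taylor = taylor_of_coeffs[OF m]
  fix z
  show "Mz i f z = of_coeffs E (shift i (coeff_of E f)) z"
  proof (cases "z \<in> ball 0 1")
    case True
    show ?thesis
    proof (rule eqI_inner)
      fix h assume h: "h \<in> hcarrier E"
      let ?g = "\<lambda>\<alpha>. zpow z \<alpha> * hinner E (shift i (coeff_of E f) \<alpha>) h"
      have "((\<lambda>\<alpha>. (z $ i) * (zpow z \<alpha> * hinner E (coeff_of E f \<alpha>) h)) has_sum (z $ i) * hinner E (f z) h) UNIV"
        by (rule has_sum_cmult_right[OF taylor_weak[OF K_taylor[OF f] True h]])
      hence "((\<lambda>\<alpha>. ?g (\<alpha> + unit_index i)) has_sum (z $ i) * hinner E (f z) h) UNIV"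
        by (simp add: zpow_add mult_ac)
      hence "(?g has_sum (z $ i) * hinner E (f z) h) UNIV"
        by (subst (asm) has_sum_add_unit) (use h in auto)
      with taylor_weak[OF taylor True h]
      have "hinner E (of_coeffs E (shift i (coeff_of E f)) z) h = hinner E (Mz i f z) h"
        using has_sum_unique h by (simp add: Mz_def inner_scale_left K_eval_mem[OF f]) blast
      thus "hinner E h (Mz i f z) = hinner E h (of_coeffs E (shift i (coeff_of E f)) z)"
        using inner_commute[OF K_eval_mem[OF mem] h] inner_commute[of "Mz i f z" h] K_eval_mem[OF f, of z] h
        by (simp add: Mz_def scale_mem)
    qed (use K_eval_mem[OF f] K_eval_mem[OF mem] in \<open>auto simp: Mz_def\<close>)
  qed (simp add: Mz_def K_outside[OF f] K_outside[OF mem])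
qed

lemma Mz_mem [simp]: "f \<in> hcarrier K \<Longrightarrow> Mz i f \<in> hcarrier K"
  and coeff_Mz: "f \<in> hcarrier K \<Longrightarrow> coeff_of E (Mz i f) = shift i (coeff_of E f)"
proof -
  assume f: "f \<in> hcarrier K"
  obtain M where M: "M \<ge> 0" "\<And>\<alpha> i. w \<alpha> \<le> M * w (\<alpha> + unit_index i)"
    using w_le_w_add by blast
  have m: "shift i (coeff_of E f) \<in> hcarrier L2"
    by (rule shift_mem[OF K_coeff[OF f] M(2)])
  show "Mz i f \<in> hcarrier K" "coeff_of E (Mz i f) = shift i (coeff_of E f)"
    unfolding Mz_eq[OF f] by (rule of_coeffs_mem[OF m], rule coeff_of_coeffs[OF m])
qed

lemma bounded_op_Mz: "bounded_op K K (Mz i)"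
proof -
  obtain M where M: "M \<ge> 0" "\<And>\<alpha> i. w \<alpha> \<le> M * w (\<alpha> + unit_index i)"
    using w_le_w_add by blast
  show ?thesis
  proof (rule bounded_opI[where M = "sqrt M"])
    fix f assume f: "f \<in> hcarrier K"
    have "(hnorm K (Mz i f))\<^sup>2 \<le> (sqrt M * hnorm K f)\<^sup>2"
      using shift_norm[OF K_coeff[OF f] M(2)] M(1) f by (simp add: K_norm coeff_Mz power_mult_distrib)
    thus "hnorm K (Mz i f) \<le> sqrt M * hnorm K f"
      by (rule power2_le_imp_le) (use M f in simp)
  next
    show "Mz i f \<in> hcarrier K" if "f \<in> hcarrier K" for f
      using that by simp
  qed (auto simp: Mz_def scaleC_fun_def fun_eq_iff scaleC_add_right scaleC_scaleC mult.commute)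
qed

text \<open>The adjoint of multiplication by z_i, written out on coefficients. The explicit formula
  is easier to iterate than \<open>hadjoint\<close>, with which it agrees on H_K(E).\<close>

definition backshift :: "'d \<Rightarrow> (complex ^ 'd \<Rightarrow> 'e) \<Rightarrow> complex ^ 'd \<Rightarrow> 'e"
  where "backshift i f =
    of_coeffs E (\<lambda>\<beta>. of_real (w \<beta> / w (\<beta> + unit_index i)) *\<^sub>C coeff_of E f (\<beta> + unit_index i))"

lemma backshift_coeffs_mem:
  assumes \<phi>: "\<phi> \<in> hcarrier L2"
  shows "(\<lambda>\<beta>. of_real (w \<beta> / w (\<beta> + unit_index i)) *\<^sub>C \<phi> (\<beta> + unit_index i)) \<in> hcarrier L2"
proof -
  obtain M where M: "M \<ge> 0" "\<And>\<alpha> i. w \<alpha> \<le> M * w (\<alpha> + unit_index i)"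
    using w_le_w_add by blast
  let ?s = "\<lambda>\<alpha>. (hnorm E (\<phi> \<alpha>))\<^sup>2 / w \<alpha>"
  have "?s summable_on range (\<lambda>\<alpha>. \<alpha> + unit_index i)"
    by (rule summable_on_subset_banach[OF L2_summable[OF \<phi>]]) simp
  hence s: "(\<lambda>\<alpha>. M * ?s (\<alpha> + unit_index i)) summable_on UNIV"
    by (intro summable_on_cmult_right) (simp add: summable_on_reindex[OF inj_add_unit] o_def)
  show ?thesis
  proof (rule L2I_le[OF _ _ s])
    fix \<beta>
    show "of_real (w \<beta> / w (\<beta> + unit_index i)) *\<^sub>C \<phi> (\<beta> + unit_index i) \<in> hcarrier E"
      using L2D[OF \<phi>] by (rule scale_mem)
    have "(hnorm E (of_real (w \<beta> / w (\<beta> + unit_index i)) *\<^sub>C \<phi> (\<beta> + unit_index i)))\<^sup>2 / w \<beta> =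
        w \<beta> / w (\<beta> + unit_index i) * ?s (\<beta> + unit_index i)"
      using L2D[OF \<phi>] w_pos[of \<beta>] w_pos[of "\<beta> + unit_index i"]
      by (simp add: norm_scale power_mult_distrib field_simps power2_eq_square norm_divide norm_mult)
    also have "\<dots> \<le> M * ?s (\<beta> + unit_index i)"
      using M(2)[of \<beta>] w_pos[of "\<beta> + unit_index i"] by (intro mult_right_mono) (auto simp: field_simps)
    finally show "(hnorm E (of_real (w \<beta> / w (\<beta> + unit_index i)) *\<^sub>C \<phi> (\<beta> + unit_index i)))\<^sup>2 / w \<beta>
        \<le> M * ?s (\<beta> + unit_index i)" .
  qed
qed

lemma backshift_mem [simp]: "f \<in> hcarrier K \<Longrightarrow> backshift i f \<in> hcarrier K"
  unfolding backshift_def by (rule of_coeffs_mem[OF backshift_coeffs_mem[OF K_coeff]])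

lemma coeff_backshift: "f \<in> hcarrier K \<Longrightarrow> coeff_of E (backshift i f) \<beta> =
    of_real (w \<beta> / w (\<beta> + unit_index i)) *\<^sub>C coeff_of E f (\<beta> + unit_index i)"
  unfolding backshift_def by (subst coeff_of_coeffs[OF backshift_coeffs_mem[OF K_coeff]]) auto

lemma inner_Mz_backshift:
  assumes f: "f \<in> hcarrier K" and g: "g \<in> hcarrier K"
  shows "hinner K (Mz i g) f = hinner K g (backshift i f)"
proof -
  let ?F = "\<lambda>\<beta>. hinner E (shift i (coeff_of E g) \<beta>) (coeff_of E f \<beta>) / of_real (w \<beta>)"
  have "hinner K (Mz i g) f = infsum ?F UNIV"
    by (simp add: K_inner L2_inner coeff_Mz[OF g])
  also have "\<dots> = (\<Sum>\<^sub>\<infinity>\<alpha>. ?F (\<alpha> + unit_index i))"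
    by (rule infsum_add_unit[symmetric]) (simp add: K_coeff_mem[OF f])
  also have "\<dots> = hinner K g (backshift i f)"
    unfolding K_inner L2_inner
    by (rule infsum_cong) (simp add: coeff_backshift[OF f] inner_scale_right K_coeff_mem f g)
  finally show ?thesis .
qed

lemma adj_tuple_Mz: "f \<in> hcarrier K \<Longrightarrow> adj_tuple K Mz i f = backshift i f"
  unfolding adj_tuple_def
  by (rule hadjoint_eqI[OF K.inner_space_axioms]) (auto simp: inner_Mz_backshift)

text \<open>The quotients of weights telescope along the factors. The set V and the tuple A are
  general so that the formula covers the adjoints of M_z on all of H_K(E) as well as those of T on
  the model space.\<close>

lemma tpow_backshift:
  assumes mem: "\<And>i f. f \<in> V \<Longrightarrow> A i f \<in> V" and eq: "\<And>i f. f \<in> V \<Longrightarrow> A i f = backshift i f"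
    and V: "V \<subseteq> hcarrier K" and f: "f \<in> V"
  shows "tpow A \<alpha> f \<in> V"
    and "coeff_of E (tpow A \<alpha> f) \<beta> = of_real (w \<beta> / w (\<beta> + \<alpha>)) *\<^sub>C coeff_of E f (\<beta> + \<alpha>)"
proof -
  let ?P = "\<lambda>\<alpha> g. g \<in> V \<and> (\<forall>\<beta>. coeff_of E g \<beta> = of_real (w \<beta> / w (\<beta> + \<alpha>)) *\<^sub>C coeff_of E f (\<beta> + \<alpha>))"
  have "?P \<alpha> (tpow A \<alpha> f)"
  proof (rule tpow_induct[where P = ?P])
    have "\<beta> + (\<lambda>_. 0) = \<beta>" for \<beta> :: "'d multiindex"
      by (simp add: fun_eq_iff)
    thus "?P (\<lambda>_. 0) f"
      using f by (simp add: scaleC_one)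
  next
    fix \<beta> g i assume g: "?P \<beta> g"
    have "coeff_of E (A i g) \<delta> = of_real (w \<delta> / w (\<delta> + (\<beta> + unit_index i))) *\<^sub>C coeff_of E f (\<delta> + (\<beta> + unit_index i))" for \<delta>
    proof -
      have "\<delta> + unit_index i + \<beta> = \<delta> + (\<beta> + unit_index i)"
        by (simp add: add_ac)
      moreover have "g \<in> hcarrier K"
        using g V by blast
      ultimately show ?thesis
        using g by (simp add: eq coeff_backshift scaleC_scaleC)
    qed
    thus "?P (\<beta> + unit_index i) (A i g)"
      using g mem by blast
  qed
  thus "tpow A \<alpha> f \<in> V"
    "coeff_of E (tpow A \<alpha> f) \<beta> = of_real (w \<beta> / w (\<beta> + \<alpha>)) *\<^sub>C coeff_of E f (\<beta> + \<alpha>)"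
    by blast+
qed

lemma
  assumes f: "f \<in> hcarrier K"
  shows tpow_Mz_mem: "tpow Mz \<alpha> f \<in> hcarrier K"
    and tpow_Mz: "tpow Mz \<alpha> f = (\<lambda>z. zpow z \<alpha> *\<^sub>C f z)"
proof -
  have "tpow Mz \<alpha> f \<in> hcarrier K \<and> (\<forall>z. tpow Mz \<alpha> f z = zpow z \<alpha> *\<^sub>C f z)"
  proof (rule tpow_induct[where P = "\<lambda>\<alpha> g. g \<in> hcarrier K \<and> (\<forall>z. g z = zpow z \<alpha> *\<^sub>C f z)"])
    fix \<beta> g i assume g: "g \<in> hcarrier K \<and> (\<forall>z. g z = zpow z \<beta> *\<^sub>C f z)"
    have "Mz i g z = zpow z (\<beta> + unit_index i) *\<^sub>C f z" for z
      using g by (simp add: Mz_def scaleC_scaleC zpow_add mult.commute)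
    with g show "Mz i g \<in> hcarrier K \<and> (\<forall>z. Mz i g z = zpow z (\<beta> + unit_index i) *\<^sub>C f z)"
      by (intro conjI allI Mz_mem) simp_all
  qed (simp add: f scaleC_one)
  thus "tpow Mz \<alpha> f \<in> hcarrier K" "tpow Mz \<alpha> f = (\<lambda>z. zpow z \<alpha> *\<^sub>C f z)"
    by auto
qed

lemma Mz_tpow: "f \<in> hcarrier K \<Longrightarrow> Mz i (tpow Mz \<alpha> f) = tpow Mz (\<alpha> + unit_index i) f"
  by (simp add: tpow_Mz Mz_def zpow_add scaleC_scaleC mult.commute)

text \<open>The symbol s depends on the degree alone. Such operators form the class that sigma for
  M_z preserves, and they include the identity, \<Delta> and the projection onto the
  constants.\<close>

definition diagonal :: "((complex ^ 'd \<Rightarrow> 'e) \<Rightarrow> complex ^ 'd \<Rightarrow> 'e) \<Rightarrow> (nat \<Rightarrow> real) \<Rightarrow> bool"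
  where "diagonal X s \<longleftrightarrow> (\<forall>f\<in>hcarrier K. X f \<in> hcarrier K \<and>
    (\<forall>\<beta>. coeff_of E (X f) \<beta> = of_real (s (msize \<beta>)) *\<^sub>C coeff_of E f \<beta>))"

text \<open>Degree m of the result comes from degree m - 1 of X, and the weight quotients over all
  directions add up to a_(m-1) / a_m; nothing reaches degree 0. Stated outside
  \<open>sigma_op\<close> so that X = \<Delta> can be inserted directly.\<close>

lemma coeff_Mz_diagonal_backshift:
  assumes X: "diagonal X s" and f: "f \<in> hcarrier K"
  shows "coeff_of E (\<Sum>i\<in>UNIV. Mz i (X (backshift i f))) \<beta> =
    of_real (case msize \<beta> of 0 \<Rightarrow> 0 | Suc n \<Rightarrow> s n * (a n / a (Suc n))) *\<^sub>C coeff_of E f \<beta>"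
proof -
  have mem: "X (backshift i f) \<in> hcarrier K" for i
    using X f by (simp add: diagonal_def)
  have "coeff_of E (\<Sum>i\<in>UNIV. Mz i (X (backshift i f))) \<beta> = (\<Sum>i\<in>UNIV. shift i (coeff_of E (X (backshift i f))) \<beta>)"
    by (simp add: coeff_sum mem coeff_Mz)
  also have "\<dots> = (\<Sum>i\<in>UNIV. of_real (s (msize \<beta> - 1) * (if \<beta> i = 0 then 0 else w (\<beta> - unit_index i) / w \<beta>)) *\<^sub>C coeff_of E f \<beta>)"
  proof (rule sum.cong)
    fix i
    show "shift i (coeff_of E (X (backshift i f))) \<beta> =
        of_real (s (msize \<beta> - 1) * (if \<beta> i = 0 then 0 else w (\<beta> - unit_index i) / w \<beta>)) *\<^sub>C coeff_of E f \<beta>"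
      using X f by (simp add: shift_def diagonal_def coeff_backshift diff_unit_add msize_diff_unit scaleC_scaleC)
  qed simp
  also have "\<dots> = of_real (s (msize \<beta> - 1) * (\<Sum>i\<in>UNIV. if \<beta> i = 0 then 0 else w (\<beta> - unit_index i) / w \<beta>)) *\<^sub>C coeff_of E f \<beta>"
    by (simp only: scaleC_sum_left[symmetric] of_real_sum[symmetric] sum_distrib_left[symmetric])
  also have "s (msize \<beta> - 1) * (\<Sum>i\<in>UNIV. if \<beta> i = 0 then 0 else w (\<beta> - unit_index i) / w \<beta>) =
      (case msize \<beta> of 0 \<Rightarrow> 0 | Suc n \<Rightarrow> s n * (a n / a (Suc n)))"
  proof (cases "msize \<beta>")
    case 0
    thus ?thesis
      by (simp add: msize_eq_0_iff)
  next
    case (Suc n)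
    thus ?thesis
      by (simp add: sum_w_ratio)
  qed
  finally show ?thesis .
qed

lemma sigma_op_diagonal:
  assumes X: "diagonal X s"
  shows "diagonal (sigma_op K Mz X) (\<lambda>m. case m of 0 \<Rightarrow> 0 | Suc n \<Rightarrow> s n * (a n / a (Suc n)))"
  unfolding diagonal_def
proof (intro ballI conjI allI)
  fix f \<beta> assume f: "f \<in> hcarrier K"
  have eq: "sigma_op K Mz X f = (\<Sum>i\<in>UNIV. Mz i (X (backshift i f)))"
    using f by (simp add: sigma_op_def adj_tuple_Mz)
  show "sigma_op K Mz X f \<in> hcarrier K"
    unfolding eq using X f by (intro K.sum_mem Mz_mem) (simp add: diagonal_def)
  show "coeff_of E (sigma_op K Mz X f) \<beta> =
      of_real (case msize \<beta> of 0 \<Rightarrow> 0 | Suc n \<Rightarrow> s n * (a n / a (Suc n))) *\<^sub>C coeff_of E f \<beta>"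
    unfolding eq by (rule coeff_Mz_diagonal_backshift[OF X f])
qed

text \<open>The factors a_k / a_(k+1) telescope, so n steps contribute a_(m-n) / a_m to degree
  m.\<close>

lemma sigma_op_power_diagonal:
  assumes X: "diagonal X s"
  shows "diagonal ((sigma_op K Mz ^^ n) X) (\<lambda>m. if n \<le> m then s (m - n) * (a (m - n) / a m) else 0)"
proof (induction n)
  case (Suc n)
  have "(\<lambda>m. case m of 0 \<Rightarrow> 0 | Suc k \<Rightarrow> (if n \<le> k then s (k - n) * (a (k - n) / a k) else 0) * (a k / a (Suc k))) =
      (\<lambda>m. if Suc n \<le> m then s (m - Suc n) * (a (m - Suc n) / a m) else 0)"
    by (auto split: nat.splits)
  with sigma_op_diagonal[OF Suc] show ?case
    by simp
qed (use X in simp)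

lemma diagonal_id: "diagonal id (\<lambda>_. 1)"
  by (simp add: diagonal_def scaleC_one)

text \<open>\<Delta> maps the space into itself because a_(n+1) / a_n is bounded, which reflects the
  positive lower bound of the ratios a_n / a_(n+1).\<close>

lemma Delta_diagonal: "diagonal (Delta a E) (\<lambda>n. a (Suc n) / a n)"
proof -
  obtain M where M: "\<And>n. a (Suc n) \<le> M * a n"
    using a_increase by blast
  have "cmod (of_real (a (Suc n) / a n)) \<le> M" for n
    unfolding norm_of_real using M[of n] a_pos[of n] a_pos[of "Suc n"] by (simp add: field_simps)
  from L2_diag_mem[OF K_coeff this]
  show ?thesis
    unfolding diagonal_def Delta_def by auto
qed

text \<open>The constant e on the ball, extended by 0. As a_0 = 1, it is the kernel function at the
  origin applied to e, so that pairing with it evaluates at 0.\<close>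

definition const_fun :: "'e \<Rightarrow> complex ^ 'd \<Rightarrow> 'e"
  where "const_fun e = of_coeffs E (\<lambda>\<alpha>. if \<alpha> = (\<lambda>_. 0) then e else 0)"

lemma
  assumes e: "e \<in> hcarrier E"
  shows const_fun_mem: "const_fun e \<in> hcarrier K"
    and coeff_const_fun: "coeff_of E (const_fun e) \<alpha> = (if \<alpha> = (\<lambda>_. 0) then e else 0)"
    and const_fun_eval: "z \<in> ball 0 1 \<Longrightarrow> const_fun e z = e"
    and inner_const_fun: "f \<in> hcarrier K \<Longrightarrow> hinner K f (const_fun e) = hinner E (f 0) e"
proof -
  let ?\<phi> = "\<lambda>\<alpha> :: 'd multiindex. if \<alpha> = (\<lambda>_. 0) then e else 0"
  have "(\<lambda>\<alpha>. (hnorm E (?\<phi> \<alpha>))\<^sup>2 / w \<alpha>) summable_on UNIV \<longleftrightarrow> (\<lambda>\<alpha>. (hnorm E (?\<phi> \<alpha>))\<^sup>2 / w \<alpha>) summable_on {\<lambda>_. 0}"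
    by (rule summable_on_cong_neutral) auto
  hence \<phi>: "?\<phi> \<in> hcarrier L2"
    using e by (simp add: weighted_l2_mem_iff)
  show mem: "const_fun e \<in> hcarrier K"
    unfolding const_fun_def by (rule of_coeffs_mem[OF \<phi>])
  show coeff: "coeff_of E (const_fun e) \<alpha> = (if \<alpha> = (\<lambda>_. 0) then e else 0)" for \<alpha>
    unfolding const_fun_def by (simp add: coeff_of_coeffs[OF \<phi>])
  show "const_fun e z = e" if z: "z \<in> ball 0 1"
  proof (rule eqI_inner)
    fix h assume h: "h \<in> hcarrier E"
    have "((\<lambda>\<alpha>. zpow z \<alpha> * hinner E (?\<phi> \<alpha>) h) has_sum hinner E (const_fun e z) h) UNIV"
      unfolding const_fun_def by (rule taylor_weak[OF taylor_of_coeffs[OF \<phi>] z h])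
    moreover have "((\<lambda>\<alpha>. zpow z \<alpha> * hinner E (?\<phi> \<alpha>) h) has_sum hinner E e h) UNIV
        \<longleftrightarrow> ((\<lambda>\<alpha>. zpow z \<alpha> * hinner E (?\<phi> \<alpha>) h) has_sum hinner E e h) {\<lambda>_. 0}"
      by (rule has_sum_cong_neutral) (use h in auto)
    ultimately have "hinner E (const_fun e z) h = hinner E e h"
      using has_sum_unique by (simp add: has_sum_finite_iff)
    thus "hinner E h (const_fun e z) = hinner E h e"
      using inner_commute[OF K_eval_mem[OF mem, of z] h] inner_commute[OF e h] by simp
  qed (use e K_eval_mem[OF mem] in auto)
  show "hinner K f (const_fun e) = hinner E (f 0) e" if f: "f \<in> hcarrier K"
  proof -
    have "hinner K f (const_fun e) = (\<Sum>\<^sub>\<infinity>\<alpha>\<in>{\<lambda>_. 0}. hinner E (coeff_of E f \<alpha>) (?\<phi> \<alpha>) / of_real (w \<alpha>))"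
      unfolding K_inner L2_inner coeff
      by (rule infsum_cong_neutral) (use K_coeff_mem[OF f] in auto)
    thus ?thesis
      by (simp add: eval_zero[OF f])
  qed
qed

lemma const_fun_diagonal: "diagonal (\<lambda>f. const_fun (f 0)) (\<lambda>n. if n = 0 then 1 else 0)"
  unfolding diagonal_def
  by (auto simp: const_fun_mem coeff_const_fun K_eval_mem msize_eq_0_iff eval_zero[symmetric] scaleC_one)

text \<open>The symbol a_(n+1) / a_n of \<Delta> is the reciprocal of the factor produced by M_z and
  its adjoint. The product therefore acts as 1 on every positive degree and as 0 on the
  constants.\<close>

lemma Mz_Delta_backshift:
  assumes f: "f \<in> hcarrier K"
  shows "(\<Sum>i\<in>UNIV. Mz i (Delta a E (backshift i f))) = f - const_fun (f 0)"
proof (rule K_eqI)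
  have D: "Delta a E (backshift i f) \<in> hcarrier K" for i
    using Delta_diagonal f by (simp add: diagonal_def)
  have c: "const_fun (f 0) \<in> hcarrier K"
    by (rule const_fun_mem[OF K_eval_mem[OF f]])
  show "(\<Sum>i\<in>UNIV. Mz i (Delta a E (backshift i f))) \<in> hcarrier K"
    by (intro K.sum_mem Mz_mem D)
  show "f - const_fun (f 0) \<in> hcarrier K"
    using f c by (rule K.diff_mem)
  fix \<beta>
  show "coeff_of E (\<Sum>i\<in>UNIV. Mz i (Delta a E (backshift i f))) \<beta> = coeff_of E (f - const_fun (f 0)) \<beta>"
    unfolding coeff_Mz_diagonal_backshift[OF Delta_diagonal f] coeff_diff[OF f c] minus_apply
      coeff_const_fun[OF K_eval_mem[OF f]]
    by (cases "msize \<beta>") (auto simp: msize_eq_0_iff eval_zero[OF f] scaleC_one)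
qed

end

section \<open>Limits of diagonal operators\<close>

lemma hnorm_complex_hilbert [simp]: "hnorm complex_hilbert x = cmod x"
  by (simp add: hnorm_def complex_hilbert_def complex_mult_cnj cmod_def)

lemma hcarrier_complex_hilbert [simp]: "hcarrier complex_hilbert = UNIV"
  by (simp add: complex_hilbert_def)

lemma hilbert_complex_hilbert: "hilbert complex_hilbert"
proof
  fix X :: "nat \<Rightarrow> complex"
  assume "\<And>e. 0 < e \<Longrightarrow> \<exists>N. \<forall>m\<ge>N. \<forall>n\<ge>N. hnorm complex_hilbert (X m - X n) < e"
  hence "Cauchy X"
    by (auto simp: Cauchy_def dist_norm)
  then obtain x where "X \<longlonglongrightarrow> x"
    using Cauchy_convergent convergent_def by blast
  thus "\<exists>x\<in>hcarrier complex_hilbert. (\<lambda>n. hnorm complex_hilbert (X n - x)) \<longlonglongrightarrow> 0"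
    by (auto simp: LIM_zero_iff tendsto_norm_zero_iff intro!: exI[of _ x])
qed (auto simp: complex_hilbert_def scaleC_complex_def algebra_simps)

lemma scaleC_fun_apply: "(c *\<^sub>C f) x = c *\<^sub>C f x"
  by (simp add: scaleC_fun_def)

lemma tendsto_zero_power2D:
  assumes "((\<lambda>n. (f n)\<^sup>2) \<longlongrightarrow> (0::real)) F"
  shows "(f \<longlongrightarrow> 0) F"
  using tendsto_real_sqrt[OF assms] by (simp add: tendsto_rabs_zero_iff)

context HK_space
begin

text \<open>The right side sees f only through the norms of its coefficients, so norms in H_K(E) can
  be compared with norms in the scalar space.\<close>

lemma hnorm_sq_diagonal:
  assumes g: "g \<in> hcarrier K" and f: "f \<in> hcarrier K" and eq: "\<And>\<beta>. coeff_of E g \<beta> = l \<beta> *\<^sub>C coeff_of E f \<beta>"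
  shows "(hnorm K g)\<^sup>2 = (\<Sum>\<^sub>\<infinity>\<beta>. (cmod (l \<beta>))\<^sup>2 * ((hnorm E (coeff_of E f \<beta>))\<^sup>2 / w \<beta>))"
  using K_coeff_mem[OF f]
  by (simp add: K_norm L2_norm_sq[OF K_coeff[OF g]] eq norm_scale power_mult_distrib)

lemma hnorm_diagonal_le:
  assumes X: "diagonal X s" and s: "\<And>n. \<bar>s n\<bar> \<le> M" and f: "f \<in> hcarrier K"
  shows "hnorm K (X f) \<le> M * hnorm K f"
proof (rule power2_le_imp_le)
  have M: "M \<ge> 0"
    using s[of 0] by linarith
  let ?F = "\<lambda>\<beta>. (hnorm E (coeff_of E f \<beta>))\<^sup>2 / w \<beta>"
  have X': "X f \<in> hcarrier K" "\<And>\<beta>. coeff_of E (X f) \<beta> = of_real (s (msize \<beta>)) *\<^sub>C coeff_of E f \<beta>"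
    using X f by (auto simp: diagonal_def)
  note sq = hnorm_sq_diagonal[OF X'(1) f X'(2)]
  have le: "(cmod (of_real (s (msize \<beta>))))\<^sup>2 * ?F \<beta> \<le> M\<^sup>2 * ?F \<beta>" for \<beta>
    using power_mono[OF s, of "msize \<beta>" 2] by (intro mult_right_mono) auto
  have sum: "(\<lambda>\<beta>. M\<^sup>2 * ?F \<beta>) summable_on UNIV"
    by (rule summable_on_cmult_right[OF L2_summable[OF K_coeff[OF f]]])
  have "(hnorm K (X f))\<^sup>2 \<le> (\<Sum>\<^sub>\<infinity>\<beta>. M\<^sup>2 * ?F \<beta>)"
    unfolding sq
  proof (rule infsum_mono[OF _ sum le])
    show "(\<lambda>\<beta>. (cmod (of_real (s (msize \<beta>))))\<^sup>2 * ?F \<beta>) summable_on UNIV"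
      by (rule summable_on_comparison_test[OF sum le]) simp
  qed
  also have "\<dots> = M\<^sup>2 * (hnorm K f)\<^sup>2"
    unfolding K_norm L2_norm_sq[OF K_coeff[OF f]] by (rule infsum_cmult_right')
  finally show "(hnorm K (X f))\<^sup>2 \<le> (M * hnorm K f)\<^sup>2"
    by (simp add: power_mult_distrib)
  show "0 \<le> M * hnorm K f"
    using M f by simp
qed

text \<open>The squared norm is the tail of a summable family outside the multi-indices of degree at
  most N.\<close>

lemma truncation_tendsto_0:
  assumes f: "f \<in> hcarrier K" and X: "\<And>N. X N \<in> hcarrier K"
    and eq: "\<And>N \<beta>. coeff_of E (X N) \<beta> = (if msize \<beta> \<le> N then 0 else coeff_of E f \<beta>)"
  shows "(\<lambda>N. hnorm K (X N)) \<longlonglongrightarrow> 0"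
proof (rule tendsto_zero_power2D)
  let ?F = "\<lambda>\<beta>. (hnorm E (coeff_of E f \<beta>))\<^sup>2 / w \<beta>"
  have "(hnorm K (X N))\<^sup>2 = (\<Sum>\<^sub>\<infinity>\<beta>\<in>-{\<beta>. msize \<beta> \<le> N}. ?F \<beta>)" for N
    unfolding K_norm L2_norm_sq[OF K_coeff[OF X]] by (rule infsum_cong_neutral) (auto simp: eq)
  moreover have "(\<lambda>N. \<Sum>\<^sub>\<infinity>\<beta>\<in>-{\<beta>. msize \<beta> \<le> N}. ?F \<beta>) \<longlonglongrightarrow> 0"
    by (rule filterlim_compose[OF infsum_compl_tendsto_0[OF L2_summable[OF K_coeff[OF f]]] filterlim_msize_le])
  ultimately show "(\<lambda>N. (hnorm K (X N))\<^sup>2) \<longlonglongrightarrow> 0"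
    by simp
qed

text \<open>Coefficients depend continuously on the function, so one that is eventually constant
  keeps its value in the limit.\<close>

lemma coeff_limit_unique:
  assumes lim: "htendsto K X y sequentially" and X: "\<And>n. X n \<in> hcarrier K" and e: "e \<in> hcarrier E"
    and ev: "\<forall>\<^sub>F n in sequentially. coeff_of E (X n) \<beta> = e"
  shows "coeff_of E y \<beta> = e"
proof -
  have y: "y \<in> hcarrier K" and lim: "(\<lambda>n. hnorm K (X n - y)) \<longlonglongrightarrow> 0"
    using lim by (auto simp: htendsto_def)
  have "(\<lambda>n. w \<beta> * (hnorm K (X n - y))\<^sup>2) \<longlonglongrightarrow> w \<beta> * 0\<^sup>2"
    by (intro tendsto_intros lim)
  moreover have "\<forall>\<^sub>F n in sequentially. (hnorm E (e - coeff_of E y \<beta>))\<^sup>2 \<le> w \<beta> * (hnorm K (X n - y))\<^sup>2"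
    using ev
  proof eventually_elim
    case (elim n)
    show ?case
      using L2_coeff_le[OF K_coeff[OF K.diff_mem[OF X[of n] y]], of \<beta>]
      by (simp add: K_norm coeff_diff[OF X y] elim)
  qed
  ultimately have "(hnorm E (e - coeff_of E y \<beta>))\<^sup>2 \<le> 0"
    using tendsto_lowerbound by fastforce
  thus ?thesis
    using norm_eq_0_iff[OF diff_mem[OF e K_coeff_mem[OF y]]] by simp
qed

text \<open>The scalar by which the N-th partial sum of 1/K of M_z acts on degree m.\<close>

definition invK_symbol :: "(nat \<Rightarrow> complex) \<Rightarrow> nat \<Rightarrow> nat \<Rightarrow> complex"
  where "invK_symbol c N m = (\<Sum>n\<le>N. c n * of_real (if n \<le> m then a (m - n) / a m else 0))"

text \<open>As soon as N reaches m, the sum is the full m-th Cauchy coefficient of (1/k) k, divided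
  by a_m. The limit symbol is thus that of the projection onto the constants.\<close>

lemma invK_symbol_eventually:
  assumes "\<And>m. (\<Sum>n\<le>m. c n * of_real (a (m - n))) = (if m = 0 then 1 else 0)" and "m \<le> N"
  shows "invK_symbol c N m = (if m = 0 then 1 else 0)"
proof -
  have "invK_symbol c N m = (\<Sum>n\<le>m. c n * of_real (if n \<le> m then a (m - n) / a m else 0))"
    unfolding invK_symbol_def using assms(2) by (intro sum.mono_neutral_right) auto
  also have "\<dots> = (\<Sum>n\<le>m. c n * of_real (a (m - n))) / of_real (a m)"
    by (simp add: sum_divide_distrib)
  finally show ?thesis
    by (simp add: assms(1) a_0)
qed

lemma sigma_id_mem: "f \<in> hcarrier K \<Longrightarrow> (sigma_op K Mz ^^ n) id f \<in> hcarrier K"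
  using sigma_op_power_diagonal[OF diagonal_id, of n] by (simp add: diagonal_def)

lemma
  assumes f: "f \<in> hcarrier K"
  shows invK_partial_mem: "invK_partial c K Mz f N \<in> hcarrier K"
    and coeff_invK_partial: "coeff_of E (invK_partial c K Mz f N) \<beta> = invK_symbol c N (msize \<beta>) *\<^sub>C coeff_of E f \<beta>"
proof -
  show "invK_partial c K Mz f N \<in> hcarrier K"
    unfolding invK_partial_def by (intro K.sum_mem K.scale_mem sigma_id_mem f)
  have "coeff_of E ((sigma_op K Mz ^^ n) id f) \<beta> =
      of_real (if n \<le> msize \<beta> then a (msize \<beta> - n) / a (msize \<beta>) else 0) *\<^sub>C coeff_of E f \<beta>" for n
    using sigma_op_power_diagonal[OF diagonal_id, of n] f by (simp add: diagonal_def)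
  thus "coeff_of E (invK_partial c K Mz f N) \<beta> = invK_symbol c N (msize \<beta>) *\<^sub>C coeff_of E f \<beta>"
    unfolding invK_partial_def invK_symbol_def
    by (simp only: coeff_sum K.scale_mem sigma_id_mem[OF f] coeff_scale scaleC_fun_apply scaleC_scaleC scaleC_sum_left)
qed

text \<open>The scalar function with coefficients \<open>\<parallel>f\<^sub>\<alpha>\<parallel>\<close> reduces the convergence of
  \<open>(1/K)(M\<^sub>z)\<close> on \<open>H_K(E)\<close> to the scalar case.\<close>

lemma invK_partial_tendsto:
  assumes c: "\<And>m. (\<Sum>n\<le>m. c n * of_real (a (m - n))) = (if m = 0 then 1 else 0)"
    and scalar: "\<And>g :: complex ^ 'd \<Rightarrow> complex. g \<in> hcarrier (HK a complex_hilbert) \<Longrightarrow>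
      \<exists>y. htendsto (HK a complex_hilbert) (invK_partial c (HK a complex_hilbert) Mz g) y sequentially"
    and f: "f \<in> hcarrier K"
  shows "htendsto K (invK_partial c K Mz f) (const_fun (f 0)) sequentially"
proof -
  interpret C: hilbert complex_hilbert
    by (rule hilbert_complex_hilbert)
  interpret S: HK_space complex_hilbert a w
    by unfold_locales (use a_pos a_0 a_summable a_decrease a_increase w_eq in auto)
  define \<psi> where "\<psi> \<beta> = complex_of_real (hnorm E (coeff_of E f \<beta>))" for \<beta>
  have \<psi>: "\<psi> \<in> hcarrier S.L2"
    using L2_summable[OF K_coeff[OF f]] by (simp add: weighted_l2_mem_iff \<psi>_def)
  define g where "g = of_coeffs complex_hilbert \<psi>"
  have g: "g \<in> hcarrier S.K" and coeff_g: "coeff_of complex_hilbert g = \<psi>"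
    using \<psi> by (auto simp: g_def)
  let ?X = "invK_partial c S.K Mz g" and ?Y = "invK_partial c K Mz f"
  obtain y where y: "htendsto S.K ?X y sequentially"
    using scalar[OF g] by blast
  have y_mem: "y \<in> hcarrier S.K"
    using y by (simp add: htendsto_def)
  let ?\<delta> = "\<lambda>m. if m = 0 then 1 else 0 :: complex"
  \<comment> \<open>The hypothesis grants a limit without naming it; its coefficients are forced by
    those of the partial sums.\<close>
  have coeff_y: "coeff_of complex_hilbert y \<beta> = ?\<delta> (msize \<beta>) *\<^sub>C \<psi> \<beta>" for \<beta>
  proof (rule S.coeff_limit_unique[OF y])
    show "\<forall>\<^sub>F n in sequentially. coeff_of complex_hilbert (?X n) \<beta> = ?\<delta> (msize \<beta>) *\<^sub>C \<psi> \<beta>"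
      using eventually_ge_at_top[of "msize \<beta>"]
      by eventually_elim (simp add: S.coeff_invK_partial[OF g] coeff_g S.invK_symbol_eventually[OF c])
  qed (auto simp: S.invK_partial_mem g)
  have k: "const_fun (f 0) \<in> hcarrier K"
    by (rule const_fun_mem[OF K_eval_mem[OF f]])
  have coeff_k: "coeff_of E (const_fun (f 0)) \<beta> = ?\<delta> (msize \<beta>) *\<^sub>C coeff_of E f \<beta>" for \<beta>
    by (simp add: coeff_const_fun[OF K_eval_mem[OF f]] msize_eq_0_iff eval_zero[OF f, symmetric] scaleC_one)
  \<comment> \<open>Both errors are diagonal with the same symbol, applied to functions whose
    coefficients have equal norms.\<close>
  have "(hnorm K (?Y N - const_fun (f 0)))\<^sup>2 = (hnorm S.K (?X N - y))\<^sup>2" for N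
  proof -
    let ?l = "\<lambda>\<beta> :: 'd multiindex. invK_symbol c N (msize \<beta>) - ?\<delta> (msize \<beta>)"
    have "(hnorm K (?Y N - const_fun (f 0)))\<^sup>2 = (\<Sum>\<^sub>\<infinity>\<beta>. (cmod (?l \<beta>))\<^sup>2 * ((hnorm E (coeff_of E f \<beta>))\<^sup>2 / w \<beta>))"
      by (rule hnorm_sq_diagonal[OF K.diff_mem[OF invK_partial_mem[OF f] k] f])
        (simp only: coeff_diff[OF invK_partial_mem[OF f] k] minus_apply coeff_invK_partial[OF f] coeff_k scaleC_diff_left)
    also have "\<dots> = (\<Sum>\<^sub>\<infinity>\<beta>. (cmod (?l \<beta>))\<^sup>2 * ((hnorm complex_hilbert (coeff_of complex_hilbert g \<beta>))\<^sup>2 / w \<beta>))"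
      by (simp add: coeff_g \<psi>_def)
    also have "\<dots> = (hnorm S.K (?X N - y))\<^sup>2"
      by (rule S.hnorm_sq_diagonal[OF S.K.diff_mem[OF S.invK_partial_mem[OF g] y_mem] g, symmetric])
        (simp only: S.coeff_diff[OF S.invK_partial_mem[OF g] y_mem] minus_apply S.coeff_invK_partial[OF g]
          coeff_y coeff_g scaleC_diff_left)
    finally show ?thesis .
  qed
  moreover have "(\<lambda>N. (hnorm S.K (?X N - y))\<^sup>2) \<longlonglongrightarrow> 0\<^sup>2"
    using y by (intro tendsto_power) (simp add: htendsto_def)
  ultimately have "(\<lambda>N. (hnorm K (?Y N - const_fun (f 0)))\<^sup>2) \<longlonglongrightarrow> 0"
    by simp
  hence "(\<lambda>N. hnorm K (?Y N - const_fun (f 0))) \<longlonglongrightarrow> 0"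
    by (rule tendsto_zero_power2D)
  thus ?thesis
    using k by (simp add: htendsto_def)
qed

section \<open>Norm estimates for \<open>F(ZT\<^sup>*)\<close>\<close>

abbreviation backpow :: "'d multiindex \<Rightarrow> (complex ^ 'd \<Rightarrow> 'e) \<Rightarrow> complex ^ 'd \<Rightarrow> 'e"
  where "backpow \<equiv> tpow backshift"

lemma
  assumes f: "f \<in> hcarrier K"
  shows backpow_mem [simp]: "backpow \<alpha> f \<in> hcarrier K"
    and coeff_backpow: "coeff_of E (backpow \<alpha> f) \<beta> = of_real (w \<beta> / w (\<beta> + \<alpha>)) *\<^sub>C coeff_of E f (\<beta> + \<alpha>)"
  by (rule tpow_backshift[where V = "hcarrier K", OF backshift_mem refl order_refl f]; assumption)+

text \<open>\<open>tpow\<close> gives no control over where a new factor is inserted; comparing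
  coefficients shows that it may be applied innermost.\<close>

lemma backpow_add_unit:
  assumes f: "f \<in> hcarrier K"
  shows "backpow (\<alpha> + unit_index i) f = backpow \<alpha> (backshift i f)"
proof (rule K_eqI)
  fix \<beta>
  have "\<beta> + (\<alpha> + unit_index i) = \<beta> + \<alpha> + unit_index i"
    by (simp add: add_ac)
  thus "coeff_of E (backpow (\<alpha> + unit_index i) f) \<beta> = coeff_of E (backpow \<alpha> (backshift i f)) \<beta>"
    using f by (simp only: coeff_backpow backshift_mem coeff_backshift scaleC_scaleC) simp
qed (use f in auto)

text \<open>This is \<open>\<sigma>\<^sup>n(1) = \<Sum> \<gamma>\<^sub>\<alpha>
  M\<^sub>z\<^sup>\<alpha> M\<^sub>z\<^sup>*\<^sup>\<alpha>\<close>, over |\<alpha>| = n, read as a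
  quadratic form. The Pascal rule for \<gamma> strips off one adjoint factor in each induction
  step.\<close>

lemma sum_norm_backpow:
  assumes "f \<in> hcarrier K"
  shows "(\<Sum>\<alpha> | msize \<alpha> = n. mgamma \<alpha> * (hnorm K (backpow \<alpha> f))\<^sup>2) = Re (hinner K f ((sigma_op K Mz ^^ n) id f))"
  using assms
proof (induction n arbitrary: f)
  case 0
  have "{\<alpha> :: 'd multiindex. msize \<alpha> = 0} = {\<lambda>_. 0}"
    by (auto simp: msize_eq_0_iff)
  moreover have "backpow (\<lambda>_. 0) f = f"
  proof (rule K_eqI)
    have "\<beta> + (\<lambda>_. 0) = \<beta>" for \<beta> :: "'d multiindex"
      by (simp add: fun_eq_iff)
    thus "coeff_of E (backpow (\<lambda>_. 0) f) \<beta> = coeff_of E f \<beta>" for \<beta>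
      using 0 by (simp add: coeff_backpow scaleC_one)
  qed (use 0 in auto)
  ultimately show ?case
    using 0 by (simp add: K.norm_sq)
next
  case (Suc n)
  note f = Suc.prems
  let ?S = "(sigma_op K Mz ^^ n) id"
  have m: "?S (backshift i f) \<in> hcarrier K" for i
    by (rule sigma_id_mem[OF backshift_mem[OF f]])
  have "(\<Sum>\<alpha> | msize \<alpha> = Suc n. mgamma \<alpha> * (hnorm K (backpow \<alpha> f))\<^sup>2) =
      (\<Sum>i\<in>UNIV. Re (hinner K (backshift i f) (?S (backshift i f))))"
    unfolding sum_mgamma_Suc_real backpow_add_unit[OF f] by (simp only: Suc.IH[OF backshift_mem[OF f]])
  also have "\<dots> = (\<Sum>i\<in>UNIV. Re (hinner K f (Mz i (?S (backshift i f)))))"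
  proof (rule sum.cong)
    fix i
    have "hinner K (Mz i (?S (backshift i f))) f = hinner K (?S (backshift i f)) (backshift i f)"
      by (rule inner_Mz_backshift[OF f m])
    thus "Re (hinner K (backshift i f) (?S (backshift i f))) = Re (hinner K f (Mz i (?S (backshift i f))))"
      using K.inner_commute[OF Mz_mem[OF m[of i], of i] f] K.inner_commute[OF m[of i] backshift_mem[OF f, of i]] by simp
  qed simp
  also have "\<dots> = Re (hinner K f (\<Sum>i\<in>UNIV. Mz i (?S (backshift i f))))"
    using f m by (simp add: K.inner_sum_right)
  also have "(\<Sum>i\<in>UNIV. Mz i (?S (backshift i f))) = (sigma_op K Mz ^^ Suc n) id f"
    using f by (simp add: sigma_op_def adj_tuple_Mz)
  finally show ?case .
qed

text \<open>Cauchy-Schwarz with \<gamma> split evenly between scalars and vectors: the scalars give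
  |z|^(2n), the vectors <f, sigma^n(1) f>, and S bounds the symbol a_(m-n) / a_m of
  sigma^n(1).\<close>

lemma F_term_bound:
  assumes f: "f \<in> hcarrier K" and S: "\<And>m. a m \<le> S * a (m + n)"
  shows "hnorm K (\<Sum>\<alpha> | msize \<alpha> = n. (of_real (mgamma \<alpha>) * zpow z \<alpha>) *\<^sub>C backpow \<alpha> f) \<le> norm z ^ n * sqrt S * hnorm K f"
proof -
  have S0: "S \<ge> 0"
    using S[of 0] a_pos[of 0] a_pos[of n] by (metis add_0 less_le_trans zero_less_mult_pos2 less_imp_le)
  let ?A = "{\<alpha> :: 'd multiindex. msize \<alpha> = n}"
  have g: "0 \<le> mgamma \<alpha>" for \<alpha> :: "'d multiindex"
    by (rule less_imp_le[OF mgamma_pos])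
  have nn: "0 \<le> norm z ^ n * sqrt S * hnorm K f"
    using S0 f by simp
  have "hnorm K (\<Sum>\<alpha>\<in>?A. (of_real (mgamma \<alpha>) * zpow z \<alpha>) *\<^sub>C backpow \<alpha> f) \<le>
      (\<Sum>\<alpha>\<in>?A. hnorm K ((of_real (mgamma \<alpha>) * zpow z \<alpha>) *\<^sub>C backpow \<alpha> f))"
    using f by (intro K.norm_sum K.scale_mem backpow_mem)
  also have "\<dots> = (\<Sum>\<alpha>\<in>?A. (sqrt (mgamma \<alpha>) * cmod (zpow z \<alpha>)) * (sqrt (mgamma \<alpha>) * hnorm K (backpow \<alpha> f)))"
  proof (rule sum.cong)
    fix \<alpha> :: "'d multiindex"
    have "mgamma \<alpha> = sqrt (mgamma \<alpha>) * sqrt (mgamma \<alpha>)"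
      using g[of \<alpha>] by simp
    thus "hnorm K ((of_real (mgamma \<alpha>) * zpow z \<alpha>) *\<^sub>C backpow \<alpha> f) =
        (sqrt (mgamma \<alpha>) * cmod (zpow z \<alpha>)) * (sqrt (mgamma \<alpha>) * hnorm K (backpow \<alpha> f))"
      using f g[of \<alpha>] by (simp add: K.norm_scale norm_mult)
  qed simp
  also have "\<dots> \<le> norm z ^ n * sqrt S * hnorm K f"
  proof (rule power2_le_imp_le[OF _ nn])
    have "(\<Sum>\<alpha>\<in>?A. (sqrt (mgamma \<alpha>) * cmod (zpow z \<alpha>)) * (sqrt (mgamma \<alpha>) * hnorm K (backpow \<alpha> f)))\<^sup>2 \<le>
        (\<Sum>\<alpha>\<in>?A. (sqrt (mgamma \<alpha>) * cmod (zpow z \<alpha>))\<^sup>2) * (\<Sum>\<alpha>\<in>?A. (sqrt (mgamma \<alpha>) * hnorm K (backpow \<alpha> f))\<^sup>2)"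
      by (rule Cauchy_Schwarz_ineq_sum)
    also have "\<dots> = norm z ^ (2 * n) * Re (hinner K f ((sigma_op K Mz ^^ n) id f))"
      using g by (simp add: power_mult_distrib sum_mgamma_zpow sum_norm_backpow[OF f])
    also have "\<dots> \<le> norm z ^ (2 * n) * (S * (hnorm K f)\<^sup>2)"
    proof (rule mult_left_mono)
      have "Re (hinner K f ((sigma_op K Mz ^^ n) id f)) \<le> cmod (hinner K f ((sigma_op K Mz ^^ n) id f))"
        by (rule complex_Re_le_cmod)
      also have "\<dots> \<le> hnorm K f * hnorm K ((sigma_op K Mz ^^ n) id f)"
        by (rule K.cauchy_schwarz[OF f sigma_id_mem[OF f]])
      also have "hnorm K ((sigma_op K Mz ^^ n) id f) \<le> S * hnorm K f"
      proof (rule hnorm_diagonal_le[OF sigma_op_power_diagonal[OF diagonal_id] _ f])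
        fix m
        show "\<bar>if n \<le> m then 1 * (a (m - n) / a m) else 0\<bar> \<le> S"
          using S[of "m - n"] S0 a_pos[of m] by (auto simp: field_simps)
      qed
      finally show "Re (hinner K f ((sigma_op K Mz ^^ n) id f)) \<le> S * (hnorm K f)\<^sup>2"
        using f by (simp add: power2_eq_square mult_left_mono mult.left_commute)
    qed simp
    also have "\<dots> = (norm z ^ n * sqrt S * hnorm K f)\<^sup>2"
      using S0 by (simp add: power_mult_distrib power_mult power2_eq_square mult.commute)
    finally show "(\<Sum>\<alpha>\<in>?A. (sqrt (mgamma \<alpha>) * cmod (zpow z \<alpha>)) * (sqrt (mgamma \<alpha>) * hnorm K (backpow \<alpha> f)))\<^sup>2
        \<le> (norm z ^ n * sqrt S * hnorm K f)\<^sup>2" .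
  qed
  finally show ?thesis .
qed

end

text \<open>With \<open>R\<close> slightly larger than \<open>r\<close> one has \<open>a\<^sub>m \<le> C R\<^sup>n a\<^bsub>m+n\<^esub>\<close>, and
  \<open>t \<surd>R < r\<close> because \<open>r \<ge> 1\<close>.\<close>

lemma weight_growth:
  fixes a :: "nat \<Rightarrow> real"
  assumes a: "\<And>n. 0 < a n" and M: "\<And>n. a n \<le> M * a (Suc n)"
    and lim: "(\<lambda>n. a n / a (Suc n)) \<longlonglongrightarrow> r" and r: "r \<ge> 1" and t: "0 \<le> t" "t < 1"
  obtains S where "\<And>m n. a m \<le> S n * a (m + n)" "\<And>n. 0 \<le> S n"
    "summable (\<lambda>n. a (Suc n) * (t ^ n * sqrt (S n)))"
proof -
  \<comment> \<open>The midpoint of t and 1: still below 1, and positive even for t = 0, so that its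
    square may be divided by.\<close>
  define s where "s = (1 + t) / 2"
  have s: "0 < s" "s < 1" "t \<le> s"
    using t by (auto simp: s_def)
  have s2: "s\<^sup>2 < 1"
    using s by (simp add: power_less_one_iff)
  \<comment> \<open>The midpoint of r and r / s^2: larger than r, while s^2 R stays below r.\<close>
  define R where "R = r * (1 + 1 / s\<^sup>2) / 2"
  have R: "R > r"
  proof -
    have "1 < 1 / s\<^sup>2"
      using s s2 by simp
    hence "r * 1 < r * ((1 + 1 / s\<^sup>2) / 2)"
      using r by (intro mult_strict_left_mono) auto
    thus ?thesis
      by (simp add: R_def)
  qed
  have R0: "R > 0"
    using R r by linarith
  have sR: "s\<^sup>2 * R < r"
  proof -
    have "s\<^sup>2 * R = r * ((s\<^sup>2 + 1) / 2)"
      using s by (simp add: R_def field_simps)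
    also have "\<dots> < r * 1"
      using r s2 by (intro mult_strict_left_mono) auto
    finally show ?thesis by simp
  qed
  define u where "u = s * sqrt R"
  have u0: "u > 0"
    using s R0 by (simp add: u_def)
  have "u\<^sup>2 < r\<^sup>2"
    using sR s R0 r by (simp add: u_def power_mult_distrib) (metis dual_order.strict_trans1 mult_left_mono mult_1_right power2_eq_square order_trans zero_le_one)
  hence u: "u < r"
    using r by (intro power2_less_imp_less[of u r]) auto
  obtain m0 where m0: "\<And>m. m \<ge> m0 \<Longrightarrow> a m / a (Suc m) < R"
    using order_tendstoD(2)[OF lim R] by (auto simp: eventually_sequentially)
  \<comment> \<open>Below m0 the ratios are only known to be at most M; taking the maximum with R
    makes q = M' / R at least 1.\<close>
  define M' where "M' = max M R"
  have M': "M' \<ge> R" "M' \<ge> M" "M' > 0"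
    using R0 by (auto simp: M'_def)
  have step: "a m \<le> (if m < m0 then M' else R) * a (Suc m)" for m
  proof (cases "m < m0")
    case True
    have "M * a (Suc m) \<le> M' * a (Suc m)"
      using M' a[of "Suc m"] by (intro mult_right_mono) auto
    thus ?thesis
      using True M[of m] by simp
  next
    case False
    thus ?thesis
      using m0[of m] a[of "Suc m"] by (simp add: field_simps)
  qed
  define q where "q = M' / R"
  have q: "q \<ge> 1" "M' = q * R"
    using M' R0 by (auto simp: q_def)
  \<comment> \<open>The truncated difference m0 - m bounds the number of steps from m upwards that
    start below m0; each of them costs a factor q on top of R. Bounding it in turn by m0 gives S n,
    uniform in m.\<close>
  have bound: "a m \<le> q ^ (m0 - m) * R ^ n * a (m + n)" for m n
  proof (induction n arbitrary: m)
    case 0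
    show ?case
      using q a[of m] by simp
  next
    case (Suc n)
    have "a m \<le> (if m < m0 then M' else R) * a (Suc m)"
      by (rule step)
    also have "\<dots> \<le> (if m < m0 then M' else R) * (q ^ (m0 - Suc m) * R ^ n * a (Suc m + n))"
      using Suc.IH[of "Suc m"] M' R0 by (intro mult_left_mono) auto
    also have "\<dots> = q ^ (m0 - m) * R ^ Suc n * a (m + Suc n)"
    proof (cases "m < m0")
      case True
      hence "m0 - m = Suc (m0 - Suc m)"
        by simp
      thus ?thesis
        using True by (simp add: q(2))
    qed simp
    finally show ?case .
  qed
  define S where "S n = q ^ m0 * R ^ n" for n
  have S: "a m \<le> S n * a (m + n)" for m n
  proof -
    have "q ^ (m0 - m) \<le> q ^ m0"
      using q by (intro power_increasing) auto
    hence "q ^ (m0 - m) * (R ^ n * a (m + n)) \<le> q ^ m0 * (R ^ n * a (m + n))"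
      using R0 a[of "m + n"] by (intro mult_right_mono) auto
    thus ?thesis
      using bound[of m n] by (simp add: S_def mult.assoc)
  qed
  have S0: "0 \<le> S n" for n
    using q R0 by (simp add: S_def)
  have summ: "summable (\<lambda>n. a (Suc n) * u ^ n)"
  proof -
    \<comment> \<open>A value strictly between u and r: it leaves room for the ratio test, with
      quotient u / v.\<close>
    define v where "v = (u + r) / 2"
    have v: "u < v" "v < r" "v > 0"
      using u u0 by (auto simp: v_def)
    obtain N where N: "\<And>n. n \<ge> N \<Longrightarrow> v < a n / a (Suc n)"
      using order_tendstoD(1)[OF lim v(2)] by (auto simp: eventually_sequentially)
    show ?thesis
    proof (rule summable_ratio_test[of "u / v" N])
      show "u / v < 1"
        using v u0 by simp
      fix n assume n: "n \<ge> N"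
      have "v * a (Suc (Suc n)) \<le> a (Suc n)"
        using N[of "Suc n"] n a[of "Suc (Suc n)"] by (simp add: field_simps)
      hence "a (Suc (Suc n)) \<le> a (Suc n) / v"
        using v by (simp add: field_simps)
      hence "a (Suc (Suc n)) * (u * u ^ n) \<le> a (Suc n) / v * (u * u ^ n)"
        using u0 by (intro mult_right_mono) auto
      thus "norm (a (Suc (Suc n)) * u ^ Suc n) \<le> u / v * norm (a (Suc n) * u ^ n)"
        using u0 a[of "Suc n"] a[of "Suc (Suc n)"] by (simp add: abs_mult mult_ac)
    qed
  qed
  have "summable (\<lambda>n. sqrt (q ^ m0) * (a (Suc n) * u ^ n))"
    using summ by (rule summable_mult)
  hence "summable (\<lambda>n. a (Suc n) * (t ^ n * sqrt (S n)))"
  proof (rule summable_comparison_test')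
    fix n :: nat
    have "t ^ n * sqrt (S n) \<le> s ^ n * sqrt (S n)"
      using s t S0 by (intro mult_right_mono power_mono) auto
    also have "\<dots> = sqrt (q ^ m0) * u ^ n"
      by (simp add: S_def u_def real_sqrt_mult real_sqrt_power power_mult_distrib)
    finally have "a (Suc n) * (t ^ n * sqrt (S n)) \<le> a (Suc n) * (sqrt (q ^ m0) * u ^ n)"
      using a[of "Suc n"] by (intro mult_left_mono) auto
    thus "norm (a (Suc n) * (t ^ n * sqrt (S n))) \<le> sqrt (q ^ m0) * (a (Suc n) * u ^ n)"
      using a[of "Suc n"] t S0[of n] by (simp add: abs_mult mult_ac)
  qed
  with S S0 show ?thesis
    using that by blast
qed

section \<open>The model space\<close>

text \<open>\<open>reciprocal\<close> expresses k times 1/k = 1 on coefficients, and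
  \<open>scalar\<close> is the strong convergence of 1/K of M_z on the scalar space, from which the
  convergence on H_K(E) is derived.\<close>

locale K_inner_model = HK_space E a w + Estar: hilbert Estar
  for E :: "'e::complex_vector hilbert" and a :: "nat \<Rightarrow> real" and w :: "'d::finite multiindex \<Rightarrow> real"
    and Estar :: "'f::complex_vector hilbert" +
  fixes c :: "nat \<Rightarrow> complex" and W :: "complex ^ 'd \<Rightarrow> 'f \<Rightarrow> 'e" and r :: real
  assumes reciprocal: "\<And>m. (\<Sum>n\<le>m. c n * of_real (a (m - n))) = (if m = 0 then 1 else 0)"
    and ratio: "(\<lambda>n. a n / a (Suc n)) \<longlonglongrightarrow> r" "r \<ge> 1"
    and scalar: "\<And>g :: complex ^ 'd \<Rightarrow> complex. g \<in> hcarrier (HK a complex_hilbert) \<Longrightarrow>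
      \<exists>y. htendsto (HK a complex_hilbert) (invK_partial c (HK a complex_hilbert) Mz g) y sequentially"
    and inner: "K_inner a Estar E W"
begin

section \<open>The isometry induced by W\<close>

definition G :: "'f \<Rightarrow> complex ^ 'd \<Rightarrow> 'e"
  where "G x = ball_fun (\<lambda>z. W z x)"

lemma W_bounded: "z \<in> ball 0 1 \<Longrightarrow> bounded_op Estar E (W z)"
  using inner by (simp add: K_inner_def op_analytic_def)

lemma G_eval: "z \<in> ball 0 1 \<Longrightarrow> G x z = W z x"
  by (simp add: G_def ball_fun_def)

lemma G_mem [simp]: "x \<in> hcarrier Estar \<Longrightarrow> G x \<in> hcarrier K"
  and G_norm: "x \<in> hcarrier Estar \<Longrightarrow> hnorm K (G x) = hnorm Estar x"
  and G_wandering: "\<lbrakk>\<alpha> \<noteq> (\<lambda>_. 0); x \<in> hcarrier Estar; y \<in> hcarrier Estar\<rbrakk> \<Longrightarrow>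
    hinner K (G x) (tpow Mz \<alpha> (G y)) = 0"
  using inner by (simp_all add: K_inner_def G_def)

lemma G_add: "\<lbrakk>x \<in> hcarrier Estar; y \<in> hcarrier Estar\<rbrakk> \<Longrightarrow> G (x + y) = G x + G y"
  using bounded_op_add[OF W_bounded] by (auto simp: G_def ball_fun_def fun_eq_iff)

lemma G_scale: "x \<in> hcarrier Estar \<Longrightarrow> G (b *\<^sub>C x) = b *\<^sub>C G x"
  using bounded_op_scale[OF W_bounded] by (auto simp: G_def ball_fun_def fun_eq_iff scaleC_fun_def)

text \<open>Equality of norms is equality of the two forms on the diagonal, hence everywhere by
  polarization.\<close>

lemma G_inner:
  assumes "x \<in> hcarrier Estar" "y \<in> hcarrier Estar"
  shows "hinner K (G x) (G y) = hinner Estar x y"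
proof -
  have "hinner K (G x) (G y) - hinner Estar x y = 0"
    by (rule Estar.sesquilinear_eq_0[where A = "\<lambda>x y. hinner K (G x) (G y) - hinner Estar x y", OF _ _ _ _ _ assms])
      (auto simp: G_add G_scale K.inner_add_left K.inner_add_right K.inner_scale_left K.inner_scale_right
        Estar.inner_add_left Estar.inner_add_right Estar.inner_scale_left Estar.inner_scale_right
        algebra_simps K.inner_self Estar.inner_self G_norm)
  thus ?thesis by simp
qed

lemma G_bounded: "bounded_op Estar K G"
  by (rule bounded_opI[where M = 1]) (auto simp: G_add G_scale G_norm)

text \<open>Orthogonality to the generators already gives orthogonality to the closed invariant
  subspace they span, so that subspace is never formed. The inner product is inherited from H_K(E),
  which makes the inclusion isometric.\<close>

definition H :: "(complex ^ 'd \<Rightarrow> 'e) hilbert"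
  where "H = \<lparr>hcarrier = {f \<in> hcarrier K. \<forall>\<alpha>. \<forall>y\<in>hcarrier Estar. hinner K f (tpow Mz \<alpha> (G y)) = 0},
              hinner = hinner K\<rparr>"

lemma H_inner [simp]: "hinner H = hinner K"
  by (simp add: H_def)

lemma H_norm [simp]: "hnorm H = hnorm K"
  by (rule hnorm_cong) simp

lemma H_mem_iff: "f \<in> hcarrier H \<longleftrightarrow>
    f \<in> hcarrier K \<and> (\<forall>\<alpha>. \<forall>y\<in>hcarrier Estar. hinner K f (tpow Mz \<alpha> (G y)) = 0)"
  by (simp add: H_def)

lemma H_sub [simp]: "f \<in> hcarrier H \<Longrightarrow> f \<in> hcarrier K"
  by (simp add: H_mem_iff)

lemma tpow_G_mem [simp]: "y \<in> hcarrier Estar \<Longrightarrow> tpow Mz \<alpha> (G y) \<in> hcarrier K"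
  by (rule tpow_Mz_mem[OF G_mem])

lemma H_hilbert: "hilbert H"
proof (rule closed_subspace_hilbert[OF K_hilbert])
  fix X f assume X: "\<And>n. X n \<in> hcarrier H" and lim: "htendsto K X f sequentially"
  have "hinner K f (tpow Mz \<alpha> (G y)) = 0" if y: "y \<in> hcarrier Estar" for \<alpha> y
  proof -
    have "(\<lambda>n. hinner K (X n) (tpow Mz \<alpha> (G y))) \<longlonglongrightarrow> hinner K f (tpow Mz \<alpha> (G y))"
      by (rule K.tendsto_inner_left[OF lim]) (use X y in auto)
    thus ?thesis
      using X y by (simp add: H_mem_iff LIMSEQ_const_iff)
  qed
  thus "f \<in> hcarrier H"
    using lim by (simp add: H_mem_iff htendsto_def)
qed (auto simp: H_mem_iff K.inner_add_left K.inner_scale_left)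

sublocale H: hilbert H
  by (rule H_hilbert)

lemma inclusion_bounded: "bounded_op H K id"
  by (rule bounded_opI[where M = 1]) auto

text \<open>The orthogonal projection onto H, obtained as the adjoint of the inclusion; its
  existence thus rests on Riesz representation in H.\<close>

definition P :: "(complex ^ 'd \<Rightarrow> 'e) \<Rightarrow> complex ^ 'd \<Rightarrow> 'e"
  where "P = hadjoint H K id"

lemma P_mem [simp]: "f \<in> hcarrier K \<Longrightarrow> P f \<in> hcarrier H"
  unfolding P_def by (rule hadjoint_mem[OF H_hilbert K.inner_space_axioms inclusion_bounded])

lemma P_inner_right: "\<lbrakk>f \<in> hcarrier K; h \<in> hcarrier H\<rbrakk> \<Longrightarrow> hinner K h (P f) = hinner K h f"
  using hadjoint_inner[OF H_hilbert K.inner_space_axioms inclusion_bounded, of f h] by (simp add: P_def)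

lemma P_inner_left: "\<lbrakk>f \<in> hcarrier K; h \<in> hcarrier H\<rbrakk> \<Longrightarrow> hinner K (P f) h = hinner K f h"
  using P_inner_right[of f h] K.inner_commute[of h "P f"] K.inner_commute[of h f] by simp

lemma P_bounded: "bounded_op K H P"
  unfolding P_def by (rule bounded_op_hadjoint[OF H_hilbert K.inner_space_axioms inclusion_bounded])

lemma P_eqI:
  assumes "f \<in> hcarrier K" "g \<in> hcarrier K" "\<And>h. h \<in> hcarrier H \<Longrightarrow> hinner K h f = hinner K h g"
  shows "P f = P g"
  by (rule H.eqI_inner) (use assms in \<open>auto simp: P_inner_right\<close>)

lemma P_id: "h \<in> hcarrier H \<Longrightarrow> P h = h"
  by (rule H.eqI_inner) (auto simp: P_inner_right)

lemma P_norm_le: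
  assumes f: "f \<in> hcarrier K"
  shows "hnorm K (P f) \<le> hnorm K f"
proof (rule H.norm_le_inner_bound[of "P f" "hnorm K f", simplified])
  fix h assume h: "h \<in> hcarrier H"
  thus "cmod (hinner K h (P f)) \<le> hnorm K f * hnorm K h"
    using K.cauchy_schwarz[of h f] f by (simp add: P_inner_right mult.commute)
qed (use f in auto)

text \<open>The orthogonal complement of an invariant subspace is invariant under the adjoints: in
  the pairing the operator becomes one more factor M_z on the generator.\<close>

lemma backshift_H [simp]:
  assumes h: "h \<in> hcarrier H"
  shows "backshift i h \<in> hcarrier H"
  unfolding H_mem_iff
proof (intro conjI allI ballI)
  fix \<alpha> y assume y: "y \<in> hcarrier Estar"
  have "hinner K (tpow Mz \<alpha> (G y)) (backshift i h) = hinner K (tpow Mz (\<alpha> + unit_index i) (G y)) h"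
    using inner_Mz_backshift[of h "tpow Mz \<alpha> (G y)" i] h y by (simp add: Mz_tpow)
  moreover have "hinner K h (tpow Mz (\<alpha> + unit_index i) (G y)) = 0"
    using h y by (simp add: H_mem_iff)
  ultimately show "hinner K (backshift i h) (tpow Mz \<alpha> (G y)) = 0"
    using K.inner_commute[of "tpow Mz \<alpha> (G y)" "backshift i h"]
      K.inner_commute[of h "tpow Mz (\<alpha> + unit_index i) (G y)"] h y by simp
qed (use h in simp)

text \<open>In the pairing the index becomes \<alpha> + e_i, which is never zero, so the wandering
  condition applies for every \<alpha>, including \<alpha> = 0.\<close>

lemma backshift_G [simp]:
  assumes x: "x \<in> hcarrier Estar"
  shows "backshift i (G x) \<in> hcarrier H"
  unfolding H_mem_iff
proof (intro conjI allI ballI)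
  fix \<alpha> y assume y: "y \<in> hcarrier Estar"
  have "hinner K (tpow Mz \<alpha> (G y)) (backshift i (G x)) = hinner K (tpow Mz (\<alpha> + unit_index i) (G y)) (G x)"
    using inner_Mz_backshift[of "G x" "tpow Mz \<alpha> (G y)" i] x y by (simp add: Mz_tpow)
  moreover have "hinner K (G x) (tpow Mz (\<alpha> + unit_index i) (G y)) = 0"
  proof (rule G_wandering[OF _ x y])
    show "\<alpha> + unit_index i \<noteq> (\<lambda>_. 0)"
      using msize_eq_0_iff[of "\<alpha> + unit_index i"] by simp
  qed
  ultimately show "hinner K (backshift i (G x)) (tpow Mz \<alpha> (G y)) = 0"
    using K.inner_commute[of "tpow Mz \<alpha> (G y)" "backshift i (G x)"]
      K.inner_commute[of "G x" "tpow Mz (\<alpha> + unit_index i) (G y)"] x y by simp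
qed (use x in simp)

lemma G_orthogonal:
  assumes h: "h \<in> hcarrier H" and y: "y \<in> hcarrier Estar"
  shows "hinner K (G y) h = 0"
proof -
  have "tpow Mz (\<lambda>_. 0) (G y) = G y"
    using y by (simp add: tpow_Mz scaleC_one)
  moreover have "hinner K h (tpow Mz (\<lambda>_. 0) (G y)) = 0"
    using h y by (simp add: H_mem_iff)
  ultimately show ?thesis
    using K.inner_commute[of h "G y"] h y by simp
qed

section \<open>The compressed tuple: 1/K of T and purity\<close>

definition T :: "'d \<Rightarrow> (complex ^ 'd \<Rightarrow> 'e) \<Rightarrow> complex ^ 'd \<Rightarrow> 'e"
  where "T i h = P (Mz i h)"

lemma adj_tuple_T: "h \<in> hcarrier H \<Longrightarrow> adj_tuple H T i h = backshift i h"
  unfolding adj_tuple_def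
  by (rule hadjoint_eqI[OF H.inner_space_axioms]) (auto simp: T_def P_inner_left inner_Mz_backshift)

text \<open>H is invariant under the adjoints, so M_z maps the complement of H into itself and P
  annihilates the contribution of g - P g. Hence P intertwines M_z with T.\<close>

lemma P_Mz_P:
  assumes g: "g \<in> hcarrier K"
  shows "P (Mz i (P g)) = P (Mz i g)"
proof (rule P_eqI)
  fix h assume h: "h \<in> hcarrier H"
  have "hinner K (Mz i (P g)) h = hinner K (Mz i g) h"
    using g h by (simp add: inner_Mz_backshift P_inner_left)
  thus "hinner K h (Mz i (P g)) = hinner K h (Mz i g)"
    using K.inner_commute[of "Mz i (P g)" h] K.inner_commute[of "Mz i g" h] g h by simp
qed (use g in auto)

lemma bounded_op_T: "bounded_op H H (T i)"
proof -
  have "bounded_op H K (\<lambda>h. Mz i (id h))"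
    by (rule bounded_op_compose[OF inclusion_bounded bounded_op_Mz H.inner_space_axioms K.inner_space_axioms])
  hence "bounded_op H H (\<lambda>h. P (Mz i (id h)))"
    by (rule bounded_op_compose[OF _ P_bounded H.inner_space_axioms K.inner_space_axioms])
  thus ?thesis
    by (simp add: T_def[abs_def])
qed

lemma commuting_T: "commuting_tuple H T"
  unfolding commuting_tuple_def
proof (intro conjI allI ballI)
  fix i j x assume x: "x \<in> hcarrier H"
  have "Mz i (Mz j x) = Mz j (Mz i x)"
    by (simp add: Mz_def scaleC_scaleC mult.commute)
  thus "T i (T j x) = T j (T i x)"
    using x by (simp add: T_def P_Mz_P)
qed (rule bounded_op_T)

text \<open>The adjoints of T are restrictions of those of M_z, and T absorbs the projection inside;
  only the outer P survives.\<close>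

lemma sigma_op_T:
  assumes X: "diagonal X s" and X': "\<And>h. h \<in> hcarrier H \<Longrightarrow> X' h = P (X h)" and h: "h \<in> hcarrier H"
  shows "sigma_op H T X' h = P (sigma_op K Mz X h)"
proof -
  have m: "X (backshift i h) \<in> hcarrier K" for i
    using X h by (simp add: diagonal_def)
  have "sigma_op H T X' h = (\<Sum>i\<in>UNIV. P (Mz i (X (backshift i h))))"
    using h m by (simp add: sigma_op_def adj_tuple_T X' T_def P_Mz_P)
  also have "\<dots> = P (\<Sum>i\<in>UNIV. Mz i (X (backshift i h)))"
    using m by (intro bounded_op_sum[OF P_bounded K.inner_space_axioms, symmetric]) simp
  also have "(\<Sum>i\<in>UNIV. Mz i (X (backshift i h))) = sigma_op K Mz X h"
    using h by (simp add: sigma_op_def adj_tuple_Mz)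
  finally show ?thesis .
qed

lemma sigma_op_T_power:
  assumes X: "diagonal X s" and X': "\<And>h. h \<in> hcarrier H \<Longrightarrow> X' h = P (X h)" and h: "h \<in> hcarrier H"
  shows "(sigma_op H T ^^ n) X' h = P ((sigma_op K Mz ^^ n) X h)"
  using h
proof (induction n arbitrary: h)
  case (Suc n)
  show ?case
    using sigma_op_T[OF sigma_op_power_diagonal[OF X] Suc.IH Suc.prems] by simp
qed (simp add: X')

lemma invK_partial_T:
  assumes h: "h \<in> hcarrier H"
  shows "invK_partial c H T h N = P (invK_partial c K Mz h N)"
proof -
  have "(sigma_op H T ^^ n) id h = P ((sigma_op K Mz ^^ n) id h)" for n
    by (rule sigma_op_T_power[OF diagonal_id _ h]) (simp add: P_id)
  hence "invK_partial c H T h N = (\<Sum>n\<le>N. P (c n *\<^sub>C (sigma_op K Mz ^^ n) id h))"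
    using h by (simp add: invK_partial_def bounded_op_scale[OF P_bounded] sigma_id_mem)
  also have "\<dots> = P (invK_partial c K Mz h N)"
    unfolding invK_partial_def using h
    by (intro bounded_op_sum[OF P_bounded K.inner_space_axioms, symmetric] K.scale_mem sigma_id_mem) simp
  finally show ?thesis .
qed

lemma const_eval_mem: "f \<in> hcarrier K \<Longrightarrow> const_fun (f 0) \<in> hcarrier K"
  by (rule const_fun_mem[OF K_eval_mem])

lemma invK_partial_T_tendsto:
  assumes h: "h \<in> hcarrier H"
  shows "htendsto H (invK_partial c H T h) (P (const_fun (h 0))) sequentially"
proof -
  have "htendsto H (\<lambda>N. P (invK_partial c K Mz h N)) (P (const_fun (h 0))) sequentially"
    by (rule bounded_op_htendsto[OF P_bounded K.inner_space_axioms H.inner_space_axioms])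
      (use h invK_partial_mem invK_partial_tendsto[OF reciprocal scalar] in auto)
  moreover have "invK_partial c H T h = (\<lambda>N. P (invK_partial c K Mz h N))"
    using invK_partial_T[OF h] by auto
  ultimately show ?thesis
    by simp
qed

lemma invK_T:
  assumes h: "h \<in> hcarrier H"
  shows "invK c H T h = P (const_fun (h 0))"
  unfolding invK_def
  by (rule H.hlim_eqI[OF _ invK_partial_T_tendsto[OF h]])
    (use h in \<open>auto simp: invK_partial_T invK_partial_mem\<close>)

definition C :: "(complex ^ 'd \<Rightarrow> 'e) \<Rightarrow> 'e"
  where "C h = h 0"

lemma C_norm_le:
  assumes f: "f \<in> hcarrier K"
  shows "hnorm E (f 0) \<le> hnorm K f"
proof (rule power2_le_imp_le)
  show "(hnorm E (f 0))\<^sup>2 \<le> (hnorm K f)\<^sup>2"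
    using L2_coeff_le[OF K_coeff[OF f], of "\<lambda>_. 0"] by (simp add: eval_zero[OF f] K_norm)
qed (use f in simp)

lemma bounded_op_C: "bounded_op H E C"
  by (rule bounded_opI[where M = 1]) (auto simp: C_def K_eval_mem C_norm_le scaleC_fun_def)

lemma hadjoint_C: "e \<in> hcarrier E \<Longrightarrow> hadjoint H E C e = P (const_fun e)"
  by (rule hadjoint_eqI[OF H.inner_space_axioms])
    (auto simp: P_inner_right inner_const_fun C_def const_fun_mem)

text \<open>By \<open>invK_T\<close> and \<open>hadjoint_C\<close> the operator is \<open>C\<close>
  followed by its adjoint.\<close>

lemma bounded_op_invK: "bounded_op H H (invK c H T)"
proof (rule bounded_op_cong)
  show "bounded_op H H (\<lambda>h. hadjoint H E C (C h))"
    by (rule bounded_op_compose[OF bounded_op_C bounded_op_hadjoint[OF H_hilbert _ bounded_op_C]])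
      unfold_locales
qed (auto simp: H.inner_space_axioms invK_T hadjoint_C C_def K_eval_mem)

lemma invK_inner:
  assumes h: "h \<in> hcarrier H" and g: "g \<in> hcarrier H"
  shows "hinner K g (invK c H T h) = hinner E (g 0) (h 0)"
  using g h by (simp add: invK_T P_inner_right const_eval_mem inner_const_fun K_eval_mem)

lemma positive_op_invK: "positive_op H (invK c H T)"
  unfolding positive_op_def
proof
  fix h assume h: "h \<in> hcarrier H"
  have m: "invK c H T h \<in> hcarrier K"
    using bounded_op_mem[OF bounded_op_invK h] by simp
  have "hinner K (invK c H T h) h = cnj (hinner E (h 0) (h 0))"
    using K.inner_commute[of h "invK c H T h"] h m by (simp add: invK_inner)
  thus "Im (hinner H (invK c H T h) h) = 0 \<and> 0 \<le> Re (hinner H (invK c H T h) h)"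
    using h by (simp add: inner_self K_eval_mem)
qed

lemma K_contraction_T: "K_contraction c H T"
  unfolding K_contraction_def
  using commuting_T invK_partial_T_tendsto bounded_op_invK positive_op_invK by blast

text \<open>Let E_0 be the projection onto the constants of H_K(E). Then a_n sigma^n(E_0), formed
  with M_z, is the projection onto degree n: its symbol is a_n a_0 / a_n = 1 there and 0 elsewhere.
  What remains after N is the compressed Taylor tail of h.\<close>

lemma pure_T: "pure_K_contraction a c H T"
  unfolding pure_K_contraction_def
proof (intro conjI ballI K_contraction_T)
  fix h assume h: "h \<in> hcarrier H"
  let ?X = "\<lambda>f. const_fun (f 0)"
  let ?S = "\<lambda>N. \<Sum>n\<le>N. complex_of_real (a n) *\<^sub>C (sigma_op K Mz ^^ n) ?X h"
  have diag: "diagonal ((sigma_op K Mz ^^ n) ?X) (\<lambda>m. if n \<le> m then (if m - n = 0 then 1 else 0) * (a (m - n) / a m) else 0)" for n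
    by (rule sigma_op_power_diagonal[OF const_fun_diagonal])
  have m: "(sigma_op K Mz ^^ n) ?X h \<in> hcarrier K" for n
    using diag[of n] h by (simp add: diagonal_def)
  have S_mem: "?S N \<in> hcarrier K" for N
    using m by auto
  have "coeff_of E (complex_of_real (a n) *\<^sub>C (sigma_op K Mz ^^ n) ?X h) \<beta> =
      (if n = msize \<beta> then 1 else 0) *\<^sub>C coeff_of E h \<beta>" for n \<beta>
    using diag[of n] h m[of n]
    by (auto simp: diagonal_def coeff_scale scaleC_fun_apply scaleC_scaleC a_0 scaleC_one)
  hence "coeff_of E (?S N) \<beta> = (\<Sum>n\<le>N. if n = msize \<beta> then 1 else 0) *\<^sub>C coeff_of E h \<beta>" for N \<beta>
    by (simp add: coeff_sum m K.scale_mem flip: scaleC_sum_left)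
  hence coeff: "coeff_of E (h - ?S N) \<beta> = (if msize \<beta> \<le> N then 0 else coeff_of E h \<beta>)" for N \<beta>
    using h S_mem[of N] by (simp add: coeff_diff scaleC_one)
  have lim: "(\<lambda>N. hnorm K (h - ?S N)) \<longlonglongrightarrow> 0"
    by (rule truncation_tendsto_0[OF _ _ coeff]) (use h S_mem in auto)
  have eq: "h - (\<Sum>n\<le>N. complex_of_real (a n) *\<^sub>C (sigma_op H T ^^ n) (invK c H T) h) = P (h - ?S N)" for N
  proof -
    have "(sigma_op H T ^^ n) (invK c H T) h = P ((sigma_op K Mz ^^ n) ?X h)" for n
      by (rule sigma_op_T_power[OF const_fun_diagonal _ h]) (rule invK_T)
    hence "(\<Sum>n\<le>N. complex_of_real (a n) *\<^sub>C (sigma_op H T ^^ n) (invK c H T) h) = (\<Sum>n\<le>N. P (complex_of_real (a n) *\<^sub>C (sigma_op K Mz ^^ n) ?X h))"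
      using m by (simp add: bounded_op_scale[OF P_bounded])
    also have "\<dots> = P (?S N)"
      using m by (intro bounded_op_sum[OF P_bounded K.inner_space_axioms, symmetric]) auto
    finally show ?thesis
      using h S_mem[of N] by (simp add: bounded_op_diff[OF P_bounded K.inner_space_axioms] P_id)
  qed
  have "(\<lambda>N. hnorm K (P (h - ?S N))) \<longlonglongrightarrow> 0"
  proof (rule Lim_null_comparison[OF _ lim], intro always_eventually allI)
    fix N
    have "h - ?S N \<in> hcarrier K"
      using h S_mem[of N] by auto
    thus "norm (hnorm K (P (h - ?S N))) \<le> hnorm K (h - ?S N)"
      using P_norm_le[of "h - ?S N"] K.norm_ge_0[of "P (h - ?S N)"] by simp
  qed
  thus "htendsto H (\<lambda>N. h - (\<Sum>n\<le>N. complex_of_real (a n) *\<^sub>C (sigma_op H T ^^ n) (invK c H T) h)) 0 sequentially"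
    by (simp add: htendsto_def eq)
qed

section \<open>The embeddings of H and the operator \<open>Delta_T\<close>\<close>

lemma
  assumes h: "h \<in> hcarrier H"
  shows tpow_adj_mem [simp]: "tpow (adj_tuple H T) \<alpha> h \<in> hcarrier H"
    and tpow_adj_eval: "tpow (adj_tuple H T) \<alpha> h 0 = of_real (1 / w \<alpha>) *\<^sub>C coeff_of E h \<alpha>"
    and tpow_adj: "tpow (adj_tuple H T) \<alpha> h = backpow \<alpha> h"
proof -
  have V: "hcarrier H \<subseteq> hcarrier K"
    by auto
  have A: "adj_tuple H T i f \<in> hcarrier H" "adj_tuple H T i f = backshift i f" if "f \<in> hcarrier H" for i f
    using that by (simp_all add: adj_tuple_T)
  note tp = tpow_backshift[where V = "hcarrier H", OF A V h]
  show mem: "tpow (adj_tuple H T) \<alpha> h \<in> hcarrier H"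
    by (rule tp(1))
  have add_0: "(\<lambda>_. 0) + \<alpha> = \<alpha>"
    by (simp add: fun_eq_iff)
  show "tpow (adj_tuple H T) \<alpha> h 0 = of_real (1 / w \<alpha>) *\<^sub>C coeff_of E h \<alpha>"
    using tp(2)[of \<alpha> "\<lambda>_. 0", unfolded add_0 w_zero] eval_zero[OF H_sub[OF mem]] by simp
  show "tpow (adj_tuple H T) \<alpha> h = backpow \<alpha> h"
    by (rule K_eqI) (use mem h tp(2) in \<open>auto simp: coeff_backpow\<close>)
qed

text \<open>The \<alpha>-th adjoint power of h has at 0 the \<alpha>-th coefficient of h divided by
  w \<alpha>; the weight in \<open>j_op\<close> restores it.\<close>

lemma j_op_C:
  assumes h: "h \<in> hcarrier H"
  shows "j_op a H E T C h = h"
proof -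
  have "(\<lambda>\<alpha>. complex_of_real (a (msize \<alpha>) * mgamma \<alpha>) *\<^sub>C C (tpow (adj_tuple H T) \<alpha> h)) = coeff_of E h"
  proof
    fix \<alpha> :: "'d multiindex"
    have "complex_of_real (w \<alpha>) *\<^sub>C C (tpow (adj_tuple H T) \<alpha> h) = coeff_of E h \<alpha>"
      using h by (simp add: C_def tpow_adj_eval scaleC_scaleC scaleC_one)
    thus "complex_of_real (a (msize \<alpha>) * mgamma \<alpha>) *\<^sub>C C (tpow (adj_tuple H T) \<alpha> h) = coeff_of E h \<alpha>"
      by (simp only: w_eq)
  qed
  thus ?thesis
    using h by (simp add: j_op_def)
qed

lemma Delta_mem [simp]: "f \<in> hcarrier K \<Longrightarrow> Delta a E f \<in> hcarrier K"
  and coeff_Delta: "f \<in> hcarrier K \<Longrightarrow>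
    coeff_of E (Delta a E f) \<beta> = of_real (a (Suc (msize \<beta>)) / a (msize \<beta>)) *\<^sub>C coeff_of E f \<beta>"
  using Delta_diagonal by (auto simp: diagonal_def)

text \<open>The canonical embedding through the defect space gives the same compression of \<open>\<Delta>\<close>
  as the inclusion, because only \<open>C\<^sub>T\<^sup>* C\<^sub>T = C\<^sup>* C\<close> enters.\<close>

lemma Delta_T_eq:
  assumes h: "h \<in> hcarrier H"
  shows "Delta_T a c H T h = P (Delta a E h)"
proof -
  define S where "S = defect_op c H T"
  \<comment> \<open>This is the hypothesis of \<open>sqrt_exists\<close>: P is a contraction, and
    the constant f(0) has the same norm in H_K(E) as in E. It ensures that SOME in
    \<open>sqrt_op\<close> really denotes a square root.\<close>
  have "(hnorm H (invK c H T f))\<^sup>2 \<le> Re (hinner H (invK c H T f) f)" if f: "f \<in> hcarrier H" for f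
  proof -
    have e: "f 0 \<in> hcarrier E"
      using f by (simp add: K_eval_mem)
    have "hinner K (const_fun (f 0)) (const_fun (f 0)) = hinner E (f 0) (f 0)"
      using e by (simp add: inner_const_fun const_fun_mem const_fun_eval)
    hence "hnorm K (const_fun (f 0)) = hnorm E (f 0)"
      by (simp add: hnorm_def)
    hence "hnorm K (invK c H T f) \<le> hnorm E (f 0)"
      using P_norm_le[OF const_fun_mem[OF e]] by (simp add: invK_T[OF f])
    moreover have m: "invK c H T f \<in> hcarrier K"
      using bounded_op_mem[OF bounded_op_invK f] by simp
    ultimately have "(hnorm K (invK c H T f))\<^sup>2 \<le> (hnorm E (f 0))\<^sup>2"
      by (intro power_mono) auto
    also have "\<dots> = Re (hinner K (invK c H T f) f)"
      using K.inner_commute[of f "invK c H T f"] f m e by (simp add: invK_inner norm_sq)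
    finally show ?thesis
      by simp
  qed
  from H.sqrt_exists[OF bounded_op_invK positive_op_invK this]
  have "bounded_op H H S \<and> positive_op H S \<and> (\<forall>x\<in>hcarrier H. S (S x) = invK c H T x)"
    unfolding S_def defect_op_def sqrt_op_def by (rule someI_ex)
  hence S: "bounded_op H H S" "positive_op H S" and SS: "\<And>f. f \<in> hcarrier H \<Longrightarrow> S (S f) = invK c H T f"
    by auto
  \<comment> \<open>Symmetry moves S across the pairing and produces its square, so the value does
    not depend on which root was chosen.\<close>
  have S_inner: "hinner K (S f) (S g) = hinner E (f 0) (g 0)" if "f \<in> hcarrier H" "g \<in> hcarrier H" for f g
    using H.positive_op_symmetric[OF S that(1) bounded_op_mem[OF S(1) that(2)]] that by (simp add: SS invK_inner)
  define Q where "Q = defect_space c H T"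
  have Q_eq: "Q = closed_image H H S"
    by (simp add: Q_def defect_space_def S_def)
  have Q_inner: "hinner Q = hinner K"
    by (simp add: Q_eq closed_image_def)
  interpret Q: hilbert Q
    unfolding Q_eq by (rule closed_image_hilbert[OF H.inner_space_axioms H_hilbert S(1)])
  interpret X: HK_space Q a w
    by unfold_locales (use a_pos a_0 a_summable a_decrease a_increase w_eq in auto)
  have S_mem: "S f \<in> hcarrier Q" if "f \<in> hcarrier H" for f
    unfolding Q_eq by (rule closed_image_memI[OF S(1) H.inner_space_axioms that])
  define \<psi> where "\<psi> f \<alpha> = complex_of_real (w \<alpha>) *\<^sub>C S (tpow (adj_tuple H T) \<alpha> f)" for f \<alpha>
  have \<psi>_mem: "\<psi> f \<alpha> \<in> hcarrier Q" if "f \<in> hcarrier H" for f \<alpha>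
    unfolding \<psi>_def by (rule Q.scale_mem[OF S_mem[OF tpow_adj_mem[OF that]]])
  \<comment> \<open>The coefficients of j f, though in another space, have the same pairings as
    those of f, index by index. Diagonal operators therefore have the same matrix elements on both
    sides.\<close>
  have \<psi>_inner: "hinner Q (\<psi> f \<alpha>) (\<psi> g \<alpha>) = hinner E (coeff_of E f \<alpha>) (coeff_of E g \<alpha>)"
    if f: "f \<in> hcarrier H" and g: "g \<in> hcarrier H" for f g \<alpha>
  proof -
    have "hinner Q (\<psi> f \<alpha>) (\<psi> g \<alpha>) = of_real (w \<alpha>) * (of_real (w \<alpha>) *
        hinner Q (S (tpow (adj_tuple H T) \<alpha> f)) (S (tpow (adj_tuple H T) \<alpha> g)))"
      unfolding \<psi>_def
      using f g by (simp add: Q.inner_scale_left Q.inner_scale_right S_mem Q.scale_mem)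
    also have "\<dots> = hinner E (coeff_of E f \<alpha>) (coeff_of E g \<alpha>)"
      using f g by (simp add: Q_inner S_inner tpow_adj_eval inner_scale_left inner_scale_right scale_mem K_coeff_mem)
    finally show ?thesis .
  qed
  have \<psi>_L2: "\<psi> f \<in> hcarrier X.L2" if f: "f \<in> hcarrier H" for f
  proof -
    have "hnorm Q (\<psi> f \<alpha>) = hnorm E (coeff_of E f \<alpha>)" for \<alpha>
      by (simp add: hnorm_def \<psi>_inner[OF f f])
    thus ?thesis
      using L2_summable[OF K_coeff[OF H_sub[OF f]]] \<psi>_mem[OF f] by (simp add: weighted_l2_mem_iff)
  qed
  define j where "j = j_op a H Q T S"
  have j_eq: "j f = of_coeffs Q (\<psi> f)" for f
    by (simp add: j_def j_op_def \<psi>_def[abs_def] w_eq)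
  have j_mem: "j f \<in> hcarrier X.K" and coeff_j: "coeff_of Q (j f) = \<psi> f" if "f \<in> hcarrier H" for f
    using \<psi>_L2[OF that] by (auto simp: j_eq)
  have "hadjoint H X.K j (Delta a Q (j h)) = P (Delta a E h)"
  proof (rule hadjoint_eqI[OF H.inner_space_axioms])
    show "P (Delta a E h) \<in> hcarrier H"
      using h by simp
    fix g assume g: "g \<in> hcarrier H"
    have cD: "coeff_of Q (Delta a Q (j h)) \<beta> = of_real (a (Suc (msize \<beta>)) / a (msize \<beta>)) *\<^sub>C \<psi> h \<beta>" for \<beta>
      using X.Delta_diagonal j_mem[OF h] coeff_j[OF h] by (simp add: X.diagonal_def)
    have "hinner X.K (j g) (Delta a Q (j h)) = hinner K g (Delta a E h)"
      unfolding X.K_inner X.L2_inner K_inner L2_inner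
    proof (rule infsum_cong)
      fix \<beta>
      show "hinner Q (coeff_of Q (j g) \<beta>) (coeff_of Q (Delta a Q (j h)) \<beta>) / of_real (w \<beta>) =
          hinner E (coeff_of E g \<beta>) (coeff_of E (Delta a E h) \<beta>) / of_real (w \<beta>)"
        using g h by (simp add: cD coeff_j coeff_Delta Q.inner_scale_right inner_scale_right \<psi>_mem \<psi>_inner K_coeff_mem)
    qed
    thus "hinner X.K (j g) (Delta a Q (j h)) = hinner H g (P (Delta a E h))"
      using g h by (simp add: P_inner_right)
  qed
  thus ?thesis
    by (simp add: Delta_T_def Let_def j_def Q_def S_def)
qed

text \<open>The identity of \<open>Mz_Delta_backshift\<close> as a sesquilinear form, with M_z moved
  to the other side of the pairing.\<close>

lemma sum_inner_Delta:
  assumes f: "f \<in> hcarrier K" and g: "g \<in> hcarrier K"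
  shows "(\<Sum>i\<in>UNIV. hinner K (backshift i g) (Delta a E (backshift i f))) = hinner K g f - hinner E (g 0) (f 0)"
proof -
  have "hinner K (backshift i g) (Delta a E (backshift i f)) = hinner K g (Mz i (Delta a E (backshift i f)))" for i
  proof -
    have "hinner K (Mz i (Delta a E (backshift i f))) g = hinner K (Delta a E (backshift i f)) (backshift i g)"
      using f g by (intro inner_Mz_backshift) auto
    thus ?thesis
      using K.inner_commute[of "Mz i (Delta a E (backshift i f))" g]
        K.inner_commute[of "Delta a E (backshift i f)" "backshift i g"] f g by simp
  qed
  hence "(\<Sum>i\<in>UNIV. hinner K (backshift i g) (Delta a E (backshift i f))) =
      hinner K g (\<Sum>i\<in>UNIV. Mz i (Delta a E (backshift i f)))"
    using f g by (simp add: K.inner_sum_right)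
  also have "\<dots> = hinner K g f - hinner E (g 0) (f 0)"
    unfolding Mz_Delta_backshift[OF f]
    using f g by (simp add: K.inner_diff_right const_eval_mem inner_const_fun K_eval_mem)
  finally show ?thesis .
qed

section \<open>The operators B and D and the conditions (K1) to (K4)\<close>

definition B :: "'f \<Rightarrow> (complex ^ 'd \<Rightarrow> 'e) ^ 'd"
  where "B = column_op (\<lambda>i x. backshift i (G x))"

definition D :: "'f \<Rightarrow> 'e"
  where "D = W 0"

lemma B_nth [simp]: "B x $ i = backshift i (G x)"
  by (simp add: B_def column_op_def)

lemma bounded_op_D: "bounded_op Estar E D"
  unfolding D_def by (rule W_bounded) simp

lemma D_eval: "D x = G x 0"
  by (simp add: D_def G_eval)

lemma bounded_op_backshift: "bounded_op K K (backshift i)"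
  by (rule bounded_op_cong[OF bounded_op_hadjoint[OF K_hilbert K.inner_space_axioms bounded_op_Mz[of i]] K.inner_space_axioms])
    (use adj_tuple_Mz in \<open>simp add: adj_tuple_def\<close>)

lemma bounded_op_B: "bounded_op Estar (hpower H) B"
  unfolding B_def
proof (rule bounded_op_column)
  fix i
  have b: "bounded_op Estar K (\<lambda>x. backshift i (G x))"
    by (rule bounded_op_compose[OF G_bounded bounded_op_backshift Estar.inner_space_axioms K.inner_space_axioms])
  thus "bounded_op Estar H (\<lambda>x. backshift i (G x))"
    using backshift_G by (auto simp: bounded_op_def)
qed unfold_locales

lemma hpower_H: "inner_space (hpower H :: ((complex ^ 'd \<Rightarrow> 'e) ^ 'd) hilbert)"
  by (rule inner_space_hpower[OF H.inner_space_axioms])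

lemma bounded_op_adj_column: "bounded_op H (hpower H) (column_op (adj_tuple H T))"
  by (rule bounded_op_column)
    (auto simp: adj_tuple_def[abs_def] H.inner_space_axioms intro!: bounded_op_hadjoint H_hilbert bounded_op_T)

text \<open>The common core of (K2) and (K3): f ranges over H in the one and is G x in the other.
  The P inside v disappears because it is paired with components of B y, which lie in H.\<close>

lemma inner_hadjoint_B:
  assumes f: "f \<in> hcarrier K" and y: "y \<in> hcarrier Estar"
    and v: "\<And>i. v $ i = P (Delta a E (backshift i f))"
  shows "hadjoint Estar (hpower H) B v \<in> hcarrier Estar"
    and "hinner Estar y (hadjoint Estar (hpower H) B v) = hinner K (G y) f - hinner E (D y) (f 0)"
proof -
  have vm: "v \<in> hcarrier (hpower H)"
    using f by (simp add: hpower_def v)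
  show "hadjoint Estar (hpower H) B v \<in> hcarrier Estar"
    by (rule hadjoint_mem[OF Estar.hilbert_axioms hpower_H bounded_op_B vm])
  have "hinner Estar y (hadjoint Estar (hpower H) B v) = (\<Sum>i\<in>UNIV. hinner K (backshift i (G y)) (Delta a E (backshift i f)))"
    using hadjoint_inner[OF Estar.hilbert_axioms hpower_H bounded_op_B vm y] f y
    by (simp add: hpower_def v P_inner_right)
  thus "hinner Estar y (hadjoint Estar (hpower H) B v) = hinner K (G y) f - hinner E (D y) (f 0)"
    using f y by (simp add: sum_inner_Delta D_eval)
qed

lemma K1:
  assumes "x \<in> hcarrier H"
  shows "hadjoint H E C (C x) = invK c H T x"
  using assms by (simp add: hadjoint_C C_def K_eval_mem invK_T)

text \<open>Here f = x lies in H, so <G y, x> vanishes and the remaining term cancels against the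
  adjoint of D.\<close>

lemma K2:
  assumes x: "x \<in> hcarrier H"
  shows "hadjoint Estar E D (C x) + hadjoint Estar (hpower H) B (dsum_op (Delta_T a c H T) (column_op (adj_tuple H T) x)) = 0"
proof (rule Estar.eqI_inner)
  let ?v = "dsum_op (Delta_T a c H T) (column_op (adj_tuple H T) x)"
  have v: "?v $ i = P (Delta a E (backshift i x))" for i
    using x by (simp add: dsum_op_def column_op_def adj_tuple_T Delta_T_eq)
  have Cx: "C x \<in> hcarrier E"
    using x by (simp add: C_def K_eval_mem)
  note DC = hadjoint_mem[OF Estar.hilbert_axioms inner_space_axioms bounded_op_D Cx]
    hadjoint_inner[OF Estar.hilbert_axioms inner_space_axioms bounded_op_D Cx]
  note Bv = inner_hadjoint_B[OF H_sub[OF x] _ v]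
  show "hadjoint Estar E D (C x) + hadjoint Estar (hpower H) B ?v \<in> hcarrier Estar"
    using DC(1) Bv(1)[OF Estar.zero_mem] by auto
  fix y assume y: "y \<in> hcarrier Estar"
  show "hinner Estar y (hadjoint Estar E D (C x) + hadjoint Estar (hpower H) B ?v) = hinner Estar y 0"
    using DC Bv[OF y] y x by (simp add: Estar.inner_add_right G_orthogonal C_def)
qed simp

text \<open>Here f = G x, and the isometry turns <G y, G x> into <y, x>.\<close>

lemma K3:
  assumes x: "x \<in> hcarrier Estar"
  shows "hadjoint Estar E D (D x) + hadjoint Estar (hpower H) B (dsum_op (Delta_T a c H T) (B x)) = x"
proof (rule Estar.eqI_inner)
  let ?v = "dsum_op (Delta_T a c H T) (B x)"
  have v: "?v $ i = P (Delta a E (backshift i (G x)))" for i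
    using x by (simp add: dsum_op_def Delta_T_eq)
  have Dx: "D x \<in> hcarrier E"
    by (rule bounded_op_mem[OF bounded_op_D x])
  note DC = hadjoint_mem[OF Estar.hilbert_axioms inner_space_axioms bounded_op_D Dx]
    hadjoint_inner[OF Estar.hilbert_axioms inner_space_axioms bounded_op_D Dx]
  note Bv = inner_hadjoint_B[OF G_mem[OF x] _ v]
  show "hadjoint Estar E D (D x) + hadjoint Estar (hpower H) B ?v \<in> hcarrier Estar"
    using DC(1) Bv(1)[OF Estar.zero_mem] by auto
  fix y assume y: "y \<in> hcarrier Estar"
  show "hinner Estar y (hadjoint Estar E D (D x) + hadjoint Estar (hpower H) B ?v) = hinner Estar y x"
    using DC Bv[OF y] y x by (simp add: Estar.inner_add_right G_inner D_eval)
qed (rule x)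

text \<open>For (K4): since the embedding given by C is the inclusion, the preimage under the
  adjoint column is the function G x itself.\<close>

lemma K4:
  assumes x: "x \<in> hcarrier Estar"
  shows "dsum_op (j_op a H E T C) (B x) = column_op (adj_tuple K Mz) (G x)"
  using x by (simp add: dsum_op_def column_op_def vec_eq_iff j_op_C adj_tuple_Mz)

section \<open>The operator \<open>F_ZT\<close> and the realization formula\<close>

lemma backpow_add: "\<lbrakk>f \<in> hcarrier K; g \<in> hcarrier K\<rbrakk> \<Longrightarrow> backpow \<alpha> (f + g) = backpow \<alpha> f + backpow \<alpha> g"
  by (rule K_eqI) (auto simp: K.add_mem coeff_backpow coeff_add scaleC_add_right)

lemma backpow_scale: "f \<in> hcarrier K \<Longrightarrow> backpow \<alpha> (b *\<^sub>C f) = b *\<^sub>C backpow \<alpha> f"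
  by (rule K_eqI) (auto simp: K.scale_mem coeff_backpow coeff_scale scaleC_fun_apply scaleC_scaleC mult.commute)

definition F_term :: "complex ^ 'd \<Rightarrow> nat \<Rightarrow> (complex ^ 'd \<Rightarrow> 'e) \<Rightarrow> complex ^ 'd \<Rightarrow> 'e"
  where "F_term z n h = complex_of_real (a (Suc n)) *\<^sub>C
    (\<Sum>\<alpha> | msize \<alpha> = n. (complex_of_real (mgamma \<alpha>) * zpow z \<alpha>) *\<^sub>C tpow (adj_tuple H T) \<alpha> h)"

lemma F_term_mem: "h \<in> hcarrier H \<Longrightarrow> F_term z n h \<in> hcarrier H"
  unfolding F_term_def by (intro H.scale_mem H.sum_mem tpow_adj_mem)

text \<open>\<open>F_term_bound\<close> and the growth estimate of \<open>weight_growth\<close> give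
  a summable majorant for the terms, so a norm limit exists and SOME picks one.\<close>

lemma F_ZT:
  assumes z: "z \<in> ball 0 1"
  shows "bounded_op H H (F_ZT a H T z)"
    and "norm_limit_op H H (\<lambda>N h. \<Sum>n\<le>N. F_term z n h) (F_ZT a H T z)"
proof -
  obtain M where M: "\<And>n. a n \<le> M * a (Suc n)"
    using a_decrease by blast
  obtain S where S: "\<And>m n. a m \<le> S n * a (m + n)" "\<And>n. 0 \<le> S n"
    "summable (\<lambda>n. a (Suc n) * (norm z ^ n * sqrt (S n)))"
    by (rule weight_growth[OF a_pos M ratio, of "norm z"]) (use z in auto)
  have bound: "hnorm H (F_term z n h) \<le> a (Suc n) * (norm z ^ n * sqrt (S n)) * hnorm H h"
    if h: "h \<in> hcarrier H" for n h
  proof -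
    have "hnorm K (\<Sum>\<alpha> | msize \<alpha> = n. (complex_of_real (mgamma \<alpha>) * zpow z \<alpha>) *\<^sub>C backpow \<alpha> h) \<le>
        norm z ^ n * sqrt (S n) * hnorm K h"
      by (rule F_term_bound[OF H_sub[OF h] S(1)])
    moreover have "hnorm K (F_term z n h) = a (Suc n) *
        hnorm K (\<Sum>\<alpha> | msize \<alpha> = n. (complex_of_real (mgamma \<alpha>) * zpow z \<alpha>) *\<^sub>C backpow \<alpha> h)"
      using h by (simp add: F_term_def tpow_adj K.norm_scale K.sum_mem K.scale_mem)
    ultimately show ?thesis
      by (simp add: mult.assoc mult_left_mono)
  qed
  have bd: "bounded_op H H (F_term z n)" for n
  proof (rule bounded_opI[OF F_term_mem _ _ bound])
    fix f g assume "f \<in> hcarrier H" "g \<in> hcarrier H"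
    thus "F_term z n (f + g) = F_term z n f + F_term z n g"
      by (simp add: F_term_def tpow_adj H.add_mem backpow_add scaleC_add_right sum.distrib)
  next
    fix b f assume "f \<in> hcarrier H"
    thus "F_term z n (b *\<^sub>C f) = b *\<^sub>C F_term z n f"
      by (simp add: F_term_def tpow_adj H.scale_mem backpow_scale scaleC_sum_right scaleC_scaleC mult_ac)
  qed
  obtain L where "bounded_op H H L" "norm_limit_op H H (\<lambda>N h. \<Sum>n\<le>N. F_term z n h) L"
    by (rule H.operator_series[of "F_term z", OF bd bound _ S(3)]) (use S(2) in auto)
  hence "\<exists>L. bounded_op H H L \<and> norm_limit_op H H (\<lambda>N h. \<Sum>n\<le>N. F_term z n h) L"
    by blast
  from someI_ex[OF this]
  show "bounded_op H H (F_ZT a H T z)"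
    "norm_limit_op H H (\<lambda>N h. \<Sum>n\<le>N. F_term z n h) (F_ZT a H T z)"
    by (simp_all add: F_ZT_def F_term_def)
qed

text \<open>Norm convergence on H passes to values at 0, where the term of index \<alpha> and degree
  n carries the factor a_(n+1) \<gamma>_\<alpha> / w \<alpha> = a_(n+1) / a_n, the symbol of
  \<Delta>. Both sides are then limits in E of the same sums by degree.\<close>

lemma F_ZT_eval:
  assumes z: "z \<in> ball 0 1" and h: "h \<in> hcarrier H"
  shows "F_ZT a H T z h 0 = Delta a E h z"
proof (rule tendsto_unique)
  let ?L = "F_ZT a H T z h"
  have mem: "(\<Sum>n\<le>N. F_term z n h) \<in> hcarrier H" for N
    using F_term_mem[OF h] by auto
  have L: "?L \<in> hcarrier H"
    by (rule bounded_op_mem[OF F_ZT(1)[OF z] h])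
  have "(\<lambda>N. hnorm H ((\<Sum>n\<le>N. F_term z n h) - ?L)) \<longlonglongrightarrow> 0"
  proof (rule LIMSEQ_I)
    fix e :: real assume e: "e > 0"
    \<comment> \<open>Adding 1 covers h = 0 and makes the resulting bound strict.\<close>
    have p: "hnorm H h + 1 > 0"
      using h by (simp add: add_nonneg_pos)
    then obtain N where N: "\<And>n. n \<ge> N \<Longrightarrow> hnorm H ((\<Sum>k\<le>n. F_term z k h) - ?L) \<le> e / (hnorm H h + 1) * hnorm H h"
      using F_ZT(2)[OF z] e h unfolding norm_limit_op_def by (metis divide_pos_pos)
    have "e / (hnorm H h + 1) * hnorm H h < e"
      using p e by (simp add: field_simps)
    moreover have "0 \<le> hnorm H ((\<Sum>k\<le>n. F_term z k h) - ?L)" for n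
      using mem[of n] L by (intro H.norm_ge_0) auto
    ultimately have "\<forall>n\<ge>N. norm (hnorm H ((\<Sum>k\<le>n. F_term z k h) - ?L) - 0) < e"
      using N by fastforce
    thus "\<exists>N. \<forall>n\<ge>N. norm (hnorm H ((\<Sum>k\<le>n. F_term z k h) - ?L) - 0) < e"
      by blast
  qed
  hence "htendsto H (\<lambda>N. \<Sum>n\<le>N. F_term z n h) ?L sequentially"
    using L by (simp add: htendsto_def)
  from bounded_op_htendsto[OF bounded_op_C H.inner_space_axioms inner_space_axioms mem this]
  show "htendsto E (\<lambda>N. C (\<Sum>n\<le>N. F_term z n h)) (?L 0) sequentially"
    by (simp add: C_def)
  have F_term_eval: "F_term z n h 0 = (\<Sum>\<alpha> | msize \<alpha> = n. zpow z \<alpha> *\<^sub>C coeff_of E (Delta a E h) \<alpha>)" for n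
  proof -
    have "F_term z n h 0 = (\<Sum>\<alpha> | msize \<alpha> = n. (of_real (a (Suc n)) * (of_real (mgamma \<alpha>) * zpow z \<alpha>) * of_real (1 / w \<alpha>)) *\<^sub>C coeff_of E h \<alpha>)"
      using h by (simp add: F_term_def scaleC_fun_apply sum_fun_eval tpow_adj_eval scaleC_sum_right scaleC_scaleC mult.assoc)
    also have "\<dots> = (\<Sum>\<alpha> | msize \<alpha> = n. zpow z \<alpha> *\<^sub>C coeff_of E (Delta a E h) \<alpha>)"
    proof (rule sum.cong)
      fix \<alpha> :: "'d multiindex" assume "\<alpha> \<in> {\<alpha>. msize \<alpha> = n}"
      hence "of_real (a (Suc n)) * (of_real (mgamma \<alpha>) * zpow z \<alpha>) * complex_of_real (1 / w \<alpha>) =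
          zpow z \<alpha> * of_real (a (Suc (msize \<alpha>)) / a (msize \<alpha>))"
        using less_imp_neq[OF mgamma_pos[of \<alpha>]] by (auto simp: w_eq field_simps)
      thus "(of_real (a (Suc n)) * (of_real (mgamma \<alpha>) * zpow z \<alpha>) * complex_of_real (1 / w \<alpha>)) *\<^sub>C coeff_of E h \<alpha> =
          zpow z \<alpha> *\<^sub>C coeff_of E (Delta a E h) \<alpha>"
        using h by (simp only: coeff_Delta[OF H_sub[OF h]] scaleC_scaleC)
    qed simp
    finally show ?thesis .
  qed
  have CS: "C (\<Sum>n\<le>N. F_term z n h) = (\<Sum>\<alpha> | msize \<alpha> \<le> N. zpow z \<alpha> *\<^sub>C coeff_of E (Delta a E h) \<alpha>)" for N
    by (simp add: C_def sum_fun_eval F_term_eval sum_msize_le)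
  have D: "Delta a E h \<in> hcarrier K"
    using h by simp
  have "htendsto E (\<lambda>A. \<Sum>\<alpha>\<in>A. zpow z \<alpha> *\<^sub>C coeff_of E (Delta a E h) \<alpha>) (Delta a E h z) (finite_subsets_at_top UNIV)"
    using K_taylor[OF D] z by (simp add: taylor_coeffs_def)
  hence "Delta a E h z \<in> hcarrier E"
    "(\<lambda>N. hnorm E ((\<Sum>\<alpha> | msize \<alpha> \<le> N. zpow z \<alpha> *\<^sub>C coeff_of E (Delta a E h) \<alpha>) - Delta a E h z)) \<longlonglongrightarrow> 0"
    unfolding htendsto_def by (auto intro: filterlim_compose[OF _ filterlim_msize_le])
  thus "htendsto E (\<lambda>N. C (\<Sum>n\<le>N. F_term z n h)) (Delta a E h z) sequentially"
    by (simp add: htendsto_def CS)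
  show "C (\<Sum>n\<le>N. F_term z n h) \<in> hcarrier E" for N
    by (rule bounded_op_mem[OF bounded_op_C mem])
qed simp

text \<open>For fixed z the number z_i may be moved out of \<Delta>, and multiplying by it agrees
  with applying \<open>Mz i\<close> and evaluating at that same z.\<close>

lemma W_realization:
  assumes z: "z \<in> ball 0 1" and x: "x \<in> hcarrier Estar"
  shows "W z x = D x + C (F_ZT a H T z (row_Z z (B x)))"
proof -
  let ?h = "row_Z z (B x)"
  have h_eq: "?h = (\<Sum>i\<in>UNIV. (z $ i) *\<^sub>C backshift i (G x))"
    by (simp add: row_Z_def)
  have m: "backshift i (G x) \<in> hcarrier K" for i
    using x by simp
  have h: "?h \<in> hcarrier H"
    unfolding h_eq using x by (intro H.sum_mem H.scale_mem) simp
  have "Delta a E ?h = (\<Sum>i\<in>UNIV. (z $ i) *\<^sub>C Delta a E (backshift i (G x)))"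
  proof (rule K_eqI)
    show "(\<Sum>i\<in>UNIV. (z $ i) *\<^sub>C Delta a E (backshift i (G x))) \<in> hcarrier K"
      using m by (intro K.sum_mem K.scale_mem) simp
    show "coeff_of E (Delta a E ?h) \<beta> = coeff_of E (\<Sum>i\<in>UNIV. (z $ i) *\<^sub>C Delta a E (backshift i (G x))) \<beta>" for \<beta>
      using m h by (simp only: coeff_Delta[OF H_sub[OF h]])
        (simp add: h_eq coeff_sum K.scale_mem coeff_scale scaleC_fun_apply coeff_Delta scaleC_sum_right scaleC_scaleC mult.commute)
  qed (use h in simp)
  hence "Delta a E ?h z = (\<Sum>i\<in>UNIV. Mz i (Delta a E (backshift i (G x)))) z"
    by (simp add: sum_fun_eval scaleC_fun_apply Mz_def)
  also have "\<dots> = W z x - W 0 x"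
    unfolding Mz_Delta_backshift[OF G_mem[OF x]]
    using z const_fun_eval[OF K_eval_mem[OF G_mem[OF x], of 0] z] by (simp add: G_eval)
  finally show ?thesis
    by (simp add: D_def C_def F_ZT_eval[OF z h])
qed

end

section \<open>Realization of \<open>K\<close>-inner functions\<close>

lemma summable_of_complex_sums:
  assumes "(\<lambda>n. complex_of_real (f n)) sums s"
  shows "summable f"
  using sums_summable[OF sums_Re[OF assms]] by simp

text \<open>The Cauchy product of the two series is the constant 1, and coefficients of a power
  series are unique.\<close>

lemma reciprocal_coefficients:
  fixes a :: "nat \<Rightarrow> real"
  assumes k: "\<And>z. z \<in> ball 0 1 \<Longrightarrow> (\<lambda>n. complex_of_real (a n) * z ^ n) sums k z"
    and k0: "\<And>z. z \<in> ball 0 1 \<Longrightarrow> k z \<noteq> 0"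
    and c: "\<And>z. z \<in> ball 0 1 \<Longrightarrow> (\<lambda>n. c n * z ^ n) sums (1 / k z)"
  shows "(\<Sum>n\<le>m. c n * of_real (a (m - n))) = (if m = 0 then 1 else 0)"
proof -
  have "(\<Sum>n\<le>m. c n * of_real (a (m - n))) - (if m = 0 then 1 else 0) = 0"
  proof (rule power_series_zero[of 1 "\<lambda>m. (\<Sum>n\<le>m. c n * of_real (a (m - n))) - (if m = 0 then 1 else 0)"])
    fix z :: complex assume "cmod z < 1"
    hence z: "z \<in> ball 0 1" by simp
    \<comment> \<open>Convergence at a radius t strictly between |z| and 1 makes both series
      absolutely convergent at z.\<close>
    obtain t where t: "cmod z < t" "t < 1"
      using \<open>cmod z < 1\<close> dense by blast
    have tb: "complex_of_real t \<in> ball 0 1" "norm z < norm (complex_of_real t)"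
      using t le_less_trans[OF norm_ge_zero t(1)] by (auto simp: abs_of_pos)
    have abs_a: "summable (\<lambda>n. norm (complex_of_real (a n) * z ^ n))"
      by (rule powser_insidea[OF sums_summable[OF k[OF tb(1)]] tb(2)])
    have abs_c: "summable (\<lambda>n. norm (c n * z ^ n))"
      by (rule powser_insidea[OF sums_summable[OF c[OF tb(1)]] tb(2)])
    have "(\<lambda>m. \<Sum>n\<le>m. (c n * z ^ n) * (complex_of_real (a (m - n)) * z ^ (m - n))) sums
        ((\<Sum>n. c n * z ^ n) * (\<Sum>n. complex_of_real (a n) * z ^ n))"
      by (rule Cauchy_product_sums[OF abs_c abs_a])
    moreover have "(\<Sum>n\<le>m. (c n * z ^ n) * (complex_of_real (a (m - n)) * z ^ (m - n))) =
        (\<Sum>n\<le>m. c n * of_real (a (m - n))) * z ^ m" for m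
      unfolding sum_distrib_right
    proof (rule sum.cong)
      fix n assume "n \<in> {..m}"
      hence "z ^ m = z ^ n * z ^ (m - n)"
        by (simp flip: power_add)
      thus "(c n * z ^ n) * (complex_of_real (a (m - n)) * z ^ (m - n)) = c n * of_real (a (m - n)) * z ^ m"
        by simp
    qed simp
    moreover have "(\<Sum>n. c n * z ^ n) * (\<Sum>n. complex_of_real (a n) * z ^ n) = 1"
      using k0[OF z] by (simp add: sums_unique[OF k[OF z], symmetric] sums_unique[OF c[OF z], symmetric])
    ultimately have 1: "(\<lambda>m. (\<Sum>n\<le>m. c n * of_real (a (m - n))) * z ^ m) sums 1"
      by simp
    have 2: "(\<lambda>m. (if m = 0 then 1 else 0) * z ^ m) sums 1"
      using sums_single[of 0 "\<lambda>m. z ^ m"] by (simp add: if_distrib[of "\<lambda>x. x * _"] cong: if_cong)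
    show "(\<lambda>m. ((\<Sum>n\<le>m. c n * of_real (a (m - n))) - (if m = 0 then 1 else 0)) * z ^ m) sums 0"
      using sums_diff[OF 1 2] by (simp add: left_diff_distrib)
  qed simp
  thus ?thesis by simp
qed

text \<open>If r < t < 1, the terms a_n t^n eventually increase, whereas convergence of the series
  at t forces them to 0.\<close>

lemma limit_ratio_ge_1:
  fixes a :: "nat \<Rightarrow> real"
  assumes a: "\<And>n. 0 < a n" and lim: "(\<lambda>n. a n / a (Suc n)) \<longlonglongrightarrow> r"
    and s: "\<And>t. \<lbrakk>0 \<le> t; t < 1\<rbrakk> \<Longrightarrow> summable (\<lambda>n. a n * t ^ n)"
  shows "r \<ge> 1"
proof (rule ccontr)
  assume "\<not> r \<ge> 1"
  then obtain t where t: "r < t" "t < 1"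
    using dense by (metis not_le)
  have "r \<ge> 0"
    by (rule LIMSEQ_le_const[OF lim]) (use a in \<open>auto intro!: less_imp_le\<close>)
  hence t0: "t > 0"
    using t by simp
  obtain N where N: "\<And>n. n \<ge> N \<Longrightarrow> a n / a (Suc n) < t"
    using order_tendstoD(2)[OF lim t(1)] by (auto simp: eventually_sequentially)
  have inc: "a N * t ^ N \<le> a n * t ^ n" if "n \<ge> N" for n
    using that
  proof (induction n rule: dec_induct)
    case (step n)
    have "a n < t * a (Suc n)"
      using N[OF step.hyps(1)] a[of "Suc n"] by (simp add: field_simps)
    hence "a n * t ^ n \<le> t * a (Suc n) * t ^ n"
      using t0 by (intro mult_right_mono) auto
    thus ?case
      using step.IH by (simp add: mult_ac)
  qed simp
  have "(\<lambda>n. a n * t ^ n) \<longlonglongrightarrow> 0"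
    using s[of t] t t0 by (intro summable_LIMSEQ_zero) auto
  hence "a N * t ^ N \<le> 0"
    by (rule LIMSEQ_le_const) (use inc in blast)
  moreover have "0 < a N * t ^ N"
    using a t0 by simp
  ultimately show False by simp
qed

theorem theorem3p2:
  fixes k :: "complex \<Rightarrow> complex"
    and a :: "nat \<Rightarrow> real" and c :: "nat \<Rightarrow> complex" and r :: real
    and E :: "'e::complex_vector hilbert" and Estar :: "'f::complex_vector hilbert"
    and W :: "complex ^ 'd::finite \<Rightarrow> 'f \<Rightarrow> 'e"
  assumes k_series: "\<And>z. z \<in> ball 0 1 \<Longrightarrow> (\<lambda>n. complex_of_real (a n) * z ^ n) sums k z"
    and k_nonzero: "\<And>z. z \<in> ball 0 1 \<Longrightarrow> k z \<noteq> 0"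
    and a_0: "a 0 = 1"
    and a_pos: "\<And>n. 0 < a n"
    and ratio_inf: "0 < (INF n. a n / a (Suc n))"
    and ratio_sup: "bdd_above (range (\<lambda>n. a n / a (Suc n)))"
    and ratio_lim: "(\<lambda>n. a n / a (Suc n)) \<longlonglongrightarrow> r"
    and invk_series: "\<And>z. z \<in> ball 0 1 \<Longrightarrow> (\<lambda>n. c n * z ^ n) sums (1 / k z)"
    and Mz_K_contraction:
      "K_contraction c (HK a complex_hilbert)
         (Mz :: 'd \<Rightarrow> (complex ^ 'd \<Rightarrow> complex) \<Rightarrow> complex ^ 'd \<Rightarrow> complex)"
    and E_hilbert: "hilbert_space E"
    and Estar_hilbert: "hilbert_space Estar"
    and W_K_inner: "K_inner a Estar E W"
  shows "\<exists>(H :: (complex ^ 'd \<Rightarrow> 'e) hilbert)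
           (T :: 'd \<Rightarrow> (complex ^ 'd \<Rightarrow> 'e) \<Rightarrow> complex ^ 'd \<Rightarrow> 'e)
           (B :: 'f \<Rightarrow> (complex ^ 'd \<Rightarrow> 'e) ^ 'd)
           (C :: (complex ^ 'd \<Rightarrow> 'e) \<Rightarrow> 'e)
           (D :: 'f \<Rightarrow> 'e).
    hilbert_space H \<and> pure_K_contraction a c H T \<and>
    bounded_op Estar (hpower H) B \<and> bounded_op H E C \<and> bounded_op Estar E D \<and>
    bounded_op (hdirect_sum H Estar) (hdirect_sum (hpower H) E)
      (matrix_op (column_op (adj_tuple H T)) B C D) \<and>
    (\<forall>x\<in>hcarrier H. hadjoint H E C (C x) = invK c H T x) \<and>
    (\<forall>x\<in>hcarrier H.
       hadjoint Estar E D (C x)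
       + hadjoint Estar (hpower H) B
           (dsum_op (Delta_T a c H T) (column_op (adj_tuple H T) x)) = 0) \<and>
    (\<forall>x\<in>hcarrier Estar.
       hadjoint Estar E D (D x)
       + hadjoint Estar (hpower H) B (dsum_op (Delta_T a c H T) (B x)) = x) \<and>
    (\<lambda>x. dsum_op (j_op a H E T C) (B x)) ` hcarrier Estar
      \<subseteq> column_op (adj_tuple (HK a E) Mz) ` hcarrier (HK a E) \<and>
    (\<forall>z\<in>ball 0 1. \<forall>x\<in>hcarrier Estar. W z x = D x + C (F_ZT a H T z (row_Z z (B x))))"
proof -
  have summable: "summable (\<lambda>n. a n * t ^ n)" if "0 \<le> t" "t < 1" for t
    using k_series[of "complex_of_real t"] that
    by (intro summable_of_complex_sums[of _ "k (complex_of_real t)"]) simp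
  \<comment> \<open>The upper bound of the ratios controls multiplication by the
    coordinates.\<close>
  obtain M where M: "\<And>n. a n / a (Suc n) \<le> M"
    using ratio_sup by (auto simp: bdd_above_def)
  have decrease: "a n \<le> M * a (Suc n)" for n
    using M[of n] a_pos[of "Suc n"] by (simp add: field_simps)
  \<comment> \<open>The infimum of the ratios, being positive, controls \<Delta>.\<close>
  define q where "q = (INF n. a n / a (Suc n))"
  have "bdd_below (range (\<lambda>n. a n / a (Suc n)))"
    using a_pos by (intro bdd_belowI2[of _ 0]) (simp add: less_imp_le)
  hence q: "q \<le> a n / a (Suc n)" for n
    unfolding q_def by (rule cINF_lower) simp
  have increase: "a (Suc n) \<le> 1 / q * a n" for n
    using q[of n] a_pos[of "Suc n"] ratio_inf by (simp add: q_def[symmetric] field_simps)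
  interpret E: hilbert E
    by (rule hilbertI[OF E_hilbert])
  interpret Estar: hilbert Estar
    by (rule hilbertI[OF Estar_hilbert])
  interpret K_inner_model E a "\<lambda>\<alpha> :: 'd multiindex. a (msize \<alpha>) * mgamma \<alpha>" Estar c W r
  proof
    show "\<exists>M. \<forall>n. a n \<le> M * a (Suc n)" "\<exists>M. \<forall>n. a (Suc n) \<le> M * a n"
      using decrease increase by blast+
    show "(\<Sum>n\<le>m. c n * of_real (a (m - n))) = (if m = 0 then 1 else 0)" for m
      by (rule reciprocal_coefficients[OF k_series k_nonzero invk_series])
    show "1 \<le> r"
      by (rule limit_ratio_ge_1[OF a_pos ratio_lim summable])
    show "\<exists>y. htendsto (HK a complex_hilbert) (invK_partial c (HK a complex_hilbert) Mz g) y sequentially"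
      if "g \<in> hcarrier (HK a complex_hilbert)" for g :: "complex ^ 'd \<Rightarrow> complex"
      using Mz_K_contraction that by (simp add: K_contraction_def)
  qed (use a_pos a_0 summable ratio_lim W_K_inner in auto)
  have "bounded_op (hdirect_sum H Estar) (hdirect_sum (hpower H) E)
      (matrix_op (column_op (adj_tuple H T)) B C D)"
    by (rule bounded_op_matrix[OF H.inner_space_axioms Estar.inner_space_axioms hpower_H
          E.inner_space_axioms bounded_op_adj_column bounded_op_B bounded_op_C bounded_op_D])
  moreover have "(\<lambda>x. dsum_op (j_op a H E T C) (B x)) ` hcarrier Estar
      \<subseteq> column_op (adj_tuple (HK a E) Mz) ` hcarrier (HK a E)"
    using K4 G_mem by blast
  ultimately show ?thesis
    using H.hilbert_space pure_T bounded_op_B bounded_op_C bounded_op_D K1 K2 K3 W_realization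
    by (intro exI[of _ H] exI[of _ T] exI[of _ B] exI[of _ C] exI[of _ D] conjI ballI)
qed

end
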